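(* Let $(H_{\mathbb R},H_{\mathbb C},F^\bullet,W_\bullet,M,S)$ be a Steenbrink PMHS of weight $m$, with normalized Seifert form $L^{nor}$. Define $\widetilde m=m+1$, $\widetilde H_{\mathbb R}=H_{\mathbb R}$, $\widetilde H_{\mathbb C}=H_{\mathbb C}$, $\widetilde M=-M$ (so $\widetilde M_s=-M_s$, $\widetilde N=N$, and the generalized eigenspaces of $\widetilde M$ are $\widetilde H_\lambda=H_{-\lambda}$), $\widetilde W_\bullet=W^{(N,m+1)}_\bullet$ on $\widetilde H_{\ne1}$, $\widetilde W_\bullet=W^{(N,m+2)}_\bullet$ on $\widetilde H_1$, $$\widetilde\nu=\begin{cases}\frac1{\widetilde M-\mathrm{id}}&\text{on }\widetilde H_{\ne1},\\ \frac{-N}{\widetilde M-\mathrm{id}}&\text{on }\widetilde H_1,\end{cases}\qquad\widetilde S(a,b)=-L^{nor}(a,\widetilde\nu b),$$ and, for $-\lambda=e^{-2\pi i\alpha}$ with $0<\alpha\le1$, $$\widetilde F^p\widetilde H_\lambda=(G^{(\alpha+\frac12)})^{-1}G^{(\alpha)}F^{p-1}\widetilde H_\lambda\quad\text{if }0<\alpha\le\tfrac12,\qquad \widetilde F^p\widetilde H_\lambda=(G^{(\alpha-\frac12)})^{-1}G^{(\alpha)}F^{p}\widetilde H_\lambda\quad\text{if }\tfrac12<\alpha\le1.$$ Then $(\widetilde H_{\mathbb R},\widetilde H_{\mathbb C},\widetilde F^\bullet,\widetilde W_\bullet,\widetilde M,\widetilde S)$ is a Steenbrink PMHS of weight $\widetilde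 m=m+1$. Its spectral pairs are $\widetilde{\mathrm{Spp}}=\mathrm{Spp}+(\frac12,1)$. The two Steenbrink PMHS have the same underlying Seifert form pair $(H_{\mathbb R},L^{nor})$. Carrying out the construction twice leaves $(H_{\mathbb R},H_{\mathbb C},M,S)$ invariant and gives $\widetilde{\widetilde m}=m+2$, $\widetilde{\widetilde W}_\bullet=W_{\bullet-2}$, $\widetilde{\widetilde F}{}^\bullet=F^{\bullet-1}$, so it is a Tate twist.
   Context: Notation: $\theta(1)=1$, $\theta(\lambda)=0$ for $\lambda\in S^1\setminus\{1\}$. For an automorphism $M$ of a finite dimensional real space $H_{\mathbb R}$ with complexification $H_{\mathbb C}$: $M=M_sM_u=M_uM_s$ (semisimple, unipotent), $N=\log M_u$, $H_\lambda=\ker(M_s-\lambda\,\mathrm{id})\subset H_{\mathbb C}$, $H_{\ne1}=\bigoplus_{\lambda\ne1}H_\lambda$; $\widetilde H_\lambda,\widetilde H_{\ne 1}$ are the analogous spaces for $\widetilde M$. $F^pH_\lambda$ means $F^p\cap H_\lambda$. For a nilpotent $N$ and $w\in\mathbb{Z}$, $W^{(N,w)}_\bullet$ is the unique increasing filtration with $N(W_k)\subset W_{k-2}$ and $N^l:\mathrm{Gr}^W_{w+l}\to\mathrm{Gr}^W_{w-l}$ an isomorphism for $l\ge0$; $P_{w+l}=\ker(N^{l+1}:\mathrm{Gr}^W_{w+l}\to\mathrm{Gr}^W_{w-l-2})$ for $l\ge0$. If $N$ is an infinitesimal isometry of a nondegenerate $(-1)^w$-symmetric form $S$, then $S_l(a,b)=S(\tilde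 a,N^l\tilde b)$ ($\tilde a,\tilde b\in W_{w+l}$ representatives) is well defined on $\mathrm{Gr}^W_{w+l}$. A mixed Hodge structure (MHS) $(H_{\mathbb R},H_{\mathbb C},F^\bullet,W_\bullet)$: decreasing filtration $F^\bullet$ of $H_{\mathbb C}$, increasing filtration $W_\bullet$ of $H_{\mathbb R}$, such that $F^\bullet\mathrm{Gr}^W_k$ is a pure Hodge structure of weight $k$. A polarized MHS (PMHS) of weight $w$ $(H_{\mathbb R},H_{\mathbb C},F^\bullet,W_\bullet,N,S)$: a MHS with $W_\bullet=W_\bullet^{(N,w)}$, $S$ nondegenerate $(-1)^w$-symmetric on $H_{\mathbb R}$, $N$ a nilpotent infinitesimal isometry of $S$, $N(F^p)\subset F^{p-1}$, $S(F^p,F^{w+1-p})=0$, and $i^{2p-w-l}S_l(a,\overline a)>0$ for $0\ne a\in F^pP_{w+l}\cap\overline{F^{w+l-p}P_{w+l}}$. A Steenbrink MHS of weight $m$: a MHS with an automorphism $M$ of $(H_{\mathbb R},H_{\mathbb C},W_\bullet)$ such that $M_s(F^p)\subset F^p$, $N(F^p)\subset F^{p-1}$, $W_\bullet=W_\bullet^{(N,m)}$ on $H_{\ne1}$, $W_\bullet=W_\bullet^{(N,m+1)}$ on $H_1$. A Steenbrink PMHS of weight $m$: a Steenbrink MHS with a nondegenerate $M$-invariant bilinear form $S$ on $H_{\mathbb R}$ such that the restriction to $H_{\ne1}$ is a PMHS of weight $m$ and the restriction to $H_1$ is a PMHS of weight $m+1$. All eigenvalues of $M$ are then in $S^1$.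 $G^{(\beta)}:=\Gamma(\beta\,\mathrm{id}-\frac N{2\pi i})=\sum_{k\ge0}\frac1{k!}\Gamma^{(k)}(\beta)\left(\frac{-N}{2\pi i}\right)^k$ for $\beta\in(0,1]$, considered as an automorphism of the relevant $N$-invariant space $\widetilde H_\lambda=H_{-\lambda}$. Normalized Seifert form of a Steenbrink PMHS: $L^{nor}(a,b)=-S(a,\nu^{-1}b)$ with $\nu=\frac1{M-\mathrm{id}}$ on $H_{\ne1}$ and $\nu=\frac{-N}{M-\mathrm{id}}$ on $H_1$, where $\frac{N}{M-\mathrm{id}}$ on $H_1$ is the inverse of $\sum_{k\ge1}\frac1{k!}N^{k-1}$. Spectral pairs: $\mathrm{Spp}=\sum d(\alpha,k)\cdot(\alpha,k)\in\mathbb{Z}_{\ge0}[\mathbb{R}\times\mathbb{Z}]$ with $d(\alpha,k)=\dim\mathrm{Gr}_F^{\lfloor m-\alpha\rfloor}\mathrm{Gr}^W_{k+\theta(\lambda)}H_\lambda$ for $\lambda=e^{-2\pi i\alpha}$. $\mathrm{Spp}+(\frac12,1)$ means that each pair is shifted by $(\frac12,1)$. *)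

theory Defs
  imports "HOL-Analysis.Analysis"
begin

section \<open>Complexification of a real vector space\<close>

text \<open>
  The real space \<open>H\<^sub>\<real>\<close> is the type \<open>'a\<close>, and \<open>H\<^sub>\<complex> = H\<^sub>\<real> \<oplus> i H\<^sub>\<real>\<close> is \<open>'a \<times> 'a\<close>, the pair
  \<open>(x, y)\<close> standing for \<open>x + i y\<close>.
\<close>

type_synonym 'a cplx = "'a \<times> 'a"

definition cscale :: "complex \<Rightarrow> 'a::real_vector cplx \<Rightarrow> 'a cplx" where
  "cscale z v = (Re z *\<^sub>R fst v - Im z *\<^sub>R snd v, Re z *\<^sub>R snd v + Im z *\<^sub>R fst v)"

global_interpretation cplx: vector_space "cscale :: complex \<Rightarrow> 'a::real_vector cplx \<Rightarrow> 'a cplx"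
  by unfold_locales (auto simp: cscale_def algebra_simps)

definition cj :: "'a::real_vector cplx \<Rightarrow> 'a cplx" where
  "cj v = (fst v, - snd v)"

definition cmap :: "('a \<Rightarrow> 'a) \<Rightarrow> 'a::real_vector cplx \<Rightarrow> 'a cplx" where
  "cmap T v = (T (fst v), T (snd v))"

definition cset :: "'a::real_vector set \<Rightarrow> 'a cplx set" where
  "cset V = V \<times> V"

definition real_points :: "'a::real_vector cplx set \<Rightarrow> 'a set" where
  "real_points V = {x. (x, 0) \<in> V}"

text \<open>The complex bilinear (not sesquilinear) extension of a real bilinear form.\<close>

definition cform :: "('a \<Rightarrow> 'a \<Rightarrow> real) \<Rightarrow> 'a::real_vector cplx \<Rightarrow> 'a cplx \<Rightarrow> complex" where
  "cform S a b = Complex (S (fst a) (fst b) - S (snd a) (snd b))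
                         (S (fst a) (snd b) + S (snd a) (fst b))"

definition set_sum :: "'b::ab_group_add set \<Rightarrow> 'b set \<Rightarrow> 'b set" where
  "set_sum A B = {a + b |a b. a \<in> A \<and> b \<in> B}"

definition finite_dimensional :: "'a::real_vector set \<Rightarrow> bool" where
  "finite_dimensional V \<longleftrightarrow> (\<exists>B. finite B \<and> span B = V)"

section \<open>Jordan decomposition\<close>

definition nilpotent_on :: "'a::real_vector set \<Rightarrow> ('a \<Rightarrow> 'a) \<Rightarrow> bool" where
  "nilpotent_on V T \<longleftrightarrow> (\<exists>n. \<forall>x\<in>V. (T ^^ n) x = 0)"

text \<open>A real operator is semisimple iff its complexification is diagonalizable.\<close>

definition semisimple :: "('a::real_vector \<Rightarrow> 'a) \<Rightarrow> bool" where
  "semisimple T \<longleftrightarrow> cplx.span {v. \<exists>c. cmap T v = cscale c v} = UNIV"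

definition unipotent :: "('a::real_vector \<Rightarrow> 'a) \<Rightarrow> bool" where
  "unipotent T \<longleftrightarrow> nilpotent_on UNIV (\<lambda>x. T x - x)"

definition jordan_decomposition ::
    "('a::real_vector \<Rightarrow> 'a) \<Rightarrow> ('a \<Rightarrow> 'a) \<Rightarrow> ('a \<Rightarrow> 'a) \<Rightarrow> bool" where
  "jordan_decomposition M s u \<longleftrightarrow>
     linear s \<and> linear u \<and> semisimple s \<and> unipotent u \<and> M = s \<circ> u \<and> M = u \<circ> s"

definition semisimple_part :: "('a::real_vector \<Rightarrow> 'a) \<Rightarrow> 'a \<Rightarrow> 'a" where
  "semisimple_part M = (THE s. \<exists>u. jordan_decomposition M s u)"

definition unipotent_part :: "('a::real_vector \<Rightarrow> 'a) \<Rightarrow> 'a \<Rightarrow> 'a" where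
  "unipotent_part M = (THE u. \<exists>s. jordan_decomposition M s u)"

text \<open>
  Power series \<open>\<Sum>k c\<^sub>k T\<^sup>k\<close> in a nilpotent operator \<open>T\<close>. The powers \<open>T\<^sup>k\<close> with \<open>k \<ge> dim H\<^sub>\<real>\<close> vanish,
  so the sum over \<open>k < dim H\<^sub>\<real>\<close> is the full series. The second version is for complex coefficients
  and operators on \<open>H\<^sub>\<complex>\<close>, whose complex dimension is \<open>dim H\<^sub>\<real>\<close>.
\<close>

definition nil_series :: "(nat \<Rightarrow> real) \<Rightarrow> ('a::real_vector \<Rightarrow> 'a) \<Rightarrow> 'a \<Rightarrow> 'a" where
  "nil_series c T x = (\<Sum>k<dim (UNIV :: 'a set). c k *\<^sub>R (T ^^ k) x)"

definition cnil_series ::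
    "(nat \<Rightarrow> complex) \<Rightarrow> ('a::real_vector cplx \<Rightarrow> 'a cplx) \<Rightarrow> 'a cplx \<Rightarrow> 'a cplx" where
  "cnil_series c T v = (\<Sum>k<dim (UNIV :: 'a set). cscale (c k) ((T ^^ k) v))"

text \<open>\<open>N = log M\<^sub>u\<close>\<close>

definition log_unipotent :: "('a::real_vector \<Rightarrow> 'a) \<Rightarrow> 'a \<Rightarrow> 'a" where
  "log_unipotent M =
     nil_series (\<lambda>k. if k = 0 then 0 else (-1) ^ (k + 1) / real k) (\<lambda>x. unipotent_part M x - x)"

definition eigsp :: "('a::real_vector \<Rightarrow> 'a) \<Rightarrow> complex \<Rightarrow> 'a cplx set" where
  "eigsp M c = {v. cmap (semisimple_part M) v = cscale c v}"

definition eigsp_ne1 :: "('a::real_vector \<Rightarrow> 'a) \<Rightarrow> 'a cplx set" where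
  "eigsp_ne1 M = cplx.span (\<Union>c\<in>-{1}. eigsp M c)"

section \<open>Filtrations and (polarized) mixed Hodge structures\<close>

text \<open>
  All structures live on a real subspace \<open>V\<close> of the ambient space, with complexification \<open>cset V\<close>;
  forms and operators are given on the ambient space and restricted to \<open>V\<close>.
  A subspace of a quotient \<open>A/B\<close> is represented by its preimage in \<open>A\<close>, a subspace between
  \<open>B\<close> and \<open>A\<close>. Filtrations are finite (exhaustive and separated).
\<close>

definition increasing_filtration :: "'a::real_vector set \<Rightarrow> (int \<Rightarrow> 'a set) \<Rightarrow> bool" where
  "increasing_filtration V W \<longleftrightarrow>
     (\<forall>k. subspace (W k) \<and> W k \<subseteq> V) \<and> (\<forall>j k. j \<le> k \<longrightarrow> W j \<subseteq> W k) \<and>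
     (\<exists>k. W k = {0}) \<and> (\<exists>k. W k = V)"

definition decreasing_filtration :: "'a::real_vector set \<Rightarrow> (int \<Rightarrow> 'a cplx set) \<Rightarrow> bool" where
  "decreasing_filtration V F \<longleftrightarrow>
     (\<forall>p. cplx.subspace (F p) \<and> F p \<subseteq> cset V) \<and> (\<forall>p q. p \<le> q \<longrightarrow> F q \<subseteq> F p) \<and>
     (\<exists>p. F p = {0}) \<and> (\<exists>p. F p = cset V)"

text \<open>The linear map \<open>f\<close> induces an isomorphism \<open>A/B \<rightarrow> C/D\<close>.\<close>

definition quotient_iso ::
    "('a::real_vector \<Rightarrow> 'a) \<Rightarrow> 'a set \<Rightarrow> 'a set \<Rightarrow> 'a set \<Rightarrow> 'a set \<Rightarrow> bool" where
  "quotient_iso f A B C D \<longleftrightarrow>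
     f ` A \<subseteq> C \<and> f ` B \<subseteq> D \<and>
     (\<forall>x\<in>A. f x \<in> D \<longrightarrow> x \<in> B) \<and> (\<forall>y\<in>C. \<exists>x\<in>A. y - f x \<in> D)"

definition is_weight_filtration ::
    "'a::real_vector set \<Rightarrow> ('a \<Rightarrow> 'a) \<Rightarrow> int \<Rightarrow> (int \<Rightarrow> 'a set) \<Rightarrow> bool" where
  "is_weight_filtration V N w W \<longleftrightarrow>
     increasing_filtration V W \<and>
     (\<forall>k. N ` W k \<subseteq> W (k - 2)) \<and>
     (\<forall>l::nat. quotient_iso (N ^^ l) (W (w + int l)) (W (w + int l - 1))
                                     (W (w - int l)) (W (w - int l - 1)))"

definition weight_filtration ::
    "'a::real_vector set \<Rightarrow> ('a \<Rightarrow> 'a) \<Rightarrow> int \<Rightarrow> int \<Rightarrow> 'a set" where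
  "weight_filtration V N w = (THE W. is_weight_filtration V N w W)"

text \<open>\<open>F\<^sup>p Gr\<^sup>W\<^sub>k\<close>, as a subspace of \<open>cset (W k)\<close> containing \<open>cset (W (k - 1))\<close>\<close>

definition F_Gr ::
    "(int \<Rightarrow> 'a::real_vector cplx set) \<Rightarrow> (int \<Rightarrow> 'a set) \<Rightarrow> int \<Rightarrow> int \<Rightarrow> 'a cplx set" where
  "F_Gr F W k p = set_sum (F p \<inter> cset (W k)) (cset (W (k - 1)))"

text \<open>
  The filtration \<open>\<Phi>\<close> (by preimages) is a pure Hodge structure of weight \<open>k\<close> on \<open>A/B\<close>:
  \<open>A/B = \<Phi>\<^sup>p \<oplus> cj (\<Phi>\<^sup>k\<^sup>+\<^sup>1\<^sup>-\<^sup>p)\<close> for all \<open>p\<close>.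
\<close>

definition pure_hodge_quotient ::
    "int \<Rightarrow> 'a::real_vector cplx set \<Rightarrow> 'a cplx set \<Rightarrow> (int \<Rightarrow> 'a cplx set) \<Rightarrow> bool" where
  "pure_hodge_quotient k A B \<Phi> \<longleftrightarrow>
     (\<forall>p. set_sum (\<Phi> p) (cj ` \<Phi> (k + 1 - p)) = A \<and> \<Phi> p \<inter> cj ` \<Phi> (k + 1 - p) = B)"

definition mhs ::
    "'a::real_vector set \<Rightarrow> (int \<Rightarrow> 'a cplx set) \<Rightarrow> (int \<Rightarrow> 'a set) \<Rightarrow> bool" where
  "mhs V F W \<longleftrightarrow>
     subspace V \<and> decreasing_filtration V F \<and> increasing_filtration V W \<and>
     (\<forall>k. pure_hodge_quotient k (cset (W k)) (cset (W (k - 1))) (F_Gr F W k))"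

definition nondegenerate_on :: "'a::real_vector set \<Rightarrow> ('a \<Rightarrow> 'a \<Rightarrow> real) \<Rightarrow> bool" where
  "nondegenerate_on V S \<longleftrightarrow>
     (\<forall>x\<in>V. (\<forall>y\<in>V. S x y = 0) \<longrightarrow> x = 0) \<and> (\<forall>y\<in>V. (\<forall>x\<in>V. S x y = 0) \<longrightarrow> y = 0)"

text \<open>The preimage in \<open>W\<^sub>w\<^sub>+\<^sub>l\<close> of the complexified primitive part \<open>P\<^sub>w\<^sub>+\<^sub>l\<close> of \<open>Gr\<^sup>W\<^sub>w\<^sub>+\<^sub>l\<close>.\<close>

definition primitive ::
    "(int \<Rightarrow> 'a::real_vector set) \<Rightarrow> ('a \<Rightarrow> 'a) \<Rightarrow> int \<Rightarrow> nat \<Rightarrow> 'a cplx set" where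
  "primitive W N w l =
     {a \<in> cset (W (w + int l)). (cmap N ^^ (l + 1)) a \<in> cset (W (w - int l - 3))}"

text \<open>
  In the positivity condition \<open>a\<close> is a representative in \<open>W\<^sub>w\<^sub>+\<^sub>l\<close> of a nonzero class in
  \<open>F\<^sup>p P\<^sub>w\<^sub>+\<^sub>l \<inter> cj (F\<^sup>w\<^sup>+\<^sup>l\<^sup>-\<^sup>p P\<^sub>w\<^sub>+\<^sub>l)\<close>, where \<open>F\<^sup>q P\<^sub>w\<^sub>+\<^sub>l = F\<^sup>q Gr\<^sup>W\<^sub>w\<^sub>+\<^sub>l \<inter> P\<^sub>w\<^sub>+\<^sub>l\<close>.
\<close>

definition pmhs ::
    "int \<Rightarrow> 'a::real_vector set \<Rightarrow> (int \<Rightarrow> 'a cplx set) \<Rightarrow> (int \<Rightarrow> 'a set) \<Rightarrow>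
     ('a \<Rightarrow> 'a) \<Rightarrow> ('a \<Rightarrow> 'a \<Rightarrow> real) \<Rightarrow> bool" where
  "pmhs w V F W N S \<longleftrightarrow>
     mhs V F W \<and>
     linear N \<and> N ` V \<subseteq> V \<and> nilpotent_on V N \<and>
     is_weight_filtration V N w W \<and>
     bilinear S \<and> nondegenerate_on V S \<and>
     (\<forall>a\<in>V. \<forall>b\<in>V. S a b = (-1) powi w * S b a) \<and>
     (\<forall>a\<in>V. \<forall>b\<in>V. S (N a) b + S a (N b) = 0) \<and>
     (\<forall>p. cmap N ` F p \<subseteq> F (p - 1)) \<and>
     (\<forall>p. \<forall>a\<in>F p. \<forall>b\<in>F (w + 1 - p). cform S a b = 0) \<and>
     (\<forall>(l::nat) p. \<forall>a \<in> (F_Gr F W (w + int l) p \<inter> primitive W N w l) \<inter>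
                    cj ` (F_Gr F W (w + int l) (w + int l - p) \<inter> primitive W N w l).
        a \<notin> cset (W (w + int l - 1)) \<longrightarrow>
        (let z = \<i> powi (2 * p - w - int l) * cform S a ((cmap N ^^ l) (cj a))
         in z \<in> \<real> \<and> Re z > 0))"

section \<open>Steenbrink polarized mixed Hodge structures\<close>

record 'a steenbrink_data =
  wt :: int
  FF :: "int \<Rightarrow> 'a cplx set"
  WW :: "int \<Rightarrow> 'a set"
  MM :: "'a \<Rightarrow> 'a"
  SS :: "'a \<Rightarrow> 'a \<Rightarrow> real"

definition steenbrink_mhs ::
    "int \<Rightarrow> (int \<Rightarrow> 'a::real_vector cplx set) \<Rightarrow> (int \<Rightarrow> 'a set) \<Rightarrow> ('a \<Rightarrow> 'a) \<Rightarrow> bool" where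
  "steenbrink_mhs m F W M \<longleftrightarrow>
     mhs UNIV F W \<and>
     linear M \<and> bij M \<and> (\<forall>k. M ` W k = W k) \<and>
     (\<forall>p. cmap (semisimple_part M) ` F p \<subseteq> F p) \<and>
     (\<forall>p. cmap (log_unipotent M) ` F p \<subseteq> F (p - 1)) \<and>
     is_weight_filtration (real_points (eigsp_ne1 M)) (log_unipotent M) m
       (\<lambda>k. W k \<inter> real_points (eigsp_ne1 M)) \<and>
     is_weight_filtration (real_points (eigsp M 1)) (log_unipotent M) (m + 1)
       (\<lambda>k. W k \<inter> real_points (eigsp M 1))"

definition steenbrink_pmhs :: "'a::real_vector steenbrink_data \<Rightarrow> bool" where
  "steenbrink_pmhs X \<longleftrightarrow>
     steenbrink_mhs (wt X) (FF X) (WW X) (MM X) \<and>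
     bilinear (SS X) \<and> nondegenerate_on UNIV (SS X) \<and>
     (\<forall>a b. SS X (MM X a) (MM X b) = SS X a b) \<and>
     pmhs (wt X) (real_points (eigsp_ne1 (MM X)))
       (\<lambda>p. FF X p \<inter> eigsp_ne1 (MM X)) (\<lambda>k. WW X k \<inter> real_points (eigsp_ne1 (MM X)))
       (log_unipotent (MM X)) (SS X) \<and>
     pmhs (wt X + 1) (real_points (eigsp (MM X) 1))
       (\<lambda>p. FF X p \<inter> eigsp (MM X) 1) (\<lambda>k. WW X k \<inter> real_points (eigsp (MM X) 1))
       (log_unipotent (MM X)) (SS X)"

section \<open>Normalized Seifert form\<close>

definition proj_1 :: "('a::real_vector \<Rightarrow> 'a) \<Rightarrow> 'a \<Rightarrow> 'a" where
  "proj_1 M x = (THE y. y \<in> real_points (eigsp M 1) \<and> x - y \<in> real_points (eigsp_ne1 M))"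

text \<open>
  \<open>\<nu> = 1/(M - id)\<close> on \<open>H\<^sub>\<noteq>\<^sub>1\<close> and \<open>\<nu> = -N/(M - id)\<close> on \<open>H\<^sub>1\<close>, where \<open>N/(M - id)\<close> is the inverse of
  \<open>\<Sum>k\<ge>1. N\<^sup>k\<^sup>-\<^sup>1 / k!\<close>; this series is an automorphism of all of \<open>H\<^sub>\<real>\<close>.
\<close>

definition nu :: "('a::real_vector \<Rightarrow> 'a) \<Rightarrow> ('a \<Rightarrow> 'a) \<Rightarrow> 'a \<Rightarrow> 'a" where
  "nu N M x =
     inv_into (real_points (eigsp_ne1 M)) (\<lambda>y. M y - y) (x - proj_1 M x)
     - inv (nil_series (\<lambda>k. 1 / fact (k + 1)) N) (proj_1 M x)"

definition seifert_normalized ::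
    "('a::real_vector \<Rightarrow> 'a) \<Rightarrow> ('a \<Rightarrow> 'a \<Rightarrow> real) \<Rightarrow> 'a \<Rightarrow> 'a \<Rightarrow> real" where
  "seifert_normalized M S a b = - S a (inv (nu (log_unipotent M) M) b)"

section \<open>Spectral pairs\<close>

definition theta :: "complex \<Rightarrow> int" where
  "theta c = (if c = 1 then 1 else 0)"

text \<open>
  \<open>F\<^sup>p Gr\<^sup>W\<^sub>k H\<^sub>\<lambda>\<close>, by its preimage in \<open>W\<^sub>k \<inter> H\<^sub>\<lambda>\<close>. The nested quotient \<open>Gr\<^sub>F\<^sup>p Gr\<^sup>W\<^sub>k H\<^sub>\<lambda>\<close> is the quotient of
  two consecutive such preimages, hence the difference of dimensions in \<open>spp\<close>.
\<close>

definition F_Gr_eig ::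
    "'a::real_vector steenbrink_data \<Rightarrow> complex \<Rightarrow> int \<Rightarrow> int \<Rightarrow> 'a cplx set" where
  "F_Gr_eig X c k p =
     set_sum (FF X p \<inter> cset (WW X k) \<inter> eigsp (MM X) c) (cset (WW X (k - 1)) \<inter> eigsp (MM X) c)"

text \<open>
  An element \<open>\<Sum>d(\<alpha>,k)\<cdot>(\<alpha>,k)\<close> of \<open>\<int>\<^sub>\<ge>\<^sub>0[\<real>\<times>\<int>]\<close> is represented by its coefficient function \<open>d\<close>.
\<close>

definition spp :: "'a::real_vector steenbrink_data \<Rightarrow> real \<times> int \<Rightarrow> nat" where
  "spp X = (\<lambda>(\<alpha>, k).
     let c = exp (- (2 * of_real pi * \<i> * of_real \<alpha>)); p = \<lfloor>of_int (wt X) - \<alpha>\<rfloor>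
     in cplx.dim (F_Gr_eig X c (k + theta c) p) - cplx.dim (F_Gr_eig X c (k + theta c) (p + 1)))"

text \<open>Shifting every pair by \<open>(s, t)\<close>\<close>

definition spp_shift :: "real \<times> int \<Rightarrow> (real \<times> int \<Rightarrow> nat) \<Rightarrow> real \<times> int \<Rightarrow> nat" where
  "spp_shift st d = (\<lambda>x. d (x - st))"

section \<open>The construction\<close>

text \<open>\<open>G\<^sup>(\<^sup>\<beta>\<^sup>) = \<Gamma>(\<beta> id - N/(2\<pi>i))\<close>, as an automorphism of \<open>H\<^sub>\<complex>\<close>; it preserves every \<open>H\<^sub>\<lambda>\<close>.\<close>

definition GG :: "('a::real_vector \<Rightarrow> 'a) \<Rightarrow> real \<Rightarrow> 'a cplx \<Rightarrow> 'a cplx" where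
  "GG N \<beta> =
     cnil_series (\<lambda>k. (deriv ^^ k) Gamma (complex_of_real \<beta>) / fact k
                      * (- 1 / (2 * of_real pi * \<i>)) ^ k) (cmap N)"

definition tilde_M :: "('a::real_vector \<Rightarrow> 'a) \<Rightarrow> 'a \<Rightarrow> 'a" where
  "tilde_M M x = - M x"

definition tilde_W :: "int \<Rightarrow> ('a::real_vector \<Rightarrow> 'a) \<Rightarrow> int \<Rightarrow> 'a set" where
  "tilde_W m M k =
     set_sum (weight_filtration (real_points (eigsp_ne1 (tilde_M M))) (log_unipotent M) (m + 1) k)
             (weight_filtration (real_points (eigsp (tilde_M M) 1)) (log_unipotent M) (m + 2) k)"

definition tilde_S ::
    "('a::real_vector \<Rightarrow> 'a) \<Rightarrow> ('a \<Rightarrow> 'a \<Rightarrow> real) \<Rightarrow> 'a \<Rightarrow> 'a \<Rightarrow> real" where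
  "tilde_S M S a b = - seifert_normalized M S a (nu (log_unipotent M) (tilde_M M) b)"

text \<open>The piece of the new Hodge filtration in \<open>ker (- M\<^sub>s - \<lambda>)\<close>, where \<open>-\<lambda> = e\<^sup>-\<^sup>2\<^sup>\<pi>\<^sup>i\<^sup>\<alpha>\<close>, \<open>0 < \<alpha> \<le> 1\<close>\<close>

definition tilde_F_eig ::
    "('a::real_vector \<Rightarrow> 'a) \<Rightarrow> (int \<Rightarrow> 'a cplx set) \<Rightarrow> real \<Rightarrow> int \<Rightarrow> 'a cplx set" where
  "tilde_F_eig M F \<alpha> p =
     (let c = - exp (- (2 * of_real pi * \<i> * of_real \<alpha>)); N = log_unipotent M in
      if \<alpha> \<le> 1/2
      then inv (GG N (\<alpha> + 1/2)) ` GG N \<alpha> ` (F (p - 1) \<inter> eigsp (tilde_M M) c)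
      else inv (GG N (\<alpha> - 1/2)) ` GG N \<alpha> ` (F p \<inter> eigsp (tilde_M M) c))"

definition tilde_F ::
    "('a::real_vector \<Rightarrow> 'a) \<Rightarrow> (int \<Rightarrow> 'a cplx set) \<Rightarrow> int \<Rightarrow> 'a cplx set" where
  "tilde_F M F p = cplx.span (\<Union>\<alpha>\<in>{0<..1}. tilde_F_eig M F \<alpha> p)"

definition tilde :: "'a::real_vector steenbrink_data \<Rightarrow> 'a steenbrink_data" where
  "tilde X =
     \<lparr> wt = wt X + 1,
       FF = tilde_F (MM X) (FF X),
       WW = tilde_W (wt X) (MM X),
       MM = tilde_M (MM X),
       SS = tilde_S (MM X) (SS X) \<rparr>"

end

theory Submission
  imports Defs "HOL-Complex_Analysis.Complex_Analysis"
begin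

text \<open>
  Everything is decided on the generalized eigenspaces \<open>H\<^sub>c\<close> of \<open>M\<close>. There \<open>M = c exp N\<close>, so all operators
  in question are power series in the nilpotent \<open>N\<close> whose coefficients depend on \<open>c\<close>, and identities
  between operators become identities between power series. The filtrations are sums of their
  intersections with the \<open>H\<^sub>c\<close>, the form pairs \<open>H\<^sub>c\<close> only with \<open>H\<^bsub>1/c\<^esub>\<close>, and all eigenvalues lie on the
  unit circle: otherwise a vector of top weight and pure type in \<open>H\<^sub>c\<close> would be orthogonal to its
  conjugate, against the polarization (\<open>norm_spectrum\<close>).

  Put \<open>\<kappa> = \<nu>\<^sup>-\<^sup>1\<close>, so that \<open>L(a,b) = - S(a, \<kappa> b)\<close>. Both structures share \<open>L\<close>, hence the new form is
  \<open>S(a, \<rho> b)\<close>, where \<open>\<rho>\<close> is the quotient of \<open>\<kappa>\<close> for \<open>M\<close> by \<open>\<kappa>\<close> for \<open>- M\<close>. The new weight filtration is the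
  old one shifted by \<open>delta c \<in> {0,1,2}\<close> on \<open>H\<^sub>c\<close>. The new Hodge filtration on \<open>H\<^sub>c\<close> is the image of the
  old one, shifted by \<open>eps c \<in> {0,1}\<close>, under a quotient \<open>\<phi>\<close> of two Gamma series. On the graded pieces
  of the weight filtration \<open>N\<close> vanishes and \<open>\<phi>\<close> is a nonzero scalar. Therefore only the index shifts are
  seen there: \<open>eps c + eps (cnj c) = delta c\<close> makes the graded pieces pure Hodge structures, and the
  spectral pairs move by \<open>(1/2, 1)\<close>. Likewise \<open>\<rho>\<close> acts on the graded pieces as a number, whose phase is
  exactly compensated by the change of the power of \<open>\<i>\<close> in the positivity condition (\<open>rho_sign\<close>).

  The isotropy of the new Hodge filtration is the only condition that sees more than the graded
  pieces, and it is where the Gamma function enters. By the reflection formula, the product of the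
  Gamma series for \<open>cnj c\<close> (with \<open>N\<close> replaced by its adjoint \<open>- N\<close>), of the Gamma series for \<open>c\<close> and of
  \<open>\<kappa>\<close> on \<open>H\<^sub>c\<close> is a constant multiple of \<open>exp (N/2)\<close> (\<open>pairing\<close>). The right-hand side has the same shape for
  \<open>c\<close> and \<open>- c\<close>. Dividing the two identities shows that \<open>\<phi>\<close> carries the old form to a constant multiple of
  the new one (\<open>phi_pairing\<close>).

  Applying the construction twice composes the data for \<open>c\<close> and \<open>- c\<close>. The series \<open>\<phi>\<close> and \<open>\<rho>\<close> cancel, and
  \<open>eps c + eps (- c) = 1\<close> and \<open>delta c + delta (- c) = 2\<close> give the Tate twist.
\<close>

text \<open>
  Vectors of the complexification are kept atomic rather than split into real and imaginary parts.
\<close>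

declare split_paired_All [simp del] split_paired_Ex [simp del]

section \<open>Linear algebra on the complexification\<close>

definition clin :: "('a::real_vector cplx \<Rightarrow> 'a cplx) \<Rightarrow> bool" where
  "clin T \<longleftrightarrow> (\<forall>x y. T (x + y) = T x + T y) \<and> (\<forall>z x. T (cscale z x) = cscale z (T x))"

lemma clinI:
  "(\<And>x y. T (x + y) = T x + T y) \<Longrightarrow> (\<And>z x. T (cscale z x) = cscale z (T x)) \<Longrightarrow> clin T"
  by (simp add: clin_def)

lemma clin_add: "clin T \<Longrightarrow> T (x + y) = T x + T y"
  and clin_scale: "clin T \<Longrightarrow> T (cscale z x) = cscale z (T x)"
  by (simp_all add: clin_def)

lemma clin_0: "clin T \<Longrightarrow> T 0 = 0"
  using clin_add[of T 0 0] by simp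

lemma clin_minus: "clin T \<Longrightarrow> T (- x) = - T x"
  using clin_scale[of T "-1" x] by simp

lemma clin_diff: "clin T \<Longrightarrow> T (x - y) = T x - T y"
  using clin_add[of T x "- y"] clin_minus[of T y] by simp

lemma clin_sum: "clin T \<Longrightarrow> T (\<Sum>i\<in>I. f i) = (\<Sum>i\<in>I. T (f i))"
  by (induction I rule: infinite_finite_induct) (auto simp: clin_0 clin_add)

lemmas clin_simps = clin_add clin_scale clin_0 clin_minus clin_diff clin_sum

lemma clin_id: "clin (\<lambda>x. x)"
  and clin_comp: "clin T \<Longrightarrow> clin U \<Longrightarrow> clin (\<lambda>x. T (U x))"
  and clin_plus: "clin T \<Longrightarrow> clin U \<Longrightarrow> clin (\<lambda>x. T x + U x)"
  and clin_sub: "clin T \<Longrightarrow> clin U \<Longrightarrow> clin (\<lambda>x. T x - U x)"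
  and clin_cscale: "clin T \<Longrightarrow> clin (\<lambda>x. cscale c (T x))"
  by (auto simp: clin_def algebra_simps cplx.scale_right_distrib cplx.scale_right_diff_distrib)

lemma clin_zero_op: "clin (\<lambda>x. 0)"
  by (simp add: clin_def)

lemma clin_sum_op: "(\<And>i. i \<in> I \<Longrightarrow> clin (A i)) \<Longrightarrow> clin (\<lambda>x. \<Sum>i\<in>I. A i x)"
  by (induction I rule: infinite_finite_induct) (auto intro!: clin_plus clin_zero_op)

lemma clin_pow: "clin T \<Longrightarrow> clin (T ^^ n)"
proof (induction n)
  case 0 then show ?case using clin_id by (simp add: clin_def)
next
  case (Suc n) then show ?case using clin_comp[of T "T ^^ n"] by (simp add: o_def)
qed

lemma clin_cmap: "linear T \<Longrightarrow> clin (cmap T)"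
  by (auto simp: clin_def cmap_def cscale_def linear_add linear_diff linear_scale)

lemma cmap_pow: "cmap T ^^ n = cmap (T ^^ n)"
  by (induction n) (auto simp: cmap_def fun_eq_iff)

lemma cmap_inject: "cmap S = cmap T \<Longrightarrow> S = T"
  unfolding fun_eq_iff cmap_def by (metis fst_conv)

lemma cj_add [simp]: "cj (x + y) = cj x + cj y"
  and cj_cj [simp]: "cj (cj x) = x"
  and cj_0 [simp]: "cj 0 = 0"
  and cj_diff [simp]: "cj (x - y) = cj x - cj y"
  and cj_scale [simp]: "cj (cscale z x) = cscale (cnj z) (cj x)"
  by (auto simp: cj_def cscale_def algebra_simps prod_eq_iff)

lemma cj_sum: "cj (\<Sum>i\<in>I. f i) = (\<Sum>i\<in>I. cj (f i))"
  by (induction I rule: infinite_finite_induct) auto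

lemma cj_eq_0_iff [simp]: "cj x = 0 \<longleftrightarrow> x = 0"
  by (metis cj_0 cj_cj)

lemma cj_in_image: "x \<in> cj ` A \<longleftrightarrow> cj x \<in> A"
  by (metis (no_types, lifting) cj_cj image_iff)

lemma cj_cmap: "linear T \<Longrightarrow> cj (cmap T x) = cmap T (cj x)"
  by (auto simp: cj_def cmap_def linear_neg)

text \<open>
  Intended for operators that commute with conjugation; these are the complexifications of real
  operators.
\<close>

definition re_op :: "('a::real_vector cplx \<Rightarrow> 'a cplx) \<Rightarrow> 'a \<Rightarrow> 'a" where
  "re_op A x = fst (A (x, 0))"

lemma re_op:
  assumes A: "clin A" and c: "\<And>v. A (cj v) = cj (A v)"
  shows linear_re_op: "linear (re_op A)" and cmap_re_op: "cmap (re_op A) = A"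
proof -
  have s: "snd (A (x, 0)) = 0" for x
  proof -
    have "snd (A (x, 0)) = - snd (A (x, 0))"
      using c[of "(x, 0)"] by (simp add: cj_def prod_eq_iff)
    then show ?thesis by (simp add: eq_neg_iff_add_eq_0 flip: scaleR_2)
  qed
  have 1: "A (x, y) = (re_op A x, re_op A y)" for x y
  proof -
    have "A (x, y) = A ((x, 0) + cscale \<i> (y, 0))" by (simp add: cscale_def)
    also have "\<dots> = A (x, 0) + cscale \<i> (A (y, 0))" using A by (simp add: clin_simps)
    finally show ?thesis using s by (simp add: cscale_def re_op_def prod_eq_iff)
  qed
  then show "cmap (re_op A) = A" by (auto simp: cmap_def fun_eq_iff)
  have 0: "re_op A 0 = 0" using A clin_0[OF A] by (simp add: re_op_def zero_prod_def)
  show "linear (re_op A)"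
  proof (rule linearI)
    show "re_op A (x + y) = re_op A x + re_op A y" for x y
      using clin_add[OF A, of "(x, 0)" "(y, 0)"] by (simp add: 1 0)
    show "re_op A (r *\<^sub>R x) = r *\<^sub>R re_op A x" for r x
      using clin_scale[OF A, of "of_real r" "(x, 0)"] by (simp add: 1 0 cscale_def)
  qed
qed

lemma comm_pow: "(\<And>x. A (B x) = B (A x)) \<Longrightarrow> (A ^^ n) (B x) = B ((A ^^ n) x)"
  by (induction n) auto

lemma comm_pow2: "(\<And>x. A (B x) = B (A x)) \<Longrightarrow> A ((B ^^ n) x) = (B ^^ n) (A x)"
  by (induction n) auto

lemma linear_pow: "linear T \<Longrightarrow> linear (T ^^ n)" for T :: "'b::real_vector \<Rightarrow> 'b"
  by (induction n) (auto simp: linear_iff)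

lemma pow_zero_mono:
  fixes f :: "'b::zero \<Rightarrow> 'b"
  assumes "f 0 = 0" "(f ^^ n) x = 0" "n \<le> k" shows "(f ^^ k) x = 0"
proof -
  have "(f ^^ k) x = (f ^^ (k - n)) ((f ^^ n) x)"
    using \<open>n \<le> k\<close> by (simp flip: funpow_add[THEN fun_cong, unfolded comp_def])
  moreover have "(f ^^ j) 0 = 0" for j by (induction j) (auto simp: assms)
  ultimately show ?thesis by (simp add: assms)
qed

lemma pow_stable: "(\<And>x. x \<in> U \<Longrightarrow> f x \<in> U) \<Longrightarrow> x \<in> U \<Longrightarrow> (f ^^ n) x \<in> U"
  by (induction n) auto

lemma finite_cplx_span:
  assumes "finite_dimensional (UNIV :: 'a::real_vector set)"
  obtains B :: "'a::real_vector cplx set" where "finite B" "cplx.span B = UNIV"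
proof -
  obtain B0 :: "'a set" where B0: "finite B0" "span B0 = UNIV"
    using assms by (auto simp: finite_dimensional_def)
  let ?B = "(\<lambda>b. (b, 0)) ` B0"
  have 1: "(x, 0) \<in> cplx.span ?B" for x
  proof -
    have "x \<in> span B0" using B0 by simp
    then show ?thesis
    proof (induction rule: span_induct_alt)
      case base then show ?case using cplx.span_zero by (simp add: zero_prod_def)
    next
      case (step c x y)
      have "(c *\<^sub>R x + y, 0) = cscale (of_real c) (x, 0) + (y, 0)" by (simp add: cscale_def)
      then show ?case using step
        by (auto intro!: cplx.span_add cplx.span_scale intro: cplx.span_base)
    qed
  qed
  have "(x, y) \<in> cplx.span ?B" for x y
  proof -
    have "(x, y) = (x, 0) + cscale \<i> (y, 0)" by (simp add: cscale_def)
    then show ?thesis using 1 by (metis cplx.span_add cplx.span_scale)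
  qed
  then have "cplx.span ?B = UNIV" by auto
  then show ?thesis using that[of ?B] B0 by blast
qed

section \<open>Generalized eigenspaces\<close>

definition shift_op :: "('a::real_vector cplx \<Rightarrow> 'a cplx) \<Rightarrow> complex \<Rightarrow> 'a cplx \<Rightarrow> 'a cplx" where
  "shift_op T c v = T v - cscale c v"

definition gen_eig :: "('a::real_vector cplx \<Rightarrow> 'a cplx) \<Rightarrow> complex \<Rightarrow> 'a cplx set" where
  "gen_eig T c = {v. \<exists>n. (shift_op T c ^^ n) v = 0}"

lemma clin_shift: "clin T \<Longrightarrow> clin (shift_op T c)"
  unfolding shift_op_def by (intro clin_sub clin_cscale clin_id)

lemma subspace_gen_eig:
  assumes "clin T" shows "cplx.subspace (gen_eig T c)"
proof (rule cplx.subspaceI)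
  let ?S = "shift_op T c"
  have S: "clin (?S ^^ n)" for n by (simp add: assms clin_pow clin_shift)
  have S0: "?S 0 = 0" using assms clin_0 clin_shift by blast
  show "0 \<in> gen_eig T c" using S0 by (auto simp: gen_eig_def intro!: exI[of _ 0])
  show "x + y \<in> gen_eig T c" if xy: "x \<in> gen_eig T c" "y \<in> gen_eig T c" for x y
  proof -
    obtain n k where "(?S ^^ n) x = 0" "(?S ^^ k) y = 0" using xy unfolding gen_eig_def by blast
    then have "(?S ^^ max n k) x = 0" "(?S ^^ max n k) y = 0"
      using pow_zero_mono[of ?S, OF S0] by (metis max.cobounded1 max.cobounded2)+
    then show ?thesis using clin_add[OF S, of "max n k" x y] unfolding gen_eig_def by auto
  qed
  show "cscale z x \<in> gen_eig T c" if "x \<in> gen_eig T c" for x z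
    using that clin_scale[OF S] by (auto simp: gen_eig_def)
qed

lemma gen_eig_commute:
  assumes "clin T" "clin A" "\<And>x. A (T x) = T (A x)" "v \<in> gen_eig T c"
  shows "A v \<in> gen_eig T c"
proof -
  have "shift_op T c (A x) = A (shift_op T c x)" for x
    using assms by (simp add: shift_op_def clin_simps)
  then have "(shift_op T c ^^ n) (A v) = A ((shift_op T c ^^ n) v)" for n by (rule comm_pow)
  then show ?thesis using assms(4) clin_0[OF assms(2)]
    unfolding gen_eig_def by auto metis
qed

lemma gen_eig_cj:
  assumes "clin T" "\<And>x. T (cj x) = cj (T x)" "v \<in> gen_eig T c"
  shows "cj v \<in> gen_eig T (cnj c)"
proof -
  obtain n where n: "(shift_op T c ^^ n) v = 0" using assms by (auto simp: gen_eig_def)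
  have "(shift_op T (cnj c) ^^ n) (cj v) = cj ((shift_op T c ^^ n) v)"
    by (induction n) (auto simp: shift_op_def assms)
  then show ?thesis using n by (auto simp: gen_eig_def)
qed

text \<open>
  On the generalized eigenspace of \<open>c\<close>, the operator \<open>T - d\<close> is the nonzero scalar \<open>c - d\<close> plus a
  nilpotent. Its inverse there is a polynomial in \<open>T\<close> and preserves \<open>U\<close>.
\<close>

lemma stable_unit:
  assumes T: "clin T" and U: "cplx.subspace U" "\<And>x. x \<in> U \<Longrightarrow> T x \<in> U" and dc: "d \<noteq> c"
  shows "(shift_op T c ^^ k) x = 0 \<Longrightarrow> shift_op T d x \<in> U \<Longrightarrow> x \<in> U"
proof (induction k arbitrary: x)
  case 0 then show ?case using U cplx.subspace_0 by auto
next
  case (Suc k)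
  let ?n = "shift_op T c"
  have Un: "x \<in> U \<Longrightarrow> ?n x \<in> U" for x
    unfolding shift_op_def by (intro cplx.subspace_diff cplx.subspace_scale U)
  have "shift_op T d (?n x) = ?n (shift_op T d x)"
    using T by (simp add: shift_op_def clin_simps algebra_simps cplx.scale_right_diff_distrib)
  then have "?n x \<in> U" using Suc.IH[of "?n x"] Suc.prems Un
    by (metis comp_apply funpow_Suc_right)
  moreover have "x = cscale (1 / (c - d)) (shift_op T d x - ?n x)"
    using dc by (simp add: shift_op_def cplx.scale_left_diff_distrib[symmetric])
  ultimately show ?case using U Suc.prems by (metis cplx.subspace_diff cplx.subspace_scale)
qed

text \<open>
  A power of \<open>T - d\<close> kills \<open>v d\<close> and acts invertibly on the other summands, which reduces the number of
  summands. Applied to \<open>U = {0}\<close>, this is the independence of the generalized eigenspaces; applied to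
  the steps of a filtration, it splits the filtration.
\<close>

lemma stable_component:
  assumes T: "clin T" and U: "cplx.subspace U" "\<And>x. x \<in> U \<Longrightarrow> T x \<in> U"
  shows "finite C \<Longrightarrow> (\<And>c. c \<in> C \<Longrightarrow> v c \<in> gen_eig T c) \<Longrightarrow> (\<Sum>c\<in>C. v c) \<in> U \<Longrightarrow> c \<in> C \<Longrightarrow> v c \<in> U"
proof (induction C arbitrary: v c rule: finite_induct)
  case (insert d C)
  obtain n where n: "(shift_op T d ^^ n) (v d) = 0"
    using insert.prems by (auto simp: gen_eig_def)
  let ?A = "shift_op T d ^^ n"
  have A: "clin ?A" by (simp add: T clin_pow clin_shift)
  have AU: "x \<in> U \<Longrightarrow> ?A x \<in> U" for x
    by (rule pow_stable) (unfold shift_op_def, intro cplx.subspace_diff cplx.subspace_scale U)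
  have AT: "shift_op T d (T x) = T (shift_op T d x)" for x
    using T by (simp add: shift_op_def clin_simps)
  have "?A (\<Sum>c\<in>insert d C. v c) = (\<Sum>c\<in>C. ?A (v c))"
    using insert.hyps n by (simp add: clin_sum[OF A] clin_add[OF A])
  then have "(\<Sum>c\<in>C. ?A (v c)) \<in> U" using AU insert.prems by metis
  moreover have "?A (v c) \<in> gen_eig T c" if "c \<in> C" for c
    using gen_eig_commute[OF T A] comm_pow[of "shift_op T d" T] AT insert.prems that by simp
  ultimately have 1: "?A (v c) \<in> U" if "c \<in> C" for c
    using insert.IH[of "\<lambda>c. ?A (v c)"] that by simp
  have 2: "v c \<in> U" if "c \<in> C" for c
  proof -
    have vc: "v c \<in> gen_eig T c" and "d \<noteq> c" using insert that by auto
    have "(shift_op T d ^^ j) (v c) \<in> U \<Longrightarrow> v c \<in> U" for j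
    proof (induction j)
      case (Suc j)
      have "(shift_op T d ^^ j) (v c) \<in> gen_eig T c"
        using gen_eig_commute[OF T clin_pow[OF clin_shift[OF T]]] comm_pow[of "shift_op T d" T] AT vc
        by simp
      then obtain k where "(shift_op T c ^^ k) ((shift_op T d ^^ j) (v c)) = 0"
        by (auto simp: gen_eig_def)
      from stable_unit[OF T U \<open>d \<noteq> c\<close> this] Suc show ?case by simp
    qed auto
    then show ?thesis using 1[OF that] by blast
  qed
  have "v d = (\<Sum>c\<in>insert d C. v c) - (\<Sum>c\<in>C. v c)" using insert by simp
  then have "v d \<in> U" using insert.prems 2 U cplx.subspace_diff cplx.subspace_sum by metis
  then show ?case using 2 insert.prems by auto
qed auto

text \<open>
  For \<open>d \<noteq> c\<close>, the operator \<open>T - c\<close> is a nonzero scalar plus a nilpotent on the generalized eigenspace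
  of \<open>d\<close>, and the geometric series of its inverse terminates.
\<close>

lemma shift_surj:
  assumes T: "clin T" and "c \<noteq> d"
  shows "(shift_op T d ^^ n) w = 0 \<Longrightarrow> \<exists>y\<in>gen_eig T d. shift_op T c y = w"
proof (induction n arbitrary: w)
  case 0
  then show ?case using cplx.subspace_0[OF subspace_gen_eig[OF T, of d]] clin_0[OF clin_shift[OF T]]
    by auto
next
  case (Suc n)
  let ?e = "d - c" let ?n = "shift_op T d"
  let ?w = "- cscale (1 / ?e) (?n w)"
  have "(?n ^^ n) ?w = - cscale (1 / ?e) ((?n ^^ n) (?n w))"
    using clin_pow[OF clin_shift[OF T], of n d] by (simp add: clin_minus clin_scale)
  also have "\<dots> = 0" using Suc.prems by (simp add: funpow_swap1)
  finally obtain y where y: "y \<in> gen_eig T d" "shift_op T c y = ?w" using Suc.IH by blast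
  have w: "w \<in> gen_eig T d" using Suc.prems gen_eig_def by blast
  have "shift_op T c (cscale (1 / ?e) w) = cscale (1 / ?e) (?n w) + w"
  proof -
    have "c * (1 / ?e) = (1 / ?e) * d - 1" using \<open>c \<noteq> d\<close> by (simp add: field_simps)
    then have "cscale c (cscale (1 / ?e) w) = cscale (1 / ?e) (cscale d w) - w"
      by (simp only: cplx.scale_scale cplx.scale_left_diff_distrib cplx.scale_one)
    then show ?thesis
      by (simp only: shift_op_def clin_scale[OF T] cplx.scale_right_diff_distrib) simp
  qed
  then have "shift_op T c (cscale (1 / ?e) w + y) = w"
    using y clin_add[OF clin_shift[OF T]] by simp
  then show ?case using w y subspace_gen_eig[OF T]
    by (meson cplx.subspace_add cplx.subspace_scale)
qed

definition poly_op :: "('a::real_vector cplx \<Rightarrow> 'a cplx) \<Rightarrow> complex poly \<Rightarrow> 'a cplx \<Rightarrow> 'a cplx" where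
  "poly_op T p v = (\<Sum>i\<le>degree p. cscale (coeff p i) ((T ^^ i) v))"

lemma poly_op_upto: "degree p \<le> n \<Longrightarrow> poly_op T p v = (\<Sum>i\<le>n. cscale (coeff p i) ((T ^^ i) v))"
  unfolding poly_op_def by (rule sum.mono_neutral_left) (simp_all add: coeff_eq_0 not_le)

lemma poly_op_linear_factor:
  assumes T: "clin T" shows "poly_op T ([:-c, 1:] * q) v = poly_op T q (shift_op T c v)"
proof -
  let ?n = "Suc (degree q)"
  have e: "[:-c, 1:] * q = smult (-c) q + pCons 0 q" by simp
  have "degree ([:-c, 1:] * q) \<le> ?n" using degree_mult_le[of "[:-c, 1:]" q] by simp
  then have "poly_op T ([:-c, 1:] * q) v = (\<Sum>i\<le>?n. cscale (- c * coeff q i) ((T ^^ i) v)) + (\<Sum>i\<le>?n. cscale (coeff (pCons 0 q) i) ((T ^^ i) v))"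
    by (simp only: poly_op_upto e coeff_add coeff_smult cplx.scale_left_distrib sum.distrib)
  also have "(\<Sum>i\<le>?n. cscale (coeff (pCons 0 q) i) ((T ^^ i) v)) = (\<Sum>i\<le>degree q. cscale (coeff q i) ((T ^^ i) (T v)))"
    by (subst sum.atMost_Suc_shift) (simp add: funpow_swap1)
  also have "(\<Sum>i\<le>?n. cscale (- c * coeff q i) ((T ^^ i) v)) = - (\<Sum>i\<le>degree q. cscale (coeff q i) ((T ^^ i) (cscale c v)))"
    by (simp add: coeff_eq_0 clin_scale[OF clin_pow[OF T]] sum_negf mult.commute)
  finally show ?thesis
    by (simp add: poly_op_def shift_op_def clin_diff[OF clin_pow[OF T]] cplx.scale_right_diff_distrib sum_subtractf)
qed

lemma annihilating_poly:
  fixes T :: "'a::real_vector cplx \<Rightarrow> 'a cplx"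
  assumes fin: "finite_dimensional (UNIV :: 'a set)"
  shows "\<exists>p. p \<noteq> 0 \<and> poly_op T p v = 0"
proof -
  obtain B :: "'a cplx set" where B: "finite B" "cplx.span B = UNIV"
    using finite_cplx_span[OF fin] by blast
  let ?n = "card B" and ?g = "\<lambda>i. (T ^^ i) v"
  show ?thesis
  proof (cases "inj_on ?g {..?n}")
    case True
    have "cplx.dependent (?g ` {..?n})"
    proof (rule ccontr)
      assume "\<not> ?thesis"
      then have "card (?g ` {..?n}) \<le> card B"
        using cplx.independent_span_bound[OF B(1)] B by blast
      then show False using card_image[OF True] by simp
    qed
    then obtain u i where u: "(\<Sum>x\<in>?g ` {..?n}. cscale (u x) x) = 0" "i \<le> ?n" "u (?g i) \<noteq> 0"
      by (auto simp: cplx.dependent_finite)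
    let ?p = "Abs_poly (\<lambda>i. if i \<le> ?n then u (?g i) else 0)"
    have c: "coeff ?p i = (if i \<le> ?n then u (?g i) else 0)" for i
      by (subst coeff_Abs_poly[of ?n]) auto
    have "poly_op T ?p v = (\<Sum>i\<le>?n. cscale (coeff ?p i) (?g i))"
      by (rule poly_op_upto) (auto simp: c intro: degree_le)
    also have "\<dots> = (\<Sum>x\<in>?g ` {..?n}. cscale (u x) x)"
      by (subst sum.reindex[OF True]) (auto simp: c)
    finally show ?thesis using u c[of i] by (intro exI[of _ ?p]) auto
  next
    case False
    then obtain i j where ij: "i \<noteq> j" "?g i = ?g j" by (auto simp: inj_on_def)
    let ?p = "monom 1 i - monom 1 j :: complex poly"
    have "poly_op T ?p v = (\<Sum>k\<le>max i j. cscale (coeff ?p k) (?g k))"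
      by (rule poly_op_upto) (auto intro!: degree_diff_le order.trans[OF degree_monom_le])
    also have "\<dots> = (\<Sum>k\<le>max i j. (if k = i then ?g k else 0) - (if k = j then ?g k else 0))"
      by (intro sum.cong) (auto simp: cplx.scale_left_diff_distrib)
    also have "\<dots> = 0" using ij by (simp add: sum_subtractf)
    finally show ?thesis using ij
      by (intro exI[of _ ?p]) (auto simp: monom_eq_iff' dest: arg_cong[of _ _ degree] simp: degree_monom_eq)
  qed
qed

text \<open>
  Every vector is killed by a polynomial in \<open>T\<close>. If \<open>c\<close> is a root of it, then \<open>(T - c) v\<close> is killed by a
  polynomial of smaller degree and lies in the span. Since \<open>T - c\<close> maps the other generalized
  eigenspaces onto themselves, subtracting a vector of the span brings \<open>v\<close> into that of \<open>c\<close>.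
\<close>

lemma span_gen_eig:
  fixes T :: "'a::real_vector cplx \<Rightarrow> 'a cplx"
  assumes T: "clin T" and fin: "finite_dimensional (UNIV :: 'a set)"
  shows "cplx.span (\<Union>c. gen_eig T c) = UNIV"
proof -
  let ?S = "cplx.span (\<Union>c. gen_eig T c)"
  \<comment> \<open>modulo the image of the span under \<open>T - c\<close>, each vector of the span is in the eigenspace of \<open>c\<close>\<close>
  have step: "\<exists>y\<in>?S. w - shift_op T c y \<in> gen_eig T c" if "w \<in> ?S" for w c
    using that
  proof (induction rule: cplx.span_induct_alt)
    case base
    then show ?case using cplx.span_zero clin_0[OF clin_shift[OF T]]
        cplx.subspace_0[OF subspace_gen_eig[OF T]] by (intro bexI[of _ 0]) auto
  next
    case (step a x z)
    obtain y where y: "y \<in> ?S" "z - shift_op T c y \<in> gen_eig T c" using step by blast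
    obtain d where d: "x \<in> gen_eig T d" using step by blast
    have "\<exists>y'\<in>?S. x - shift_op T c y' \<in> gen_eig T c"
    proof (cases "d = c")
      case True
      then show ?thesis using d cplx.span_zero clin_0[OF clin_shift[OF T]]
        by (intro bexI[of _ 0]) auto
    next
      case False
      then obtain y' where "y' \<in> gen_eig T d" "shift_op T c y' = x"
        using shift_surj[OF T, of c d] d unfolding gen_eig_def by blast
      then show ?thesis using cplx.subspace_0[OF subspace_gen_eig[OF T, of c]]
        by (intro bexI[of _ y']) (auto intro: cplx.span_base)
    qed
    then obtain y' where y': "y' \<in> ?S" "x - shift_op T c y' \<in> gen_eig T c" by blast
    have "cscale a x + z - shift_op T c (cscale a y' + y)
        = cscale a (x - shift_op T c y') + (z - shift_op T c y)"
      using clin_shift[OF T, of c] by (simp add: clin_simps cplx.scale_right_diff_distrib)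
    also have "\<dots> \<in> gen_eig T c"
      by (intro cplx.subspace_add cplx.subspace_scale subspace_gen_eig[OF T] y y')
    finally show ?case
      by (rule bexI) (intro cplx.span_add cplx.span_scale y y')
  qed
  have "p \<noteq> 0 \<Longrightarrow> poly_op T p v = 0 \<Longrightarrow> degree p = n \<Longrightarrow> v \<in> ?S" for p v n
  proof (induction n arbitrary: p v)
    case 0
    obtain a where "p = [:a:]" using \<open>degree p = 0\<close> by (rule degree_eq_zeroE)
    then have "v = 0" using 0 by (simp add: poly_op_def)
    then show ?case using cplx.span_zero by metis
  next
    case (Suc n)
    have "coeff p 0 = 0 \<or> (\<exists>i\<in>{1..degree p}. coeff p i \<noteq> 0)"
      using Suc.prems leading_coeff_0_iff[of p] by (intro disjI2 bexI[of _ "degree p"]) simp_all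
    then obtain c where "(\<Sum>i\<le>degree p. coeff p i * c ^ i) = 0"
      by (rule fundamental_theorem_of_algebra)
    then have "poly p c = 0" by (simp add: poly_altdef)
    then obtain q where q: "p = [:-c, 1:] * q" unfolding poly_eq_0_iff_dvd by (rule dvdE)
    have q0: "q \<noteq> 0" using q Suc.prems by auto
    then have "degree ([:-c, 1:] * q) = Suc (degree q)" by (subst degree_mult_eq) auto
    then have "degree q = n" using q Suc.prems by simp
    moreover have "poly_op T q (shift_op T c v) = 0"
      using poly_op_linear_factor[OF T] q Suc.prems by metis
    ultimately have "shift_op T c v \<in> ?S"
      using Suc.IH[of q "shift_op T c v"] q0 by blast
    then obtain y where y: "y \<in> ?S" "shift_op T c v - shift_op T c y \<in> gen_eig T c"
      using step by blast
    then have "shift_op T c (v - y) \<in> gen_eig T c"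
      using clin_diff[OF clin_shift[OF T]] by metis
    then obtain k where "(shift_op T c ^^ k) (shift_op T c (v - y)) = 0" by (auto simp: gen_eig_def)
    then have "(shift_op T c ^^ Suc k) (v - y) = 0" by (simp add: funpow_swap1)
    then have "v - y \<in> gen_eig T c"
      unfolding gen_eig_def by blast
    then have "v - y \<in> ?S" by (auto intro: cplx.span_base)
    then have "(v - y) + y \<in> ?S" using y cplx.span_add by blast
    then show ?case by simp
  qed
  then show ?thesis using annihilating_poly[OF fin, of T] by blast
qed

definition spectrum :: "('a::real_vector cplx \<Rightarrow> 'a cplx) \<Rightarrow> complex set" where
  "spectrum T = {c. gen_eig T c \<noteq> {0}}"

text \<open>
  The decomposition is unique by independence, so the choice is immaterial. Indexing it by all complex
  numbers makes the parts outside the spectrum zero.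
\<close>

definition eig_part :: "('a::real_vector cplx \<Rightarrow> 'a cplx) \<Rightarrow> complex \<Rightarrow> 'a cplx \<Rightarrow> 'a cplx" where
  "eig_part T c v = (SOME f. (\<forall>c. f c \<in> gen_eig T c) \<and> v = (\<Sum>c\<in>spectrum T. f c)) c"

lemma gen_eig_independent:
  assumes T: "clin T" and C: "finite C" "\<And>c. c \<in> C \<Longrightarrow> v c \<in> gen_eig T c" "(\<Sum>c\<in>C. v c) = 0" "c \<in> C"
  shows "v c = 0"
  using stable_component[OF T, of "{0}" C v c] C clin_0[OF T] by auto

locale finite_op =
  fixes T :: "'a::real_vector cplx \<Rightarrow> 'a cplx"
  assumes clinT: "clin T" and fin: "finite_dimensional (UNIV :: 'a set)"
begin

lemmas subspace_gen = subspace_gen_eig[OF clinT]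

lemma zero_in_gen: "0 \<in> gen_eig T c"
  using subspace_gen cplx.subspace_0 by blast

lemma subspace_gen_sums:
  "cplx.subspace {v. \<exists>f. (\<forall>c. f c \<in> gen_eig T c) \<and> v = (\<Sum>c\<in>C. f c)}"
proof (rule cplx.subspaceI, goal_cases)
  case 1 then show ?case using zero_in_gen by (auto intro!: exI[of _ "\<lambda>c. 0"])
next
  case (2 x y)
  then obtain f g where f: "\<forall>c. f c \<in> gen_eig T c" "x = (\<Sum>c\<in>C. f c)"
    and g: "\<forall>c. g c \<in> gen_eig T c" "y = (\<Sum>c\<in>C. g c)" by blast
  have "x + y = (\<Sum>c\<in>C. f c + g c)" "\<forall>c. f c + g c \<in> gen_eig T c"
    using f g cplx.subspace_add[OF subspace_gen] by (auto simp: sum.distrib)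
  then show ?case by (intro CollectI exI[of _ "\<lambda>c. f c + g c"]) simp
next
  case (3 z x)
  then obtain f where f: "\<forall>c. f c \<in> gen_eig T c" "x = (\<Sum>c\<in>C. f c)" by blast
  have "cscale z x = (\<Sum>c\<in>C. cscale z (f c))" "\<forall>c. cscale z (f c) \<in> gen_eig T c"
    using f cplx.subspace_scale[OF subspace_gen] by (auto simp: cplx.scale_sum_right)
  then show ?case by (intro CollectI exI[of _ "\<lambda>c. cscale z (f c)"]) simp
qed

lemma gen_sums_mono:
  assumes "finite D" "C \<subseteq> D" "\<forall>c. f c \<in> gen_eig T c"
  shows "\<exists>g. (\<forall>c. g c \<in> gen_eig T c) \<and> (\<Sum>c\<in>C. f c) = (\<Sum>c\<in>D. g c)"
proof (intro exI[of _ "\<lambda>c. if c \<in> C then f c else 0"] conjI)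
  show "(\<Sum>c\<in>C. f c) = (\<Sum>c\<in>D. if c \<in> C then f c else 0)"
    using assms by (simp add: sum.If_cases Int_absorb1)
qed (use assms zero_in_gen in auto)

lemma finite_gen_sums: "\<exists>C. finite C \<and> (\<forall>v. \<exists>f. (\<forall>c. f c \<in> gen_eig T c) \<and> v = (\<Sum>c\<in>C. f c))"
proof -
  let ?G = "\<lambda>C. {v. \<exists>f. (\<forall>c. f c \<in> gen_eig T c) \<and> v = (\<Sum>c\<in>C. f c)}"
  have mono: "?G C \<subseteq> ?G D" if "C \<subseteq> D" "finite D" for C D
    using gen_sums_mono[OF that(2,1)] by blast
  have ex: "\<exists>C. finite C \<and> v \<in> ?G C" for v
  proof -
    have "v \<in> cplx.span (\<Union>c. gen_eig T c)" using span_gen_eig[OF clinT fin] by simp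
    then show ?thesis
    proof (induction rule: cplx.span_induct_alt)
      case base
      show ?case by (intro exI[of _ "{}"] conjI CollectI exI[of _ "\<lambda>c. 0"]) (use zero_in_gen in auto)
    next
      case (step z x y)
      then obtain C where C: "finite C" "y \<in> ?G C" by blast
      obtain d where d: "x \<in> gen_eig T d" using step by blast
      have "\<exists>f. (\<forall>c. f c \<in> gen_eig T c) \<and> x = (\<Sum>c\<in>{d}. f c)"
        using d zero_in_gen by (intro exI[of _ "\<lambda>c. if c = d then x else 0"]) auto
      then have "x \<in> ?G {d}" by simp
      then have x: "x \<in> ?G (insert d C)" using mono[of "{d}" "insert d C"] C by blast
      have y: "y \<in> ?G (insert d C)" using mono[of C "insert d C"] C by blast
      have "cscale z x + y \<in> ?G (insert d C)"
        by (rule cplx.subspace_add[OF subspace_gen_sums cplx.subspace_scale[OF subspace_gen_sums x] y])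
      then show ?case using C by blast
    qed
  qed
  obtain B :: "'a cplx set" where B: "finite B" "cplx.span B = UNIV"
    using finite_cplx_span[OF fin] by blast
  have "\<exists>C. \<forall>b. finite (C b) \<and> b \<in> ?G (C b)"
    by (rule choice) (rule allI, rule ex)
  then obtain C where C: "\<forall>b. finite (C b) \<and> b \<in> ?G (C b)" by (rule exE)
  let ?C = "\<Union>b\<in>B. C b"
  have fC: "finite ?C" using B C by blast
  have "B \<subseteq> ?G ?C"
  proof
    fix b assume "b \<in> B"
    then show "b \<in> ?G ?C" using mono[of "C b" ?C] C fC by blast
  qed
  then have "cplx.span B \<subseteq> ?G ?C" using subspace_gen_sums by (rule cplx.span_minimal)
  then show ?thesis using B fC by (intro exI[of _ ?C]) blast
qed

lemma finite_spectrum: "finite (spectrum T)"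
  and gen_decomp: "\<exists>f. (\<forall>c. f c \<in> gen_eig T c) \<and> v = (\<Sum>c\<in>spectrum T. f c)"
proof -
  obtain C where C: "finite C" "\<forall>v. \<exists>f. (\<forall>c. f c \<in> gen_eig T c) \<and> v = (\<Sum>c\<in>C. f c)"
    using finite_gen_sums by blast
  have sub: "spectrum T \<subseteq> C"
  proof (rule ccontr)
    assume "\<not> ?thesis"
    then obtain c x where c: "c \<notin> C" "x \<in> gen_eig T c" "x \<noteq> 0"
      using zero_in_gen by (auto simp: spectrum_def)
    obtain f where f: "\<forall>c. f c \<in> gen_eig T c" "x = (\<Sum>c\<in>C. f c)" using C by blast
    let ?v = "\<lambda>d. if d = c then - x else f d"
    have "(\<Sum>d\<in>insert c C. ?v d) = - x + (\<Sum>d\<in>C. ?v d)" using C c by simp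
    also have "(\<Sum>d\<in>C. ?v d) = (\<Sum>d\<in>C. f d)" using c by (intro sum.cong) auto
    finally have "(\<Sum>d\<in>insert c C. ?v d) = 0" using f by simp
    then have "?v c = 0"
      by (rule gen_eig_independent[OF clinT, rotated 2])
         (use C c f cplx.subspace_neg[OF subspace_gen] in auto)
    then show False using c by simp
  qed
  then show fs: "finite (spectrum T)" using C finite_subset by blast
  obtain f where f: "\<forall>c. f c \<in> gen_eig T c" "v = (\<Sum>c\<in>C. f c)" using C by blast
  have "(\<Sum>c\<in>C. f c) = (\<Sum>c\<in>spectrum T. f c)"
    by (rule sum.mono_neutral_right) (use C sub f in \<open>auto simp: spectrum_def\<close>)
  then show "\<exists>f. (\<forall>c. f c \<in> gen_eig T c) \<and> v = (\<Sum>c\<in>spectrum T. f c)" using f by blast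
qed

lemma eig_part_decomp:
  "(\<forall>c. eig_part T c v \<in> gen_eig T c) \<and> v = (\<Sum>c\<in>spectrum T. eig_part T c v)"
  unfolding eig_part_def using someI_ex[OF gen_decomp[of v]] by blast

lemma eig_part_in: "eig_part T c v \<in> gen_eig T c"
  using eig_part_decomp by blast

lemma eig_part_sum: "(\<Sum>c\<in>spectrum T. eig_part T c v) = v"
  using eig_part_decomp by simp

lemma not_spectrum: "c \<notin> spectrum T \<Longrightarrow> gen_eig T c = {0}"
  by (simp add: spectrum_def)

lemma eig_part_not_spectrum: "c \<notin> spectrum T \<Longrightarrow> eig_part T c v = 0"
  using eig_part_in not_spectrum by blast

lemma eig_part_eqI:
  assumes "\<And>c. f c \<in> gen_eig T c" "v = (\<Sum>c\<in>spectrum T. f c)" shows "eig_part T c v = f c"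
proof (cases "c \<in> spectrum T")
  case True
  have "(\<Sum>c\<in>spectrum T. eig_part T c v - f c) = 0"
    using assms(2) eig_part_sum by (simp add: sum_subtractf)
  then have "eig_part T c v - f c = 0"
    by (rule gen_eig_independent[OF clinT finite_spectrum, rotated])
       (use True assms(1) eig_part_in cplx.subspace_diff[OF subspace_gen] in auto)
  then show ?thesis by simp
next
  case False
  then have "f c = 0" using assms(1)[of c] not_spectrum[of c] by simp
  then show ?thesis using False eig_part_not_spectrum by simp
qed

lemma clin_eig_part: "clin (eig_part T c)"
proof (rule clinI)
  show "eig_part T c (x + y) = eig_part T c x + eig_part T c y" for x y
    by (rule eig_part_eqI[of "\<lambda>c. eig_part T c x + eig_part T c y"])
       (auto simp: sum.distrib eig_part_sum eig_part_in intro: cplx.subspace_add[OF subspace_gen])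
  show "eig_part T c (cscale z x) = cscale z (eig_part T c x)" for x z
    by (rule eig_part_eqI[of "\<lambda>c. cscale z (eig_part T c x)"])
       (auto simp: cplx.scale_sum_right[symmetric] eig_part_sum eig_part_in
             intro: cplx.subspace_scale[OF subspace_gen])
qed

lemma eig_part_on: 
  assumes "v \<in> gen_eig T c" shows "eig_part T d v = (if d = c then v else 0)"
proof (cases "c \<in> spectrum T")
  case True
  show ?thesis
    by (rule eig_part_eqI) (use True assms finite_spectrum zero_in_gen in auto)
next
  case False
  then have "v = 0" using assms not_spectrum by blast
  then show ?thesis using clin_0[OF clin_eig_part] by simp
qed

lemma eig_part_twice: "eig_part T d (eig_part T c v) = (if d = c then eig_part T c v else 0)"
  by (rule eig_part_on[OF eig_part_in])

lemma stable_eig_part: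
  assumes "cplx.subspace U" "\<And>x. x \<in> U \<Longrightarrow> T x \<in> U" "v \<in> U"
  shows "eig_part T c v \<in> U"
proof (cases "c \<in> spectrum T")
  case True
  show ?thesis
    by (rule stable_component[OF clinT assms(1,2) finite_spectrum, of "\<lambda>c. eig_part T c v"])
       (use True assms(3) eig_part_in eig_part_sum in auto)
next
  case False
  then show ?thesis using assms eig_part_not_spectrum cplx.subspace_0 by metis
qed

lemma eq_on_eigen:
  assumes "clin A" "clin B" "\<And>c v. v \<in> gen_eig T c \<Longrightarrow> A v = B v" shows "A = B"
proof
  fix v
  have "A v = A (\<Sum>c\<in>spectrum T. eig_part T c v)" by (simp add: eig_part_sum)
  also have "\<dots> = B (\<Sum>c\<in>spectrum T. eig_part T c v)"
    unfolding clin_sum[OF assms(1)] clin_sum[OF assms(2)]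
    by (rule sum.cong[OF refl]) (rule assms(3)[OF eig_part_in])
  finally show "A v = B v" by (simp add: eig_part_sum)
qed

lemma eig_part_commute:
  assumes A: "clin A" "\<And>c v. v \<in> gen_eig T c \<Longrightarrow> A v \<in> gen_eig T c"
  shows "eig_part T c (A v) = A (eig_part T c v)"
  by (rule eig_part_eqI) (use A eig_part_in in \<open>auto simp: clin_sum[OF A(1), symmetric] eig_part_sum\<close>)

lemma eig_part_cj:
  assumes "\<And>x. T (cj x) = cj (T x)"
  shows "eig_part T c (cj v) = cj (eig_part T (cnj c) v)"
proof -
  have sp: "cnj ` spectrum T = spectrum T"
  proof -
    have "cnj c \<in> spectrum T" if "c \<in> spectrum T" for c
    proof (rule ccontr)
      assume "cnj c \<notin> spectrum T"
      then have "x = 0" if "x \<in> gen_eig T c" for x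
        using gen_eig_cj[OF clinT assms that] not_spectrum by auto
      then show False using that zero_in_gen by (auto simp: spectrum_def)
    qed
    then show ?thesis by (force simp: image_iff)
  qed
  have inj: "inj_on cnj (spectrum T)" by (simp add: inj_on_def)
  show ?thesis
  proof (rule eig_part_eqI)
    show "cj (eig_part T (cnj c) v) \<in> gen_eig T c" for c
      using gen_eig_cj[OF clinT assms eig_part_in, of "cnj c" v] by simp
    have "cj v = cj (\<Sum>c\<in>cnj ` spectrum T. eig_part T c v)" by (simp add: sp eig_part_sum)
    also have "\<dots> = (\<Sum>c\<in>spectrum T. cj (eig_part T (cnj c) v))"
      by (simp add: cj_sum sum.reindex[OF inj])
    finally show "cj v = (\<Sum>c\<in>spectrum T. cj (eig_part T (cnj c) v))" .
  qed
qed

text \<open>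
  Functions of \<open>T\<close>, such as its semisimple part, are prescribed on each generalized eigenspace.
\<close>

definition blockwise :: "(complex \<Rightarrow> 'a cplx \<Rightarrow> 'a cplx) \<Rightarrow> 'a cplx \<Rightarrow> 'a cplx" where
  "blockwise A v = (\<Sum>c\<in>spectrum T. A c (eig_part T c v))"

lemma clin_blockwise: "(\<And>c. clin (A c)) \<Longrightarrow> clin (blockwise A)"
  unfolding blockwise_def[abs_def] by (rule clin_sum_op) (rule clin_comp[OF _ clin_eig_part])

lemma blockwise_on:
  assumes "\<And>c. clin (A c)" "v \<in> gen_eig T c" shows "blockwise A v = A c v"
proof -
  have "blockwise A v = (\<Sum>d\<in>spectrum T. if d = c then A c v else 0)"
    unfolding blockwise_def
    by (intro sum.cong) (auto simp: eig_part_on[OF assms(2)] clin_0[OF assms(1)])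
  also have "\<dots> = A c v"
    using finite_spectrum not_spectrum[of c] assms clin_0[OF assms(1)] by auto
  finally show ?thesis .
qed

lemma blockwise_cj:
  assumes A: "\<And>c. clin (A c)" and "\<And>x. T (cj x) = cj (T x)"
    and "\<And>c v. v \<in> gen_eig T c \<Longrightarrow> A (cnj c) (cj v) = cj (A c v)"
  shows "blockwise A (cj v) = cj (blockwise A v)"
proof -
  have "(\<lambda>v. blockwise A (cj v)) = (\<lambda>v. cj (blockwise A v))"
  proof -
    have "cj (blockwise A (cj v)) = blockwise A v" for v
    proof -
      have 1: "clin (\<lambda>v. cj (blockwise A (cj v)))"
        using clin_blockwise[OF A] by (auto simp: clin_def)
      have "(\<lambda>v. cj (blockwise A (cj v))) = blockwise A"
      proof (rule eq_on_eigen[OF 1 clin_blockwise[OF A]])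
        fix c v assume v: "v \<in> gen_eig T c"
        have "blockwise A (cj v) = cj (A c v)"
          by (simp add: blockwise_on[OF A gen_eig_cj[OF clinT assms(2) v]] assms(3)[OF v])
        then show "cj (blockwise A (cj v)) = blockwise A v"
          by (simp add: blockwise_on[OF A v])
      qed
      then show ?thesis by metis
    qed
    then show ?thesis by (metis cj_cj)
  qed
  then show ?thesis by metis
qed

end

section \<open>Jordan decomposition of an automorphism\<close>

text \<open>
  If \<open>n\<close> is the least exponent with \<open>R\<^sup>n x = 0\<close>, then \<open>x, R x, \<dots>, R\<^sup>n\<^sup>-\<^sup>1 x\<close> are independent, so \<open>n\<close> is at most
  the dimension. Hence series truncated at the dimension are complete.
\<close>

lemma nilpotent_dim:
  fixes R :: "'a::real_vector \<Rightarrow> 'a"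
  assumes R: "linear R" and fin: "finite_dimensional (UNIV :: 'a set)" and nil: "\<exists>n. (R ^^ n) x = 0"
  shows "(R ^^ dim (UNIV :: 'a set)) x = 0"
proof -
  obtain B0 :: "'a set" where B0: "finite B0" "span B0 = UNIV"
    using fin by (auto simp: finite_dimensional_def)
  obtain B :: "'a set" where B: "independent B" "UNIV \<subseteq> span B" "card B = dim (UNIV :: 'a set)"
    using basis_exists[of "UNIV :: 'a set"] by auto
  have fB: "finite B" using independent_span_bound[OF B0(1) B(1)] B0 by simp
  define n where "n = (LEAST n. (R ^^ n) x = 0)"
  have n0: "(R ^^ n) x = 0" unfolding n_def using nil by (rule LeastI_ex)
  have least: "(R ^^ k) x \<noteq> 0" if "k < n" for k using that not_less_Least unfolding n_def by blast
  note linR = linear_pow[OF R]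
  have pow0: "(R ^^ k) x = 0" if "n \<le> k" for k
    using pow_zero_mono[of R, OF linear_0[OF R] n0 that] .
  let ?C = "\<lambda>i. (\<lambda>j. (R ^^ j) x) ` {i..<n}"
  have "independent (?C (n - i)) \<and> card (?C (n - i)) = i" if "i \<le> n" for i
    using that
  proof (induction i)
    case (Suc i)
    let ?k = "n - Suc i"
    have I: "{?k..<n} = insert ?k {n - i..<n}" using Suc.prems by auto
    have "(R ^^ i) ((R ^^ ?k) x) = (R ^^ (n - 1)) x"
      using Suc.prems by (simp flip: funpow_add[THEN fun_cong, unfolded comp_def])
    then have "(R ^^ i) ((R ^^ ?k) x) \<noteq> 0" using least[of "n - 1"] Suc.prems by simp
    have N0': "(R ^^ i) y = 0" if "y \<in> span (?C (n - i))" for y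
    proof -
      have "(R ^^ i) z = 0" if z: "z \<in> ?C (n - i)" for z
      proof -
        obtain j where j: "n - i \<le> j" "j < n" "z = (R ^^ j) x" using z by auto
        have "(R ^^ i) z = (R ^^ (i + j)) x" unfolding j(3) funpow_add comp_def ..
        then show ?thesis using j Suc.prems by (simp only: pow0)
      qed
      then show ?thesis using linear_eq_0_on_span[OF linR] that by blast
    qed
    have ni: "(R ^^ ?k) x \<notin> span (?C (n - i))"
      using N0' \<open>(R ^^ i) ((R ^^ ?k) x) \<noteq> 0\<close> by blast
    have "independent (insert ((R ^^ ?k) x) (?C (n - i)))"
      using Suc ni by (intro independent_insertI) auto
    moreover have "(R ^^ ?k) x \<notin> ?C (n - i)"
    proof
      assume "(R ^^ ?k) x \<in> ?C (n - i)"
      from span_base[OF this] ni show False by contradiction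
    qed
    then have "card (insert ((R ^^ ?k) x) (?C (n - i))) = Suc i"
      using Suc.IH Suc.prems by (subst card_insert_disjoint) simp_all
    ultimately show ?case unfolding I image_insert by blast
  qed (simp add: independent_empty)
  from this[of n] have "independent (?C 0)" "card (?C 0) = n" by auto
  then have "n \<le> card B" using independent_span_bound[OF fB, of "?C 0"] B(2) by auto
  then show ?thesis using pow0 B by simp
qed

locale automorphism =
  fixes M :: "'a::real_vector \<Rightarrow> 'a"
  assumes linM: "linear M" and bijM: "bij M" and finM: "finite_dimensional (UNIV :: 'a set)"
begin

sublocale finite_op "cmap M"
  by unfold_locales (rule clin_cmap[OF linM], rule finM)

lemma cmap_M_cj: "cmap M (cj x) = cj (cmap M x)"
  by (simp add: cj_cmap linM)

lemma cmap_M_inj: "cmap M v = 0 \<Longrightarrow> v = 0"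
  using bijM linM linear_injective_0 unfolding bij_def
  by (metis cmap_def fst_conv prod_eq_iff snd_conv zero_prod_def)

lemma gen_eig_0: "gen_eig (cmap M) 0 = {0}"
proof -
  have "v = 0" if "v \<in> gen_eig (cmap M) 0" for v
  proof -
    obtain n where "(shift_op (cmap M) 0 ^^ n) v = 0" using \<open>v \<in> _\<close> by (auto simp: gen_eig_def)
    moreover have "shift_op (cmap M) 0 = cmap M" by (simp add: shift_op_def fun_eq_iff)
    moreover have "(cmap M ^^ n) v = 0 \<Longrightarrow> v = 0"
      by (induction n) (auto dest: cmap_M_inj)
    ultimately show ?thesis by metis
  qed
  then show ?thesis using zero_in_gen by auto
qed

lemma gen_M: "v \<in> gen_eig (cmap M) c \<Longrightarrow> cmap M v \<in> gen_eig (cmap M) c"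
  by (rule gen_eig_commute[OF clinT clinT]) auto

definition ss_cplx :: "'a cplx \<Rightarrow> 'a cplx" where
  "ss_cplx = blockwise cscale"

definition un_cplx :: "'a cplx \<Rightarrow> 'a cplx" where
  "un_cplx = blockwise (\<lambda>c v. cscale (1 / c) (cmap M v))"

lemma clin_cs: "clin (cscale c)"
  using clin_cscale[OF clin_id, of c] by simp

lemma clin_un: "clin (\<lambda>v. cscale (1 / c) (cmap M v))"
  by (rule clin_cscale[OF clinT])

lemma ss_cplx_on: "v \<in> gen_eig (cmap M) c \<Longrightarrow> ss_cplx v = cscale c v"
  unfolding ss_cplx_def by (rule blockwise_on[OF clin_cs])

lemma un_cplx_on: "v \<in> gen_eig (cmap M) c \<Longrightarrow> un_cplx v = cscale (1 / c) (cmap M v)"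
  unfolding un_cplx_def by (rule blockwise_on[OF clin_un])

lemma clin_ss: "clin ss_cplx" and clin_unc: "clin un_cplx"
  unfolding ss_cplx_def un_cplx_def by (rule clin_blockwise, rule clin_cs clin_un)+

lemma ss_cj: "ss_cplx (cj v) = cj (ss_cplx v)"
  unfolding ss_cplx_def by (rule blockwise_cj[OF clin_cs]) (simp_all add: cmap_M_cj)

lemma un_cj: "un_cplx (cj v) = cj (un_cplx v)"
  unfolding un_cplx_def by (rule blockwise_cj[OF clin_un]) (simp_all add: cmap_M_cj)

lemma ss_un: "(\<lambda>v. ss_cplx (un_cplx v)) = cmap M"
proof (rule eq_on_eigen[OF clin_comp[OF clin_ss clin_unc] clinT])
  fix c v assume v: "v \<in> gen_eig (cmap M) c"
  have "un_cplx v \<in> gen_eig (cmap M) c"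
    unfolding un_cplx_on[OF v] by (rule cplx.subspace_scale[OF subspace_gen gen_M[OF v]])
  then have "ss_cplx (un_cplx v) = cscale c (cscale (1 / c) (cmap M v))"
    by (simp add: ss_cplx_on un_cplx_on[OF v])
  then show "ss_cplx (un_cplx v) = cmap M v"
    using v gen_eig_0 clin_0[OF clinT] by (cases "c = 0") auto
qed

lemma un_ss: "(\<lambda>v. un_cplx (ss_cplx v)) = cmap M"
proof (rule eq_on_eigen[OF clin_comp[OF clin_unc clin_ss] clinT])
  fix c v assume v: "v \<in> gen_eig (cmap M) c"
  have "ss_cplx v \<in> gen_eig (cmap M) c"
    unfolding ss_cplx_on[OF v] by (rule cplx.subspace_scale[OF subspace_gen v])
  then have "un_cplx (ss_cplx v) = cscale (1 / c) (cmap M (cscale c v))"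
    by (simp add: ss_cplx_on[OF v] un_cplx_on)
  then show "un_cplx (ss_cplx v) = cmap M v"
    using v gen_eig_0 clin_0[OF clinT] by (cases "c = 0") (auto simp: clin_scale[OF clinT])
qed

lemma jordan_exists: "jordan_decomposition M (re_op ss_cplx) (re_op un_cplx)"
proof -
  let ?s = "re_op ss_cplx" and ?u = "re_op un_cplx"
  have cs: "cmap ?s = ss_cplx" and cu: "cmap ?u = un_cplx"
    by (rule cmap_re_op[OF clin_ss ss_cj], rule cmap_re_op[OF clin_unc un_cj])
  have ls: "linear ?s" and lu: "linear ?u"
    by (rule linear_re_op[OF clin_ss ss_cj], rule linear_re_op[OF clin_unc un_cj])
  have "(\<Union>c. gen_eig (cmap M) c) \<subseteq> {v. \<exists>c. cmap ?s v = cscale c v}"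
    unfolding cs using ss_cplx_on by blast
  then have "cplx.span (\<Union>c. gen_eig (cmap M) c) \<subseteq> cplx.span {v. \<exists>c. cmap ?s v = cscale c v}"
    by (rule cplx.span_mono)
  then have "semisimple ?s" unfolding semisimple_def span_gen_eig[OF clinT finM] by blast
  moreover have "unipotent ?u"
  proof -
    have "gen_eig (cmap M) c \<subseteq> gen_eig un_cplx 1" for c
    proof
      fix v assume v: "v \<in> gen_eig (cmap M) c"
      then obtain n where n: "(shift_op (cmap M) c ^^ n) v = 0" by (auto simp: gen_eig_def)
      have pw: "(shift_op un_cplx 1 ^^ n) v = cscale ((1 / c) ^ n) ((shift_op (cmap M) c ^^ n) v)
          \<and> (shift_op (cmap M) c ^^ n) v \<in> gen_eig (cmap M) c" if "c \<noteq> 0" for n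
      proof (induction n)
        case (Suc n)
        let ?w = "(shift_op (cmap M) c ^^ n) v"
        have w: "?w \<in> gen_eig (cmap M) c" using Suc by blast
        have "shift_op un_cplx 1 (cscale ((1 / c) ^ n) ?w)
            = cscale ((1 / c) ^ n) (cscale (1 / c) (shift_op (cmap M) c ?w))"
          using \<open>c \<noteq> 0\<close>
          unfolding shift_op_def[of un_cplx] shift_op_def[of "cmap M" c ?w]
          by (simp add: clin_scale[OF clin_unc] un_cplx_on[OF w] cplx.scale_right_diff_distrib
              mult.commute)
        moreover have "shift_op (cmap M) c ?w \<in> gen_eig (cmap M) c"
          unfolding shift_op_def[of "cmap M" c ?w]
          by (intro cplx.subspace_diff cplx.subspace_scale subspace_gen gen_M w)
        ultimately show ?case using Suc by (simp add: mult.commute)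
      qed (use v in auto)
      show "v \<in> gen_eig un_cplx 1"
      proof (cases "c = 0")
        case True
        then have "v = 0" using v gen_eig_0 by simp
        then show ?thesis using cplx.subspace_0[OF subspace_gen_eig[OF clin_unc]] by metis
      next
        case False
        then have "(shift_op un_cplx 1 ^^ n) v = 0" using n pw by simp
        then show ?thesis by (auto simp: gen_eig_def)
      qed
    qed
    then have "cplx.span (\<Union>c. gen_eig (cmap M) c) \<subseteq> gen_eig un_cplx 1"
      by (intro cplx.span_minimal subspace_gen_eig[OF clin_unc]) blast
    then have loc: "v \<in> gen_eig un_cplx 1" for v unfolding span_gen_eig[OF clinT finM] by blast
    let ?R = "\<lambda>x. ?u x - x"
    have R: "linear ?R" by (intro linear_compose_sub lu linear_ident)
    have sh: "shift_op un_cplx 1 = cmap ?R"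
    proof
      fix v show "shift_op un_cplx 1 v = cmap ?R v"
        using fun_cong[OF cu, of v] by (simp add: shift_op_def cmap_def prod_eq_iff)
    qed
    have "\<exists>n. (?R ^^ n) x = 0" for x
    proof -
      obtain n where "cmap (?R ^^ n) (x, 0) = 0"
        using loc[of "(x, 0)"] unfolding gen_eig_def sh cmap_pow by blast
      then show ?thesis by (auto simp: cmap_def zero_prod_def)
    qed
    then have "(?R ^^ dim (UNIV :: 'a set)) x = 0" for x
      by (rule nilpotent_dim[OF R finM])
    then show ?thesis unfolding unipotent_def nilpotent_on_def by blast
  qed
  moreover have "M = ?s \<circ> ?u"
  proof (rule cmap_inject)
    have "cmap (?s \<circ> ?u) = (\<lambda>v. cmap ?s (cmap ?u v))" by (simp add: cmap_def fun_eq_iff)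
    then show "cmap M = cmap (?s \<circ> ?u)" using ss_un cs cu by simp
  qed
  moreover have "M = ?u \<circ> ?s"
  proof (rule cmap_inject)
    have "cmap (?u \<circ> ?s) = (\<lambda>v. cmap ?u (cmap ?s v))" by (simp add: cmap_def fun_eq_iff)
    then show "cmap M = cmap (?u \<circ> ?s)" using un_ss cs cu by simp
  qed
  ultimately show ?thesis using ls lu by (simp add: jordan_decomposition_def)
qed

text \<open>
  On \<open>ker (s - c)\<close> one has \<open>M - c = c (u - 1)\<close>, which is nilpotent. As these kernels span, \<open>s\<close> can only be
  the operator that acts on each generalized eigenspace as its eigenvalue.
\<close>

lemma jordan_eigen:
  assumes j: "jordan_decomposition M s u" and v: "cmap s v = cscale c v"
  shows "v \<in> gen_eig (cmap M) c"
proof -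
  have s: "linear s" "linear u" "unipotent u" and M: "M = s \<circ> u" "M = u \<circ> s"
    using j by (auto simp: jordan_decomposition_def)
  obtain n where n: "\<And>x. ((\<lambda>x. u x - x) ^^ n) x = 0"
    using s by (auto simp: unipotent_def nilpotent_on_def)
  let ?R = "cmap (\<lambda>x. u x - x)"
  have R: "clin ?R" by (intro clin_cmap linear_compose_sub linear_ident s)
  have us: "cmap s (?R w) = ?R (cmap s w)" for w
    using M s by (simp add: cmap_def linear_diff fun_eq_iff)
  have Mus: "shift_op (cmap M) c w = cscale c (?R w)" if "cmap s w = cscale c w" for w
  proof -
    have "cmap M w = cmap u (cmap s w)" using M(2) by (simp add: cmap_def)
    also have "\<dots> = cscale c (cmap u w)" using that clin_scale[OF clin_cmap[OF s(2)]] by simp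
    also have "cmap u w = ?R w + w" by (simp add: cmap_def prod_eq_iff)
    finally show ?thesis by (simp add: shift_op_def cplx.scale_right_distrib)
  qed
  have "(shift_op (cmap M) c ^^ k) v = cscale (c ^ k) ((?R ^^ k) v)
      \<and> cmap s ((?R ^^ k) v) = cscale c ((?R ^^ k) v)" for k
  proof (induction k)
    case (Suc k)
    have "shift_op (cmap M) c (cscale (c ^ k) ((?R ^^ k) v))
        = cscale (c ^ k) (shift_op (cmap M) c ((?R ^^ k) v))"
      by (rule clin_scale[OF clin_shift[OF clinT]])
    then show ?case using Suc Mus[of "(?R ^^ k) v"] us
      by (simp add: clin_scale[OF R] mult.commute)
  qed (use v in auto)
  from this[of n] have "(shift_op (cmap M) c ^^ n) v = 0"
    using n by (simp add: cmap_pow cmap_def zero_prod_def[symmetric])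
  then show ?thesis by (auto simp: gen_eig_def)
qed

lemma jordan_unique:
  assumes j: "jordan_decomposition M s u"
  shows "s = re_op ss_cplx" "u = re_op un_cplx"
proof -
  have s: "linear s" "linear u" "semisimple s" and M: "M = s \<circ> u" "M = u \<circ> s"
    using j by (auto simp: jordan_decomposition_def)
  have "cmap s v = ss_cplx v" for v
  proof -
    have "v \<in> cplx.span {v. \<exists>c. cmap s v = cscale c v}"
      using s(3) by (simp add: semisimple_def)
    then show ?thesis
    proof (induction rule: cplx.span_induct_alt)
      case base show ?case using clin_0[OF clin_ss] clin_0[OF clin_cmap[OF s(1)]] by simp
    next
      case (step z x y)
      then obtain c where c: "cmap s x = cscale c x" by blast
      then have "ss_cplx x = cmap s x" using ss_cplx_on[OF jordan_eigen[OF j]] by simp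
      then show ?case using step by (simp add: clin_simps clin_ss clin_cmap[OF s(1)])
    qed
  qed
  then have "cmap s = cmap (re_op ss_cplx)" using cmap_re_op[OF clin_ss ss_cj] by auto
  then show s': "s = re_op ss_cplx" by (rule cmap_inject)
  have "M = s \<circ> re_op un_cplx" using jordan_exists s' by (simp add: jordan_decomposition_def)
  moreover have "inj s" using M(2) bijM by (metis bij_def inj_on_imageI2)
  ultimately show "u = re_op un_cplx" using M(1)
    by (metis comp_apply ext injD)
qed

lemma semisimple_part_eq: "semisimple_part M = re_op ss_cplx"
  and unipotent_part_eq: "unipotent_part M = re_op un_cplx"
  unfolding semisimple_part_def unipotent_part_def using jordan_exists jordan_unique by blast+

lemma jordan_parts: "jordan_decomposition M (semisimple_part M) (unipotent_part M)"
  unfolding semisimple_part_eq unipotent_part_eq by (rule jordan_exists)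

lemma cmap_semisimple_part: "cmap (semisimple_part M) = ss_cplx"
  unfolding semisimple_part_eq by (rule cmap_re_op[OF clin_ss ss_cj])

lemma cmap_unipotent_part: "cmap (unipotent_part M) = un_cplx"
  unfolding unipotent_part_eq by (rule cmap_re_op[OF clin_unc un_cj])

lemma eigsp_eq: "eigsp M c = gen_eig (cmap M) c"
proof
  show "eigsp M c \<subseteq> gen_eig (cmap M) c" using jordan_eigen[OF jordan_parts] by (auto simp: eigsp_def)
  show "gen_eig (cmap M) c \<subseteq> eigsp M c" using ss_cplx_on by (auto simp: eigsp_def cmap_semisimple_part)
qed

end

section \<open>Power series in a nilpotent operator\<close>

definition nil_op :: "('a::real_vector cplx \<Rightarrow> 'a cplx) \<Rightarrow> bool" where
  "nil_op T \<longleftrightarrow> clin T \<and> (\<forall>v. (T ^^ dim (UNIV :: 'a set)) v = 0)"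

text \<open>
  For nilpotent \<open>T\<close> this is a ring homomorphism from formal power series to operators, compatible with
  composition of series.
\<close>

definition fps_op :: "('a::real_vector cplx \<Rightarrow> 'a cplx) \<Rightarrow> complex fps \<Rightarrow> 'a cplx \<Rightarrow> 'a cplx" where
  "fps_op T f = cnil_series (fps_nth f) T"

lemma nil_op_clin: "nil_op T \<Longrightarrow> clin T"
  by (simp add: nil_op_def)

lemma nil_op_pow:
  fixes T :: "'a::real_vector cplx \<Rightarrow> 'a cplx"
  shows "nil_op T \<Longrightarrow> dim (UNIV :: 'a set) \<le> n \<Longrightarrow> (T ^^ n) v = 0"
  using pow_zero_mono[of T "dim (UNIV :: 'a set)" v n] clin_0 by (auto simp: nil_op_def)

lemma fps_op_upto:
  fixes T :: "'a::real_vector cplx \<Rightarrow> 'a cplx"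
  assumes "nil_op T" "dim (UNIV :: 'a set) \<le> n"
  shows "fps_op T f v = (\<Sum>k<n. cscale (fps_nth f k) ((T ^^ k) v))"
  unfolding fps_op_def cnil_series_def
  by (rule sum.mono_neutral_left) (use assms in \<open>auto simp: nil_op_pow\<close>)

lemma clin_fps_op: "clin T \<Longrightarrow> clin (fps_op T f)"
  unfolding fps_op_def cnil_series_def[abs_def] by (rule clin_sum_op) (rule clin_cscale[OF clin_pow])

lemma fps_op_add: "fps_op T (f + g) v = fps_op T f v + fps_op T g v"
  by (simp add: fps_op_def cnil_series_def cplx.scale_left_distrib sum.distrib)

lemma fps_op_minus: "fps_op T (- f) v = - fps_op T f v"
  by (simp add: fps_op_def cnil_series_def sum_negf)

lemma fps_op_diff: "fps_op T (f - g) v = fps_op T f v - fps_op T g v"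
  using fps_op_add[of T f "- g"] by (simp add: fps_op_minus)

lemma fps_op_const: "nil_op T \<Longrightarrow> fps_op T (fps_const c) v = cscale c v"
  for T :: "'a::real_vector cplx \<Rightarrow> 'a cplx"
  by (subst fps_op_upto[where n = "Suc (dim (UNIV :: 'a set))"])
     (simp_all add: sum.lessThan_Suc_shift del: sum.lessThan_Suc)

lemma fps_op_1: "nil_op T \<Longrightarrow> fps_op T 1 v = v"
  using fps_op_const[of T 1 v] by simp

lemma fps_op_X: "nil_op T \<Longrightarrow> fps_op T fps_X v = T v"
  for T :: "'a::real_vector cplx \<Rightarrow> 'a cplx"
  by (subst fps_op_upto[where n = "Suc (Suc (dim (UNIV :: 'a set)))"])
     (simp_all add: sum.lessThan_Suc_shift fps_X_def del: sum.lessThan_Suc)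

lemma fps_op_mult:
  fixes T :: "'a::real_vector cplx \<Rightarrow> 'a cplx"
  assumes T: "nil_op T" shows "fps_op T (f * g) v = fps_op T f (fps_op T g v)"
proof -
  let ?D = "dim (UNIV :: 'a set)"
  let ?t = "\<lambda>i j. cscale (fps_nth f i * fps_nth g j) ((T ^^ (i + j)) v)"
  have "fps_op T f (fps_op T g v) = (\<Sum>i<?D. \<Sum>j<?D. ?t i j)"
    unfolding fps_op_def cnil_series_def
    by (simp add: clin_sum[OF clin_pow[OF nil_op_clin[OF T]]] clin_scale[OF clin_pow[OF nil_op_clin[OF T]]]
        cplx.scale_sum_right funpow_add)
  also have "\<dots> = (\<Sum>(i,j)\<in>{..<?D}\<times>{..<?D}. ?t i j)" by (rule sum.cartesian_product)
  also have "\<dots> = (\<Sum>(i,j)\<in>{(i,j). i + j < ?D}. ?t i j)"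
  proof (rule sum.mono_neutral_right)
    show "\<forall>x\<in>{..<?D} \<times> {..<?D} - {(i, j). i + j < ?D}. (case x of (i, j) \<Rightarrow> ?t i j) = 0"
      by auto (metis nil_op_pow[OF T] not_less)
  qed auto
  also have "\<dots> = (\<Sum>k<?D. \<Sum>i\<le>k. ?t i (k - i))" by (rule sum.triangle_reindex)
  also have "\<dots> = fps_op T (f * g) v"
    by (simp add: fps_op_def cnil_series_def fps_mult_nth cplx.scale_sum_left atMost_atLeast0)
  finally show ?thesis ..
qed

lemma fps_op_commute:
  assumes "clin A" "\<And>x. A (T x) = T (A x)" shows "A (fps_op T f v) = fps_op T f (A v)"
  by (simp add: fps_op_def cnil_series_def clin_sum[OF assms(1)] clin_scale[OF assms(1)]
      comm_pow2[of A T, OF assms(2)])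

lemma fps_op_stable:
  assumes "cplx.subspace U" "\<And>x. x \<in> U \<Longrightarrow> T x \<in> U" "v \<in> U" shows "fps_op T f v \<in> U"
  unfolding fps_op_def cnil_series_def
  by (intro cplx.subspace_sum cplx.subspace_scale assms(1)) (rule pow_stable[OF assms(2,3)])

lemma fps_op_inverse:
  assumes "nil_op T" "fps_nth f 0 \<noteq> 0"
  shows "fps_op T f (fps_op T (inverse f) v) = v" "fps_op T (inverse f) (fps_op T f v) = v"
  using assms by (simp_all add: fps_op_mult[symmetric] fps_op_1 inverse_mult_eq_1 inverse_mult_eq_1')

lemma fps_op_bij: "nil_op T \<Longrightarrow> fps_nth f 0 \<noteq> 0 \<Longrightarrow> bij (fps_op T f)"
  by (rule o_bij[of "fps_op T (inverse f)"]) (auto simp: fun_eq_iff fps_op_inverse)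

lemma inv_fps_op: "nil_op T \<Longrightarrow> fps_nth f 0 \<noteq> 0 \<Longrightarrow> inv (fps_op T f) = fps_op T (inverse f)"
  by (rule inv_unique_comp) (auto simp: fun_eq_iff fps_op_inverse)

text \<open>
  On a space where \<open>T\<close> vanishes modulo a smaller one, only the constant term of a series acts.
\<close>

lemma fps_op_tail:
  assumes T: "nil_op T"
  shows "fps_op T f v = cscale (fps_nth f 0) v + T (fps_op T (fps_shift 1 f) v)"
proof -
  have "f = fps_const (fps_nth f 0) + fps_X * fps_shift 1 f"
    by (rule fps_ext) (auto simp: gr0_conv_Suc)
  then have "fps_op T f v = fps_op T (fps_const (fps_nth f 0) + fps_X * fps_shift 1 f) v" by simp
  then show ?thesis by (simp add: fps_op_add fps_op_mult[OF T] fps_op_X[OF T] fps_op_const[OF T])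
qed

lemma fps_op_power: "nil_op T \<Longrightarrow> (fps_op T g ^^ k) v = fps_op T (g ^ k) v"
  by (induction k) (auto simp: fps_op_1 fps_op_mult)

lemma nil_op_fps_op:
  fixes T :: "'a::real_vector cplx \<Rightarrow> 'a cplx"
  assumes T: "nil_op T" and g: "fps_nth g 0 = 0" shows "nil_op (fps_op T g)"
proof -
  let ?D = "dim (UNIV :: 'a set)"
  have "(fps_op T g ^^ ?D) v = 0" for v
  proof -
    have "fps_op T (g ^ ?D) v = 0" unfolding fps_op_def cnil_series_def
      using startsby_zero_power_prefix[OF g] by (intro sum.neutral) auto
    then show ?thesis by (simp add: fps_op_power[OF T])
  qed
  then show ?thesis using clin_fps_op[OF nil_op_clin[OF T]] by (auto simp: nil_op_def)
qed

lemma fps_op_compose: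
  fixes T :: "'a::real_vector cplx \<Rightarrow> 'a cplx"
  assumes T: "nil_op T" and g: "fps_nth g 0 = 0"
  shows "fps_op (fps_op T g) f v = fps_op T (f oo g) v"
proof -
  let ?D = "dim (UNIV :: 'a set)"
  have "fps_op (fps_op T g) f v = (\<Sum>k<?D. cscale (fps_nth f k) (fps_op T (g ^ k) v))"
    by (simp add: fps_op_def[of "fps_op T g"] cnil_series_def fps_op_power[OF T])
  also have "\<dots> = (\<Sum>k<?D. \<Sum>n<?D. cscale (fps_nth f k * fps_nth (g ^ k) n) ((T ^^ n) v))"
    by (simp add: fps_op_def cnil_series_def cplx.scale_sum_right)
  also have "\<dots> = (\<Sum>n<?D. \<Sum>k<?D. cscale (fps_nth f k * fps_nth (g ^ k) n) ((T ^^ n) v))" by (rule sum.swap)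
  also have "\<dots> = (\<Sum>n<?D. cscale (fps_nth (f oo g) n) ((T ^^ n) v))"
  proof (rule sum.cong[OF refl])
    fix n assume n: "n \<in> {..<?D}"
    have "(\<Sum>k<?D. fps_nth f k * fps_nth (g ^ k) n) = (\<Sum>k=0..n. fps_nth f k * fps_nth (g ^ k) n)"
      by (rule sum.mono_neutral_right)
         (use n startsby_zero_power_prefix[OF g] in \<open>auto simp: not_le\<close>)
    then show "(\<Sum>k<?D. cscale (fps_nth f k * fps_nth (g ^ k) n) ((T ^^ n) v)) = cscale (fps_nth (f oo g) n) ((T ^^ n) v)"
      by (simp add: fps_compose_nth flip: cplx.scale_sum_left)
  qed
  finally show ?thesis by (simp add: fps_op_def cnil_series_def)
qed

lemma fps_op_cj:
  assumes "\<And>x. T (cj x) = cj (T x)" "\<And>k. fps_nth g k = cnj (fps_nth f k)"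
  shows "fps_op T g (cj v) = cj (fps_op T f v)"
  by (simp add: fps_op_def cnil_series_def cj_sum assms(2) comm_pow[of T cj, OF assms(1)])

lemma cmap_nil_series: "cmap (nil_series c R) = cnil_series (\<lambda>k. of_real (c k)) (cmap R)"
  by (auto simp: fun_eq_iff nil_series_def cnil_series_def cmap_pow cmap_def cscale_def
      prod_eq_iff fst_sum snd_sum)

lemma nil_op_cmap:
  fixes R :: "'a::real_vector \<Rightarrow> 'a"
  assumes "linear R" "finite_dimensional (UNIV :: 'a set)" "nilpotent_on UNIV R"
  shows "nil_op (cmap R)"
proof -
  have "(R ^^ dim (UNIV :: 'a set)) x = 0" for x
    by (rule nilpotent_dim[OF assms(1,2)]) (use assms(3) in \<open>auto simp: nilpotent_on_def\<close>)
  then show ?thesis using clin_cmap[OF assms(1)]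
    by (auto simp: nil_op_def cmap_pow cmap_def zero_prod_def)
qed

lemma linear_nil_series:
  assumes "linear R" shows "linear (nil_series c R)"
  unfolding nil_series_def[abs_def]
  by (intro linear_compose_sum ballI linear_compose_scale_right linear_pow assms)

lemma exp_compose_ln: "fps_exp 1 oo fps_ln 1 = (1 + fps_X :: complex fps)"
proof -
  have "(fps_exp 1 - 1 :: complex fps) oo fps_inv (fps_exp 1 - 1) = fps_X"
    by (rule fps_inv_right) auto
  then have "(fps_exp 1 oo fps_ln 1) - (1 :: complex fps) = fps_X"
    by (simp add: fps_ln_fps_exp_inv[of "1 :: complex"] fps_compose_sub_distrib)
  then show ?thesis by (simp add: algebra_simps)
qed

context automorphism
begin

abbreviation N :: "'a \<Rightarrow> 'a" where "N \<equiv> log_unipotent M"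

lemma linear_unipotent_part: "linear (unipotent_part M)"
  using jordan_parts by (simp add: jordan_decomposition_def)

lemma linear_N: "linear N"
  unfolding log_unipotent_def
  by (intro linear_nil_series linear_compose_sub linear_unipotent_part linear_ident)

lemma nil_op_R: "nil_op (cmap (\<lambda>x. unipotent_part M x - x))"
  by (intro nil_op_cmap linear_compose_sub linear_unipotent_part linear_ident finM)
     (use jordan_parts in \<open>simp add: jordan_decomposition_def unipotent_def\<close>)

lemma cmap_N: "cmap N = fps_op (cmap (\<lambda>x. unipotent_part M x - x)) (fps_ln 1)"
  unfolding log_unipotent_def cmap_nil_series fps_op_def
  by (rule arg_cong[where f = "\<lambda>c. cnil_series c _"]) (auto simp: fun_eq_iff fps_ln_nth gr0_conv_Suc)

lemma nil_N: "nil_op (cmap N)"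
  unfolding cmap_N by (rule nil_op_fps_op[OF nil_op_R]) simp

lemma clin_N: "clin (cmap N)"
  using nil_N by (rule nil_op_clin)

lemma cmap_N_cj: "cmap N (cj x) = cj (cmap N x)"
  by (simp add: cj_cmap linear_N)

lemma exp_N: "fps_op (cmap N) (fps_exp 1) v = un_cplx v"
proof -
  let ?R = "cmap (\<lambda>x. unipotent_part M x - x)"
  have "fps_op (cmap N) (fps_exp 1) v = fps_op ?R (fps_exp 1 oo fps_ln 1) v"
    unfolding cmap_N by (rule fps_op_compose[OF nil_op_R]) simp
  also have "\<dots> = v + ?R v"
    by (simp add: exp_compose_ln fps_op_add fps_op_1[OF nil_op_R] fps_op_X[OF nil_op_R])
  also have "\<dots> = cmap (unipotent_part M) v" by (simp add: cmap_def prod_eq_iff)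
  finally show ?thesis by (simp add: cmap_unipotent_part)
qed

lemma un_gen: "v \<in> gen_eig (cmap M) c \<Longrightarrow> un_cplx v \<in> gen_eig (cmap M) c"
  unfolding un_cplx_on by (rule cplx.subspace_scale[OF subspace_gen gen_M])

lemma N_gen: "v \<in> gen_eig (cmap M) c \<Longrightarrow> cmap N v \<in> gen_eig (cmap M) c"
  unfolding cmap_N
proof (rule fps_op_stable[OF subspace_gen])
  fix x assume x: "x \<in> gen_eig (cmap M) c"
  have "cmap (\<lambda>x. unipotent_part M x - x) x = un_cplx x - x"
    using fun_cong[OF cmap_unipotent_part, of x] by (simp add: cmap_def prod_eq_iff)
  then show "cmap (\<lambda>x. unipotent_part M x - x) x \<in> gen_eig (cmap M) c"
    using x un_gen cplx.subspace_diff[OF subspace_gen] by metis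
qed

lemma fps_N_gen: "v \<in> gen_eig (cmap M) c \<Longrightarrow> fps_op (cmap N) f v \<in> gen_eig (cmap M) c"
  by (rule fps_op_stable[OF subspace_gen N_gen])

text \<open>
  The Jordan decomposition in exponential form; it makes every function of \<open>M\<close> a power series in \<open>N\<close>
  on each generalized eigenspace.
\<close>

lemma M_on:
  assumes "v \<in> gen_eig (cmap M) c"
  shows "cmap M v = fps_op (cmap N) (fps_const c * fps_exp 1) v"
proof -
  have "cmap M v = un_cplx (ss_cplx v)" using fun_cong[OF un_ss, of v] by simp
  then show ?thesis using assms
    by (simp add: ss_cplx_on clin_scale[OF clin_unc] fps_op_mult[OF nil_N] exp_N fps_op_const[OF nil_N])
qed

end

section \<open>The Gamma function and the reflection formula for power series\<close>

text \<open>
  The Taylor series of \<open>x \<mapsto> \<Gamma>(\<beta> - x/(2\<pi>i))\<close> at \<open>0\<close>.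
\<close>

definition gamma_fps :: "real \<Rightarrow> complex fps" where
  "gamma_fps \<beta> = Abs_fps (\<lambda>k. (deriv ^^ k) Gamma (complex_of_real \<beta>) / fact k
                      * (- 1 / (2 * of_real pi * \<i>)) ^ k)"

lemma GG_eq: "GG N \<beta> = fps_op (cmap N) (gamma_fps \<beta>)"
  unfolding GG_def fps_op_def
  by (rule arg_cong[where f = "\<lambda>c. cnil_series c _"]) (simp add: fun_eq_iff gamma_fps_def)

abbreviation gamma_dir :: complex where "gamma_dir \<equiv> - 1 / (2 * of_real pi * \<i>)"

lemma gamma_fps_expansion_aux:
  assumes "\<beta> > 0"
  shows "(\<lambda>x. Gamma (of_real \<beta> + a * x)) has_fps_expansion (fps_expansion Gamma (of_real \<beta>) oo (fps_const a * fps_X))"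
proof -
  have "complex_of_real \<beta> \<notin> \<int>\<^sub>\<le>\<^sub>0" using assms by (auto elim!: nonpos_Ints_cases simp: complex_eq_iff)
  then have "Gamma analytic_on {complex_of_real \<beta>}" by (intro analytic_Gamma) auto
  from analytic_at_imp_has_fps_expansion[OF this]
  have "((\<lambda>x. Gamma (of_real \<beta> + x)) \<circ> (\<lambda>x. a * x)) has_fps_expansion (fps_expansion Gamma (of_real \<beta>) oo (fps_const a * fps_X))"
    by (rule has_fps_expansion_compose) (auto intro!: fps_expansion_intros)
  then show ?thesis by (simp add: o_def)
qed

lemma gamma_fps_eq: "gamma_fps \<beta> = fps_expansion Gamma (of_real \<beta>) oo (fps_const gamma_dir * fps_X)"
  by (simp add: fps_eq_iff gamma_fps_def fps_expansion_def)

lemma gamma_fps_neg_eq: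
  "gamma_fps \<beta> oo (- fps_X) = fps_expansion Gamma (of_real \<beta>) oo (fps_const (- gamma_dir) * fps_X)"
proof (rule fps_ext)
  fix n
  show "fps_nth (gamma_fps \<beta> oo (- fps_X)) n
      = fps_nth (fps_expansion Gamma (of_real \<beta>) oo (fps_const (- gamma_dir) * fps_X)) n"
    unfolding fps_compose_uminus' fps_nth_compose_linear gamma_fps_def fps_expansion_def
      fps_nth_Abs_fps power_minus[of gamma_dir n] by (simp only: mult_ac)
qed

lemma gamma_fps_expansion:
  "\<beta> > 0 \<Longrightarrow> (\<lambda>x. Gamma (of_real \<beta> + gamma_dir * x)) has_fps_expansion gamma_fps \<beta>"
  unfolding gamma_fps_eq by (rule gamma_fps_expansion_aux)

lemma gamma_fps_neg_expansion:
  "\<beta> > 0 \<Longrightarrow> (\<lambda>x. Gamma (of_real \<beta> + (- gamma_dir) * x)) has_fps_expansion (gamma_fps \<beta> oo (- fps_X))"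
  unfolding gamma_fps_neg_eq by (rule gamma_fps_expansion_aux)

lemma gamma_fps_0: "fps_nth (gamma_fps \<beta>) 0 = of_real (Gamma \<beta>)"
  by (simp add: gamma_fps_def Gamma_complex_of_real)

lemma sin_reflection:
  fixes z :: complex
  assumes "z \<notin> \<int>" shows "Gamma z * Gamma (1 - z) * sin (of_real pi * z) = of_real pi"
proof -
  have "Gamma z \<noteq> 0" using assms by (auto simp: Gamma_eq_zero_iff elim!: nonpos_Ints_cases)
  moreover have "1 - z \<notin> \<int>" using assms by (metis Ints_1 Ints_diff diff_diff_eq2 add_diff_cancel_left')
  then have "Gamma (1 - z) \<noteq> 0" unfolding Gamma_eq_zero_iff by (metis Ints_of_int nonpos_Ints_cases)
  ultimately have "of_real pi / sin (of_real pi * z) \<noteq> (0 :: complex)"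
    using Gamma_reflection_complex[of z] by (metis mult_eq_0_iff)
  then have "sin (of_real pi * z) \<noteq> 0" by auto
  then show ?thesis using Gamma_reflection_complex[of z] by (simp add: field_simps)
qed

lemma exp_minus_1: "exp (- (2 * of_real pi * \<i> * z)) - 1 = - 2 * \<i> * sin (of_real pi * z) * exp (- (of_real pi * \<i> * z))"
proof -
  let ?w = "of_real pi * \<i> * z"
  have 1: "sin (of_real pi * z) = (exp ?w - exp (- ?w)) / (2 * \<i>)"
    by (simp add: sin_exp_eq mult_ac)
  have 2: "exp (- (2 * of_real pi * \<i> * z)) = exp (- ?w) * exp (- ?w)"
    unfolding exp_add[symmetric] by (rule arg_cong[where f = exp]) simp
  have 3: "exp ?w * exp (- ?w) = 1" by (simp flip: exp_add)
  have "- 2 * \<i> * sin (of_real pi * z) * exp (- ?w) = - (exp ?w * exp (- ?w)) + exp (- ?w) * exp (- ?w)"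
    unfolding 1 by (simp add: field_simps)
  then show ?thesis by (simp only: 2 3) simp
qed

text \<open>
  Put \<open>z = \<alpha> - x/(2\<pi>i)\<close>, so that \<open>exp (- 2\<pi>i\<alpha>) exp x = exp (- 2\<pi>iz)\<close>. The reflection formula is
  \<open>\<Gamma>(z) \<Gamma>(1 - z) sin \<pi>z = \<pi>\<close>, and \<open>exp (- 2\<pi>iz) - 1 = - 2i sin(\<pi>z) exp (- \<pi>iz)\<close>. The sines cancel.
\<close>

lemma gamma_pairing:
  assumes \<alpha>: "0 < \<alpha>" "\<alpha> < 1"
  shows "(gamma_fps (1 - \<alpha>) oo (- fps_X)) * gamma_fps \<alpha>
           * (fps_const (exp (- (2 * of_real pi * \<i> * of_real \<alpha>))) * fps_exp 1 - 1)
       = fps_const (- 2 * of_real pi * \<i> * exp (- (of_real pi * \<i> * of_real \<alpha>))) * fps_exp (1 / 2)"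
    (is "?L = ?R")
proof -
  let ?z = "\<lambda>x. of_real \<alpha> + gamma_dir * x :: complex"
  let ?f = "\<lambda>x. Gamma (of_real (1 - \<alpha>) + (- gamma_dir) * x) * Gamma (?z x)
           * (exp (- (2 * of_real pi * \<i> * of_real \<alpha>)) * exp (1 * x) - 1)"
  let ?g = "\<lambda>x. (- 2 * of_real pi * \<i> * exp (- (of_real pi * \<i> * of_real \<alpha>))) * exp (1 / 2 * x)"
  have L: "?f has_fps_expansion ?L"
    by (intro has_fps_expansion_mult has_fps_expansion_diff has_fps_expansion_cmult_left
        has_fps_expansion_exp has_fps_expansion_1 gamma_fps_expansion gamma_fps_neg_expansion) (use \<alpha> in auto)
  have R: "?g has_fps_expansion ?R"
    by (intro has_fps_expansion_cmult_left has_fps_expansion_exp)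
  have "eventually (\<lambda>x. ?f x = ?g x) (nhds 0)"
  proof -
    have "eventually (\<lambda>x. Re (?z x) > 0 \<and> Re (?z x) < 1) (nhds 0)"
      by (intro eventually_conj order_tendstoD[where F = "nhds 0"] tendsto_Re)
         (use \<alpha> in \<open>auto intro!: tendsto_eq_intros filterlim_ident\<close>)
    then show ?thesis
    proof eventually_elim
      case (elim x)
      have "?z x \<notin> \<int>"
      proof
        assume "?z x \<in> \<int>"
        then obtain k where k: "?z x = of_int k" by (rule Ints_cases)
        show False using elim unfolding k by simp linarith
      qed
      from sin_reflection[OF this]
      have s: "Gamma (1 - ?z x) * Gamma (?z x) * sin (of_real pi * ?z x) = of_real pi" by (simp add: mult_ac)
      have z1: "of_real (1 - \<alpha>) + (- gamma_dir) * x = 1 - ?z x" by simp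
      have e: "2 * of_real pi * \<i> * ?z x = 2 * of_real pi * \<i> * of_real \<alpha> - x"
        "of_real pi * \<i> * ?z x = of_real pi * \<i> * of_real \<alpha> - x / 2"
        by (simp_all add: field_simps)
      have "exp (- (2 * of_real pi * \<i> * of_real \<alpha>)) * exp (1 * x) = exp (- (2 * of_real pi * \<i> * ?z x))"
        unfolding e by (simp flip: exp_add)
      then have "?f x = Gamma (1 - ?z x) * Gamma (?z x) * (- 2 * \<i> * sin (of_real pi * ?z x) * exp (- (of_real pi * \<i> * ?z x)))"
        unfolding z1 exp_minus_1[symmetric] by simp
      also have "\<dots> = (Gamma (1 - ?z x) * Gamma (?z x) * sin (of_real pi * ?z x)) * (- 2 * \<i> * exp (- (of_real pi * \<i> * ?z x)))"
        by (simp only: mult_ac)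
      also have "\<dots> = ?g x" unfolding s e by (simp add: exp_diff exp_minus field_simps flip: exp_add)
      finally show ?case .
    qed
  qed
  then have "?g has_fps_expansion ?L" using L by (subst (asm) has_fps_expansion_cong) auto
  then show ?thesis using R fps_expansion_unique_complex by blast
qed

text \<open>
  The case \<open>\<alpha> = 1\<close>, where \<open>M - 1\<close> is replaced by \<open>- (M - 1)/N\<close>. With \<open>n = - x/(2\<pi>i)\<close> the Gamma factors
  give \<open>\<Gamma>(1 + n) \<Gamma>(1 - n) = \<pi>n / sin \<pi>n\<close>, and this \<open>n\<close> cancels the denominator \<open>x\<close>. Both sides are compared
  after multiplication by \<open>x\<close>.
\<close>

lemma gamma_pairing_1:
  "(gamma_fps 1 oo (- fps_X)) * gamma_fps 1 * (- fps_shift 1 (fps_exp 1)) = - fps_exp (1 / 2)"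
proof -
  let ?n = "\<lambda>x. gamma_dir * x :: complex"
  let ?L = "(gamma_fps 1 oo (- fps_X)) * gamma_fps 1 * (1 - fps_exp 1)"
  let ?R = "- (fps_X * fps_exp (1 / 2)) :: complex fps"
  let ?f = "\<lambda>x. Gamma (of_real 1 + (- gamma_dir) * x) * Gamma (of_real 1 + ?n x) * (1 - exp (1 * x))"
  let ?g = "\<lambda>x. - (x * exp (1 / 2 * x)) :: complex"
  have L: "?f has_fps_expansion ?L"
    by (intro has_fps_expansion_mult has_fps_expansion_diff 
        has_fps_expansion_exp has_fps_expansion_1 gamma_fps_expansion gamma_fps_neg_expansion) auto
  have R: "?g has_fps_expansion ?R"
    by (intro fps_expansion_intros)
  have "eventually (\<lambda>x. norm (?n x) < 1) (nhds 0)"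
    by (rule order_tendstoD[where F = "nhds 0"], rule tendsto_norm) (auto intro!: tendsto_eq_intros filterlim_ident)
  then have "eventually (\<lambda>x. ?f x = ?g x) (nhds 0)"
  proof eventually_elim
    case (elim x)
    show ?case
    proof (cases "x = 0")
      case False
      let ?m = "?n x"
      have m0: "?m \<noteq> 0" using False by simp
      have mZ: "?m \<notin> \<int>"
      proof
        assume "?m \<in> \<int>"
        then obtain k where k: "?m = of_int k" by (rule Ints_cases)
        then have "\<bar>real_of_int k\<bar> < 1" using elim by (metis norm_of_int)
        then have "k = 0" by linarith
        then show False using k m0 by simp
      qed
      then have "?m \<notin> \<int>\<^sub>\<le>\<^sub>0" by (metis Ints_of_int nonpos_Ints_cases)
      then have G: "Gamma (1 + ?m) = ?m * Gamma ?m" using Gamma_plus1[of ?m] by (simp add: add.commute)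
      have s: "Gamma ?m * Gamma (1 - ?m) * sin (of_real pi * ?m) = of_real pi" by (rule sin_reflection[OF mZ])
      have e: "- (2 * of_real pi * \<i> * ?m) = x" "- (of_real pi * \<i> * ?m) = x / 2" "2 * \<i> * of_real pi * ?m = - x"
        by (simp_all add: field_simps)
      have E: "exp x - 1 = - 2 * \<i> * sin (of_real pi * ?m) * exp (x / 2)"
        using exp_minus_1[of ?m] unfolding e .
      have z1: "of_real 1 + (- gamma_dir) * x = 1 - ?m" "complex_of_real 1 = 1" "1 * x = x" by simp_all
      have "?f x = Gamma (1 - ?m) * (?m * Gamma ?m) * (1 - exp x)" unfolding z1(1) unfolding z1(2,3) G ..
      also have "\<dots> = - (Gamma (1 - ?m) * (?m * Gamma ?m) * (exp x - 1))"
        by (simp only: mult_minus_right[symmetric] minus_diff_eq)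
      also have "\<dots> = (2 * \<i> * (Gamma ?m * Gamma (1 - ?m) * sin (of_real pi * ?m)) * ?m) * exp (x / 2)"
        unfolding E by (simp only: mult_ac mult_minus_left mult_minus_right minus_minus)
      also have "\<dots> = - x * exp (x / 2)" unfolding s e(3) ..
      finally show ?thesis by simp
    qed simp
  qed
  then have "?g has_fps_expansion ?L" using L by (subst (asm) has_fps_expansion_cong) auto
  then have LR: "?L = ?R" using R fps_expansion_unique_complex by blast
  have X: "1 - fps_exp 1 = fps_X * (- fps_shift 1 (fps_exp (1 :: complex)))"
    by (rule fps_ext) (auto simp: gr0_conv_Suc)
  have "fps_X * ((gamma_fps 1 oo (- fps_X)) * gamma_fps 1 * (- fps_shift 1 (fps_exp 1))) = fps_X * (- fps_exp (1 / 2))"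
    using LR unfolding X by (simp add: mult_ac)
  then show ?thesis by (simp only: mult_cancel_left fps_X_neq_zero) simp
qed

section \<open>Weight filtrations\<close>

lemma weight_filtration_mono: "is_weight_filtration V N w W \<Longrightarrow> j \<le> k \<Longrightarrow> W j \<subseteq> W k"
  and weight_filtration_sub: "is_weight_filtration V N w W \<Longrightarrow> W k \<subseteq> V"
  and weight_filtration_subspace: "is_weight_filtration V N w W \<Longrightarrow> subspace (W k)"
  and weight_filtration_N: "is_weight_filtration V N w W \<Longrightarrow> x \<in> W k \<Longrightarrow> N x \<in> W (k - 2)"
  unfolding is_weight_filtration_def increasing_filtration_def by blast+

lemma weight_filtration_ends:
  assumes "is_weight_filtration V N w W"
  shows "\<exists>L::nat. \<forall>l\<ge>L. W (w + int l) = V \<and> W (w - int l - 1) = {0}"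
proof -
  obtain a b where a: "W a = {0}" and b: "W b = V"
    using assms by (auto simp: is_weight_filtration_def increasing_filtration_def)
  have "W (w + int l) = V \<and> W (w - int l - 1) = {0}" if l: "l \<ge> nat (\<bar>a - w\<bar> + \<bar>b - w\<bar>)" for l
  proof
    have "b \<le> w + int l" "w - int l - 1 \<le> a" using l by linarith+
    then show "W (w + int l) = V" "W (w - int l - 1) = {0}"
      using a b weight_filtration_mono[OF assms] weight_filtration_sub[OF assms]
        subspace_0[OF weight_filtration_subspace[OF assms]] by blast+
  qed
  then show ?thesis by blast
qed

text \<open>
  The two middle steps of a weight filtration are recovered from the two outer ones, which gives
  uniqueness by descending induction.
\<close>

lemma weight_filtration_inner:
  assumes W: "is_weight_filtration V N w W"
  shows "W (w + int l - 1) = {x \<in> W (w + int l). (N ^^ l) x \<in> W (w - int l - 1)}"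
    and "W (w - int l) = {(N ^^ l) x + y |x y. x \<in> W (w + int l) \<and> y \<in> W (w - int l - 1)}"
proof -
  have q: "quotient_iso (N ^^ l) (W (w + int l)) (W (w + int l - 1)) (W (w - int l)) (W (w - int l - 1))"
    using W by (simp add: is_weight_filtration_def)
  have m: "W (w + int l - 1) \<subseteq> W (w + int l)" "W (w - int l - 1) \<subseteq> W (w - int l)"
    by (rule weight_filtration_mono[OF W], simp)+
  show "W (w + int l - 1) = {x \<in> W (w + int l). (N ^^ l) x \<in> W (w - int l - 1)}"
    using q m by (auto simp: quotient_iso_def)
  show "W (w - int l) = {(N ^^ l) x + y |x y. x \<in> W (w + int l) \<and> y \<in> W (w - int l - 1)}"
  proof
    show "W (w - int l) \<subseteq> {(N ^^ l) x + y |x y. x \<in> W (w + int l) \<and> y \<in> W (w - int l - 1)}"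
    proof
      fix y assume "y \<in> W (w - int l)"
      then obtain x where "x \<in> W (w + int l)" "y - (N ^^ l) x \<in> W (w - int l - 1)"
        using q by (auto simp: quotient_iso_def)
      then show "y \<in> {(N ^^ l) x + y |x y. x \<in> W (w + int l) \<and> y \<in> W (w - int l - 1)}"
        by (intro CollectI exI[of _ x] exI[of _ "y - (N ^^ l) x"]) simp
    qed
    show "{(N ^^ l) x + y |x y. x \<in> W (w + int l) \<and> y \<in> W (w - int l - 1)} \<subseteq> W (w - int l)"
      using q m subspace_add[OF weight_filtration_subspace[OF W, of "w - int l"]]
      unfolding quotient_iso_def by blast
  qed
qed

lemma weight_filtration_unique:
  assumes W: "is_weight_filtration V N w W" and W': "is_weight_filtration V N w W'"
  shows "W = W'"
proof -
  obtain L1 where L1: "\<forall>l\<ge>L1. W (w + int l) = V \<and> W (w - int l - 1) = {0}"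
    using weight_filtration_ends[OF W] by (rule exE)
  obtain L2 where L2: "\<forall>l\<ge>L2. W' (w + int l) = V \<and> W' (w - int l - 1) = {0}"
    using weight_filtration_ends[OF W'] by (rule exE)
  have big: "W (w + int l) = W' (w + int l) \<and> W (w - int l - 1) = W' (w - int l - 1)" if "l \<ge> max L1 L2" for l
    using L1 L2 that by simp
  have step: "W (w + int l) = W' (w + int l) \<and> W (w - int l - 1) = W' (w - int l - 1)"
    if "W (w + int (Suc l)) = W' (w + int (Suc l)) \<and> W (w - int (Suc l) - 1) = W' (w - int (Suc l) - 1)" for l
    using that weight_filtration_inner[OF W, of "Suc l"] weight_filtration_inner[OF W', of "Suc l"]
    by (simp add: algebra_simps)
  have all: "W (w + int l) = W' (w + int l) \<and> W (w - int l - 1) = W' (w - int l - 1)" for l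
  proof (cases "l \<ge> max L1 L2")
    case False
    then have "l \<le> max L1 L2" by (simp only: not_le less_imp_le)
    then show ?thesis
      by (induction rule: inc_induct) (use big step in blast)+
  qed (rule big)
  show ?thesis
  proof
    fix k show "W k = W' k"
    proof (cases "k \<ge> w")
      case True then show ?thesis using all[of "nat (k - w)"] by simp
    next
      case False then show ?thesis using all[of "nat (w - k - 1)"] by simp
    qed
  qed
qed

lemma weight_filtration_eqI: "is_weight_filtration V N w W \<Longrightarrow> weight_filtration V N w = W"
  unfolding weight_filtration_def by (rule the_equality) (auto dest: weight_filtration_unique)

lemma weight_filtration_shift:
  assumes "is_weight_filtration V N w W" shows "is_weight_filtration V N (w + j) (\<lambda>k. W (k - j))"
proof -
  have i: "increasing_filtration V W" and n: "\<forall>k. N ` W k \<subseteq> W (k - 2)"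
    and q: "\<And>l. quotient_iso (N ^^ l) (W (w + int l)) (W (w + int l - 1)) (W (w - int l)) (W (w - int l - 1))"
    using assms by (auto simp: is_weight_filtration_def)
  have "\<exists>k. W (k - j) = {0}" "\<exists>k. W (k - j) = V"
    using i unfolding increasing_filtration_def by (metis add_diff_cancel_right')+
  then have "increasing_filtration V (\<lambda>k. W (k - j))"
    using i by (auto simp: increasing_filtration_def)
  moreover have "\<forall>k. N ` W (k - j) \<subseteq> W (k - 2 - j)"
  proof
    fix k
    have e: "k - 2 - j = k - j - 2" by simp
    show "N ` W (k - j) \<subseteq> W (k - 2 - j)" unfolding e by (rule n[rule_format])
  qed
  moreover have e: "w + j + int l - j = w + int l" "w + j + int l - 1 - j = w + int l - 1"
    "w + j - int l - j = w - int l" "w + j - int l - 1 - j = w - int l - 1" for l by auto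
  ultimately show ?thesis unfolding is_weight_filtration_def e using q by blast
qed

lemma weight_filtration_restrict:
  assumes W: "is_weight_filtration V N w W" and N: "linear N" and V': "subspace V'" "V' \<subseteq> V"
    and Q: "linear Q" "\<And>x. Q x \<in> V'" "\<And>x. x \<in> V' \<Longrightarrow> Q x = x" "\<And>x. Q (N x) = N (Q x)"
    and QW: "\<And>k x. x \<in> W k \<Longrightarrow> Q x \<in> W k"
  shows "is_weight_filtration V' N w (\<lambda>k. W k \<inter> V')"
proof -
  have i: "increasing_filtration V W" and n: "\<forall>k. N ` W k \<subseteq> W (k - 2)"
    and q: "\<And>l. quotient_iso (N ^^ l) (W (w + int l)) (W (w + int l - 1)) (W (w - int l)) (W (w - int l - 1))"
    using W by (auto simp: is_weight_filtration_def)
  have NV: "N x \<in> V'" if "x \<in> V'" for x using Q(2,3,4) that by metis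
  have NlV: "(N ^^ l) x \<in> V'" if "x \<in> V'" for x l by (rule pow_stable[OF NV that])
  obtain a b where a: "W a = {0}" and b: "W b = V" using i by (auto simp: increasing_filtration_def)
  have ex: "\<exists>k. W k \<inter> V' = {0}" "\<exists>k. W k \<inter> V' = V'"
    by (rule exI[of _ a], use a subspace_0[OF V'(1)] in auto, rule exI[of _ b], use b V' in auto)
  have 1: "increasing_filtration V' (\<lambda>k. W k \<inter> V')"
    unfolding increasing_filtration_def
  proof (intro conjI allI impI ex)
    show "subspace (W k \<inter> V')" for k
      using i V' by (auto simp: increasing_filtration_def intro: subspace_inter)
    show "W j \<inter> V' \<subseteq> W k \<inter> V'" if "j \<le> k" for j k
      using weight_filtration_mono[OF W that] by blast
  qed simp
  have 2: "N ` (W k \<inter> V') \<subseteq> W (k - 2) \<inter> V'" for k using n NV by auto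
  have 3: "quotient_iso (N ^^ l) (W (w + int l) \<inter> V') (W (w + int l - 1) \<inter> V') (W (w - int l) \<inter> V') (W (w - int l - 1) \<inter> V')" for l
    unfolding quotient_iso_def
  proof (intro conjI ballI impI)
    show "(N ^^ l) ` (W (w + int l) \<inter> V') \<subseteq> W (w - int l) \<inter> V'"
      "(N ^^ l) ` (W (w + int l - 1) \<inter> V') \<subseteq> W (w - int l - 1) \<inter> V'"
      using q[of l] NlV by (auto simp: quotient_iso_def)
    show "x \<in> W (w + int l - 1) \<inter> V'" if "x \<in> W (w + int l) \<inter> V'" "(N ^^ l) x \<in> W (w - int l - 1) \<inter> V'" for x
      using q[of l] that by (auto simp: quotient_iso_def)
    fix y assume y: "y \<in> W (w - int l) \<inter> V'"
    then obtain x where x: "x \<in> W (w + int l)" "y - (N ^^ l) x \<in> W (w - int l - 1)"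
      using q[of l] by (auto simp: quotient_iso_def)
    have "Q ((N ^^ l) x) = (N ^^ l) (Q x)" by (rule comm_pow2[of Q N, OF Q(4)])
    then have "Q (y - (N ^^ l) x) = y - (N ^^ l) (Q x)" using y Q(1,3) by (simp add: linear_diff)
    then have "y - (N ^^ l) (Q x) \<in> W (w - int l - 1) \<inter> V'" using QW[OF x(2)] Q(2) by (metis IntI)
    then show "\<exists>x\<in>W (w + int l) \<inter> V'. y - (N ^^ l) x \<in> W (w - int l - 1) \<inter> V'"
      using QW[OF x(1)] Q(2) by blast
  qed
  show ?thesis using 1 2 3 by (simp add: is_weight_filtration_def)
qed

lemma set_sumI: "a \<in> A \<Longrightarrow> b \<in> B \<Longrightarrow> a + b \<in> set_sum A B"
  by (auto simp: set_sum_def)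

lemma set_sumE: "x \<in> set_sum A B \<Longrightarrow> (\<And>a b. x = a + b \<Longrightarrow> a \<in> A \<Longrightarrow> b \<in> B \<Longrightarrow> P) \<Longrightarrow> P"
  by (auto simp: set_sum_def)

lemma subspace_set_sum: "subspace A \<Longrightarrow> subspace B \<Longrightarrow> subspace (set_sum A B)"
  using subspace_sums[of A B] by (simp add: set_sum_def)

lemma weight_filtration_sum:
  assumes W1: "is_weight_filtration V1 N w W1" and W2: "is_weight_filtration V2 N w W2"
    and N: "linear N" and V: "V1 \<inter> V2 = {0}"
  shows "is_weight_filtration (set_sum V1 V2) N w (\<lambda>k. set_sum (W1 k) (W2 k))"
proof -
  have i: "increasing_filtration V1 W1" "increasing_filtration V2 W2"
    using W1 W2 by (auto simp: is_weight_filtration_def)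
  have q1: "\<And>l. quotient_iso (N ^^ l) (W1 (w + int l)) (W1 (w + int l - 1)) (W1 (w - int l)) (W1 (w - int l - 1))"
    and q2: "\<And>l. quotient_iso (N ^^ l) (W2 (w + int l)) (W2 (w + int l - 1)) (W2 (w - int l)) (W2 (w - int l - 1))"
    using W1 W2 by (auto simp: is_weight_filtration_def)
  have sub: "W1 k \<subseteq> V1" "W2 k \<subseteq> V2" "subspace (W1 k)" "subspace (W2 k)" for k
    using i by (auto simp: increasing_filtration_def)
  note linN = linear_pow[OF N]
  obtain a1 b1 a2 b2 where e: "W1 a1 = {0}" "W1 b1 = V1" "W2 a2 = {0}" "W2 b2 = V2"
    using i by (auto simp: increasing_filtration_def)
  have m: "j \<le> k \<Longrightarrow> W1 j \<subseteq> W1 k" "j \<le> k \<Longrightarrow> W2 j \<subseteq> W2 k" for j k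
    using i by (auto simp: increasing_filtration_def)
  have sV: "subspace V1" "subspace V2" using e sub by metis+
  have ms: "A \<subseteq> A' \<Longrightarrow> B \<subseteq> B' \<Longrightarrow> set_sum A B \<subseteq> set_sum A' B'" for A A' B B' :: "'a set"
    by (auto simp: set_sum_def)
  have "W1 (min a1 a2) = {0}" "W2 (min a1 a2) = {0}"
    using m[of "min a1 a2"] e sub subspace_0 by (metis min.cobounded1 min.cobounded2 subset_singletonD empty_iff)+
  then have "set_sum (W1 (min a1 a2)) (W2 (min a1 a2)) = {0}" by (simp add: set_sum_def)
  moreover have "W1 (max b1 b2) = V1" "W2 (max b1 b2) = V2"
    using m[of _ "max b1 b2"] e sub by (metis max.cobounded1 max.cobounded2 subset_antisym)+
  then have "set_sum (W1 (max b1 b2)) (W2 (max b1 b2)) = set_sum V1 V2" by simp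
  ultimately have ex: "\<exists>k. set_sum (W1 k) (W2 k) = {0}" "\<exists>k. set_sum (W1 k) (W2 k) = set_sum V1 V2"
    by metis+
  have 1: "increasing_filtration (set_sum V1 V2) (\<lambda>k. set_sum (W1 k) (W2 k))"
    unfolding increasing_filtration_def
    by (intro conjI allI impI ex subspace_set_sum sub ms m) assumption+
  have 2: "N ` set_sum (W1 k) (W2 k) \<subseteq> set_sum (W1 (k - 2)) (W2 (k - 2))" for k
    using weight_filtration_N[OF W1] weight_filtration_N[OF W2]
    by (auto elim!: set_sumE simp: linear_add[OF N] intro!: set_sumI)
  have 3: "quotient_iso (N ^^ l) (set_sum (W1 (w + int l)) (W2 (w + int l))) (set_sum (W1 (w + int l - 1)) (W2 (w + int l - 1)))
     (set_sum (W1 (w - int l)) (W2 (w - int l))) (set_sum (W1 (w - int l - 1)) (W2 (w - int l - 1)))" for l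
    unfolding quotient_iso_def
  proof (intro conjI ballI impI)
    note q = q1[of l, unfolded quotient_iso_def] q2[of l, unfolded quotient_iso_def]
    have im: "x \<in> W1 (w + int l) \<Longrightarrow> (N ^^ l) x \<in> W1 (w - int l)"
      "x \<in> W2 (w + int l) \<Longrightarrow> (N ^^ l) x \<in> W2 (w - int l)"
      "x \<in> W1 (w + int l - 1) \<Longrightarrow> (N ^^ l) x \<in> W1 (w - int l - 1)"
      "x \<in> W2 (w + int l - 1) \<Longrightarrow> (N ^^ l) x \<in> W2 (w - int l - 1)" for x
      using subsetD[OF q(1)[THEN conjunct1] imageI] subsetD[OF q(2)[THEN conjunct1] imageI]
        subsetD[OF q(1)[THEN conjunct2, THEN conjunct1] imageI]
        subsetD[OF q(2)[THEN conjunct2, THEN conjunct1] imageI] by simp_all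
    show "(N ^^ l) ` set_sum (W1 (w + int l)) (W2 (w + int l)) \<subseteq> set_sum (W1 (w - int l)) (W2 (w - int l))"
      using im by (auto elim!: set_sumE simp: linear_add[OF linN] intro!: set_sumI)
    show "(N ^^ l) ` set_sum (W1 (w + int l - 1)) (W2 (w + int l - 1)) \<subseteq> set_sum (W1 (w - int l - 1)) (W2 (w - int l - 1))"
      using im by (auto elim!: set_sumE simp: linear_add[OF linN] intro!: set_sumI)
    fix x assume "x \<in> set_sum (W1 (w + int l)) (W2 (w + int l))"
      and "(N ^^ l) x \<in> set_sum (W1 (w - int l - 1)) (W2 (w - int l - 1))"
    then obtain x1 x2 y1 y2 where x: "x = x1 + x2" "x1 \<in> W1 (w + int l)" "x2 \<in> W2 (w + int l)"
      and y: "(N ^^ l) x = y1 + y2" "y1 \<in> W1 (w - int l - 1)" "y2 \<in> W2 (w - int l - 1)"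
      by (auto elim!: set_sumE)
    have Nx: "(N ^^ l) x1 \<in> V1" "(N ^^ l) x2 \<in> V2" using im x sub by blast+
    have yV: "y1 \<in> V1" "y2 \<in> V2" using y sub by blast+
    have eq: "(N ^^ l) x1 - y1 = y2 - (N ^^ l) x2"
      using x(1) y(1) linear_add[OF linN, of l x1 x2] by (simp add: algebra_simps)
    have "(N ^^ l) x1 - y1 \<in> V1" "y2 - (N ^^ l) x2 \<in> V2" using Nx yV sV subspace_diff by blast+
    then have "(N ^^ l) x1 - y1 \<in> V1 \<inter> V2" using eq by simp
    then have "(N ^^ l) x1 - y1 = 0" unfolding V by simp
    then have "(N ^^ l) x1 = y1" "(N ^^ l) x2 = y2" using eq by simp_all
    then have "x1 \<in> W1 (w + int l - 1)" "x2 \<in> W2 (w + int l - 1)" using q x y by auto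
    then show "x \<in> set_sum (W1 (w + int l - 1)) (W2 (w + int l - 1))" unfolding x(1) by (rule set_sumI)
  next
    fix y assume "y \<in> set_sum (W1 (w - int l)) (W2 (w - int l))"
    then obtain y1 y2 where y: "y = y1 + y2" "y1 \<in> W1 (w - int l)" "y2 \<in> W2 (w - int l)"
      by (auto elim!: set_sumE)
    obtain x1 where x1: "x1 \<in> W1 (w + int l)" "y1 - (N ^^ l) x1 \<in> W1 (w - int l - 1)"
      using q1[of l] y by (auto simp: quotient_iso_def)
    obtain x2 where x2: "x2 \<in> W2 (w + int l)" "y2 - (N ^^ l) x2 \<in> W2 (w - int l - 1)"
      using q2[of l] y by (auto simp: quotient_iso_def)
    have "y - (N ^^ l) (x1 + x2) = (y1 - (N ^^ l) x1) + (y2 - (N ^^ l) x2)"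
      using y(1) linear_add[OF linN, of l x1 x2] by simp
    then have "y - (N ^^ l) (x1 + x2) \<in> set_sum (W1 (w - int l - 1)) (W2 (w - int l - 1))"
      using set_sumI[OF x1(2) x2(2)] by simp
    then show "\<exists>x\<in>set_sum (W1 (w + int l)) (W2 (w + int l)). y - (N ^^ l) x \<in> set_sum (W1 (w - int l - 1)) (W2 (w - int l - 1))"
      using set_sumI[OF x1(1) x2(1)] by blast
  qed
  show ?thesis using 1 2 3 by (simp add: is_weight_filtration_def)
qed

text \<open>
  An element of \<open>W\<^bsub>w-l\<^esub>\<close> is \<open>N\<^sup>l x\<close> up to an error in \<open>W\<^bsub>w-l-1\<^esub>\<close>. By induction the error is \<open>N\<^sup>l (N x')\<close>
  with \<open>N x'\<close> in \<open>W\<^bsub>w+l\<^esub>\<close>, and the filtration is finite.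
\<close>

lemma weight_filtration_image:
  assumes W: "is_weight_filtration V N w W" and N: "linear N" and y: "y \<in> W (w - int l)"
  shows "\<exists>x\<in>W (w + int l). y = (N ^^ l) x"
proof -
  obtain L where L: "\<forall>l\<ge>L. W (w + int l) = V \<and> W (w - int l - 1) = {0}"
    using weight_filtration_ends[OF W] by (rule exE)
  note linN = linear_pow[OF N]
  have "l + n > L \<Longrightarrow> y \<in> W (w - int l) \<Longrightarrow> \<exists>x\<in>W (w + int l). y = (N ^^ l) x" for n
  proof (induction n arbitrary: l y)
    case 0
    have "w - int (l - 1) - 1 = w - int l" using 0 by auto
    then have "y = 0" using L[rule_format, of "l - 1"] 0 by auto
    then show ?case using linear_0[OF linN] subspace_0[OF weight_filtration_subspace[OF W]]
      by (intro bexI[of _ 0]) auto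
  next
    case (Suc n)
    obtain x where x: "x \<in> W (w + int l)" "y - (N ^^ l) x \<in> W (w - int l - 1)"
      using Suc.prems W unfolding is_weight_filtration_def quotient_iso_def by blast
    have e: "w - int l - 1 = w - int (Suc l)" by simp
    obtain x' where x': "x' \<in> W (w + int (Suc l))" "y - (N ^^ l) x = (N ^^ Suc l) x'"
      using Suc.IH[of "Suc l"] Suc.prems x(2) unfolding e by auto
    have "N x' \<in> W (w + int (Suc l) - 2)" by (rule weight_filtration_N[OF W x'(1)])
    then have "N x' \<in> W (w + int l)" using weight_filtration_mono[OF W, of "w + int (Suc l) - 2" "w + int l"] by auto
    then have "x + N x' \<in> W (w + int l)" using x subspace_add[OF weight_filtration_subspace[OF W]] by blast
    moreover have "y = (N ^^ l) (x + N x')"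
      using x'(2) linear_add[OF linN, of l x "N x'"] by (simp add: funpow_swap1 algebra_simps)
    ultimately show ?case by blast
  qed
  from this[of "Suc L"] show ?thesis using y by simp
qed

lemma skew_pow:
  assumes "\<And>a b. a \<in> V \<Longrightarrow> b \<in> V \<Longrightarrow> S (N a) b + S a (N b) = (0::real)" "\<And>x. x \<in> V \<Longrightarrow> N x \<in> V" "a \<in> V" "b \<in> V"
  shows "S ((N ^^ l) a) b = (-1) ^ l * S a ((N ^^ l) b)"
  using assms(3,4)
proof (induction l arbitrary: b)
  case (Suc l)
  have "S ((N ^^ Suc l) a) b = - S ((N ^^ l) a) (N b)"
    using assms(1)[of "(N ^^ l) a" b] pow_stable[of V N a l] assms(2) Suc.prems by simp
  also have "\<dots> = - ((-1) ^ l * S a ((N ^^ l) (N b)))" using Suc assms(2) by simp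
  finally show ?case by (simp add: funpow_swap1)
qed simp

text \<open>
  The argument of smaller weight \<open>w - l\<close> is in the image of \<open>N\<^sup>l\<close>. Moving \<open>N\<^sup>l\<close> to the other argument keeps
  the sum of the weights and lowers their minimum, which cannot go on below the filtration.
\<close>

lemma weight_filtration_orth:
  assumes W: "is_weight_filtration V N w W" and N: "linear N" and S: "bilinear S"
    and sk: "\<And>a b. a \<in> V \<Longrightarrow> b \<in> V \<Longrightarrow> S (N a) b + S a (N b) = (0::real)"
    and jk: "j + k < 2 * w" and a: "a \<in> W j" and b: "b \<in> W k"
  shows "S a b = 0"
proof -
  obtain k0 where k0: "W k0 = {0}"
    using W by (auto simp: is_weight_filtration_def increasing_filtration_def)
  have NV: "x \<in> V \<Longrightarrow> N x \<in> V" for x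
    using W unfolding is_weight_filtration_def increasing_filtration_def by blast
  have NW: "(N ^^ l) x \<in> W (k - 2 * int l)" if "x \<in> W k" for x k l
  proof (induction l)
    case (Suc l) then show ?case using weight_filtration_N[OF W Suc.IH] by (simp add: algebra_simps)
  qed (use that in simp)
  note WV = subsetD[OF weight_filtration_sub[OF W]]
  have "min j k \<le> k0 + int n \<Longrightarrow> j + k < 2 * w \<Longrightarrow> a \<in> W j \<Longrightarrow> b \<in> W k \<Longrightarrow> S a b = 0" for n
  proof (induction n arbitrary: j k a b)
    case 0
    then have "a = 0 \<or> b = 0"
      using weight_filtration_mono[OF W, of j k0] weight_filtration_mono[OF W, of k k0] k0 by (auto simp: min_def split: if_splits)
    then show ?case using bilinear_lzero[OF S] bilinear_rzero[OF S] by auto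
  next
    case (Suc n)
    show ?case
    proof (cases "k \<le> j")
      case True
      define l where "l = nat (w - k)"
      have l: "k = w - int l" using True Suc.prems by (simp add: l_def)
      obtain x where x: "x \<in> W (w + int l)" "b = (N ^^ l) x"
        using weight_filtration_image[OF W N] Suc.prems l by blast
      have "S ((N ^^ l) a) x = 0"
        by (rule Suc.IH[OF _ _ NW[OF Suc.prems(3)] x(1)]) (use Suc.prems l True in auto)
      then have "(-1) ^ l * S a b = 0"
        using skew_pow[of V S N a x l, OF sk NV WV[OF Suc.prems(3)] WV[OF x(1)]] x(2) by simp
      then show ?thesis by simp
    next
      case False
      define l where "l = nat (w - j)"
      have l: "j = w - int l" using False Suc.prems by (simp add: l_def)
      obtain x where x: "x \<in> W (w + int l)" "a = (N ^^ l) x"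
        using weight_filtration_image[OF W N] Suc.prems l by blast
      have "S x ((N ^^ l) b) = 0"
        by (rule Suc.IH[OF _ _ x(1) NW[OF Suc.prems(4)]]) (use Suc.prems l False in auto)
      then show ?thesis
        using skew_pow[of V S N x b l, OF sk NV WV[OF x(1)] WV[OF Suc.prems(4)]] x(2) by simp
    qed
  qed
  moreover have "min j k \<le> k0 + int (nat (min j k - k0))" by linarith
  ultimately show ?thesis using jk a b by blast
qed

section \<open>Functional calculus of an automorphism\<close>

text \<open>
  The operator \<open>\<kappa> = \<nu>\<^sup>-\<^sup>1\<close> on the generalized eigenspace of \<open>c\<close>, as a series in \<open>N\<close>. For \<open>c \<noteq> 1\<close> it is
  \<open>M - 1 = c exp N - 1\<close>; for \<open>c = 1\<close> it is \<open>- (M - 1)/N = - (exp N - 1)/N\<close>.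
\<close>

definition seifert_fps :: "complex \<Rightarrow> complex fps" where
  "seifert_fps c = (if c = 1 then - fps_shift 1 (fps_exp 1) else fps_const c * fps_exp 1 - 1)"

lemma seifert_fps_0: "fps_nth (seifert_fps c) 0 = (if c = 1 then - 1 else c - 1)"
  by (simp add: seifert_fps_def)

lemma seifert_fps_0_nz: "fps_nth (seifert_fps c) 0 \<noteq> 0"
  by (simp add: seifert_fps_0)

lemma seifert_fps_cnj: "fps_nth (seifert_fps (cnj c)) k = cnj (fps_nth (seifert_fps c) k)"
  by (simp add: seifert_fps_def)

definition direct_part :: "('a::real_vector cplx \<Rightarrow> 'a cplx) \<Rightarrow> complex set \<Rightarrow> 'a cplx set" where
  "direct_part T C = {v. \<forall>c. c \<notin> C \<longrightarrow> eig_part T c v = 0}"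

text \<open>
  A graded subspace is the sum of its intersections with the generalized eigenspaces. Sums,
  intersections and conjugates of graded subspaces can be compared one eigenvalue at a time.
\<close>

definition graded :: "('a::real_vector cplx \<Rightarrow> 'a cplx) \<Rightarrow> 'a cplx set \<Rightarrow> bool" where
  "graded T A \<longleftrightarrow> cplx.subspace A \<and> (\<forall>c. \<forall>v\<in>A. eig_part T c v \<in> A)"

lemma subspace_cset: "subspace U \<Longrightarrow> cplx.subspace (cset U)"
  by (rule cplx.subspaceI)
     (auto simp: cset_def cscale_def subspace_0 subspace_add subspace_diff subspace_scale
        mem_Times_iff zero_prod_def)

lemma cj_cset:
  fixes U :: "'a::real_vector set"
  assumes U: "subspace U" shows "cj ` cset U = cset U"
proof (rule set_eqI)
  fix v :: "'a cplx"
  have "- snd v \<in> U \<longleftrightarrow> snd v \<in> U" using subspace_neg[OF U] by (metis minus_minus)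
  then show "v \<in> cj ` cset U \<longleftrightarrow> v \<in> cset U"
    unfolding cj_in_image by (simp add: cset_def cj_def mem_Times_iff)
qed

lemma cset_Int: "cset (A \<inter> B) = cset A \<inter> cset B"
  by (auto simp: cset_def)

lemma subspace_cj: "cplx.subspace A \<Longrightarrow> cplx.subspace (cj ` A)"
  by (rule cplx.subspaceI)
     (simp_all add: cj_in_image cplx.subspace_0 cplx.subspace_add cplx.subspace_scale)

lemma csubspace_set_sum: "cplx.subspace A \<Longrightarrow> cplx.subspace B \<Longrightarrow> cplx.subspace (set_sum A B)"
  using cplx.subspace_sums[of A B] by (simp add: set_sum_def)

context finite_op
begin

lemma gradedI: "cplx.subspace A \<Longrightarrow> (\<And>x. x \<in> A \<Longrightarrow> T x \<in> A) \<Longrightarrow> graded T A"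
  using stable_eig_part by (auto simp: graded_def)

lemma graded_subspace: "graded T A \<Longrightarrow> cplx.subspace A"
  and graded_part: "graded T A \<Longrightarrow> v \<in> A \<Longrightarrow> eig_part T c v \<in> A"
  by (simp_all add: graded_def)

lemma graded_part_Int: "graded T A \<Longrightarrow> v \<in> A \<Longrightarrow> eig_part T c v \<in> A \<inter> gen_eig T c"
  using graded_part eig_part_in by blast

lemma graded_Int: "graded T A \<Longrightarrow> graded T B \<Longrightarrow> graded T (A \<inter> B)"
  by (simp add: graded_def cplx.subspace_inter)

lemma graded_set_sum:
  assumes "graded T A" "graded T B" shows "graded T (set_sum A B)"
  unfolding graded_def
proof (intro conjI allI ballI)
  show "cplx.subspace (set_sum A B)" using assms by (simp add: graded_def csubspace_set_sum)
  fix c v assume "v \<in> set_sum A B"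
  then obtain a b where ab: "v = a + b" "a \<in> A" "b \<in> B" by (rule set_sumE)
  show "eig_part T c v \<in> set_sum A B"
    unfolding ab(1) clin_add[OF clin_eig_part]
    by (rule set_sumI) (use assms ab in \<open>simp_all add: graded_def\<close>)
qed

lemma graded_le:
  assumes "graded T A" "cplx.subspace B" "\<And>c. A \<inter> gen_eig T c \<subseteq> B" shows "A \<subseteq> B"
proof
  fix v assume "v \<in> A"
  then have "\<And>c. eig_part T c v \<in> B" using graded_part_Int[OF assms(1)] assms(3) by blast
  then have "(\<Sum>c\<in>spectrum T. eig_part T c v) \<in> B" by (rule cplx.subspace_sum[OF assms(2)])
  then show "v \<in> B" by (simp add: eig_part_sum)
qed

lemma graded_eqI:
  assumes "graded T A" "graded T B" "\<And>c. A \<inter> gen_eig T c = B \<inter> gen_eig T c" shows "A = B"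
  by (rule equalityI; rule graded_le)
     (use assms graded_subspace in blast)+

lemma set_sum_gen:
  assumes "graded T A" "graded T B"
  shows "set_sum A B \<inter> gen_eig T c = set_sum (A \<inter> gen_eig T c) (B \<inter> gen_eig T c)"
proof
  show "set_sum A B \<inter> gen_eig T c \<subseteq> set_sum (A \<inter> gen_eig T c) (B \<inter> gen_eig T c)"
  proof
    fix v assume v: "v \<in> set_sum A B \<inter> gen_eig T c"
    then obtain a b where ab: "v = a + b" "a \<in> A" "b \<in> B" by (auto elim: set_sumE)
    have "v = eig_part T c v" using v eig_part_on[of v c c] by simp
    also have "\<dots> = eig_part T c a + eig_part T c b" unfolding ab(1) by (rule clin_add[OF clin_eig_part])
    finally show "v \<in> set_sum (A \<inter> gen_eig T c) (B \<inter> gen_eig T c)"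
      using set_sumI[OF graded_part_Int[OF assms(1) ab(2)] graded_part_Int[OF assms(2) ab(3)]] by simp
  qed
  show "set_sum (A \<inter> gen_eig T c) (B \<inter> gen_eig T c) \<subseteq> set_sum A B \<inter> gen_eig T c"
  proof
    fix v assume "v \<in> set_sum (A \<inter> gen_eig T c) (B \<inter> gen_eig T c)"
    then obtain a b where ab: "v = a + b" "a \<in> A \<inter> gen_eig T c" "b \<in> B \<inter> gen_eig T c" by (rule set_sumE)
    show "v \<in> set_sum A B \<inter> gen_eig T c"
      unfolding ab(1) using ab(2,3) set_sumI[of a A b B] cplx.subspace_add[OF subspace_gen] by blast
  qed
qed

lemma direct_part_iff: "v \<in> direct_part T C \<longleftrightarrow> (\<forall>c. c \<notin> C \<longrightarrow> eig_part T c v = 0)"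
  by (simp add: direct_part_def)

lemma graded_direct_part: "graded T (direct_part T C)"
  unfolding graded_def
proof (intro conjI allI ballI)
  show "cplx.subspace (direct_part T C)"
    by (rule cplx.subspaceI)
       (simp_all add: direct_part_iff clin_0[OF clin_eig_part] clin_add[OF clin_eig_part] clin_scale[OF clin_eig_part])
qed (auto simp: direct_part_iff eig_part_twice)

lemma direct_part_gen: "direct_part T C \<inter> gen_eig T c = (if c \<in> C then gen_eig T c else {0})"
proof (cases "c \<in> C")
  case True
  then have "gen_eig T c \<subseteq> direct_part T C"
    unfolding direct_part_def using eig_part_on by (auto split: if_splits)
  then show ?thesis using True by auto
next
  case False
  have "v = 0" if "v \<in> direct_part T C \<inter> gen_eig T c" for v
    using that False eig_part_on[of v c c] by (auto simp: direct_part_iff)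
  then show ?thesis using False zero_in_gen cplx.subspace_0[OF graded_subspace[OF graded_direct_part]] by auto
qed

lemma direct_part_single: "direct_part T {c} = gen_eig T c"
proof
  show "direct_part T {c} \<subseteq> gen_eig T c"
    by (rule graded_le[OF graded_direct_part subspace_gen]) (use zero_in_gen in \<open>auto simp: direct_part_gen split: if_splits\<close>)
  show "gen_eig T c \<subseteq> direct_part T {c}" using direct_part_gen[of "{c}" c] by auto
qed

lemma direct_part_span: "direct_part T C = cplx.span (\<Union>c\<in>C. gen_eig T c)"
proof
  show "direct_part T C \<subseteq> cplx.span (\<Union>c\<in>C. gen_eig T c)"
    by (rule graded_le[OF graded_direct_part cplx.subspace_span])
       (auto simp: direct_part_gen cplx.span_zero intro: cplx.span_base split: if_splits)
  show "cplx.span (\<Union>c\<in>C. gen_eig T c) \<subseteq> direct_part T C"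
  proof (rule cplx.span_minimal[OF _ graded_subspace[OF graded_direct_part]], rule UN_least)
    fix c assume "c \<in> C"
    then show "gen_eig T c \<subseteq> direct_part T C" using direct_part_gen[of C c] by auto
  qed
qed

end

lemma real_points_direct: "cplx.subspace A \<Longrightarrow> subspace (real_points A)"
proof (rule subspaceI)
  assume A: "cplx.subspace A"
  show "0 \<in> real_points A" using cplx.subspace_0[OF A] by (simp add: real_points_def zero_prod_def)
  show "x + y \<in> real_points A" if "x \<in> real_points A" "y \<in> real_points A" for x y
    using that cplx.subspace_add[OF A, of "(x, 0)" "(y, 0)"] by (simp add: real_points_def)
  show "r *\<^sub>R x \<in> real_points A" if "x \<in> real_points A" for r x
    using that cplx.subspace_scale[OF A, of "(x, 0)" "of_real r"] by (simp add: real_points_def cscale_def)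
qed

lemma cset_real_points:
  assumes A: "cplx.subspace A" and cj: "\<And>v. v \<in> A \<Longrightarrow> cj v \<in> A"
  shows "cset (real_points A) = A"
proof
  show "A \<subseteq> cset (real_points A)"
  proof
    fix v assume v: "v \<in> A"
    have "cscale (1/2) (v + cj v) \<in> A" "cscale (- \<i> / 2) (v - cj v) \<in> A"
      by (intro cplx.subspace_scale cplx.subspace_add cplx.subspace_diff A v cj[OF v])+
    moreover have "cscale (1/2) (v + cj v) = (fst v, 0)" "cscale (- \<i> / 2) (v - cj v) = (snd v, 0)"
      by (auto simp: cscale_def cj_def prod_eq_iff simp flip: scaleR_2)
    ultimately show "v \<in> cset (real_points A)" by (simp add: cset_def real_points_def mem_Times_iff)
  qed
  show "cset (real_points A) \<subseteq> A"
  proof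
    fix v assume "v \<in> cset (real_points A)"
    then have "(fst v, 0) \<in> A" "(snd v, 0) \<in> A" by (auto simp: cset_def real_points_def)
    then have "(fst v, 0) + cscale \<i> (snd v, 0) \<in> A" using A by (metis cplx.subspace_add cplx.subspace_scale)
    then show "v \<in> A" by (simp add: cscale_def)
  qed
qed

context automorphism
begin

abbreviation E :: "complex \<Rightarrow> 'a cplx set" where "E c \<equiv> gen_eig (cmap M) c"
abbreviation P :: "complex \<Rightarrow> 'a cplx \<Rightarrow> 'a cplx" where "P c \<equiv> eig_part (cmap M) c"
abbreviation D :: "complex set \<Rightarrow> 'a cplx set" where "D C \<equiv> direct_part (cmap M) C"
abbreviation gr :: "'a cplx set \<Rightarrow> bool" where "gr A \<equiv> graded (cmap M) A"
abbreviation fop :: "complex fps \<Rightarrow> 'a cplx \<Rightarrow> 'a cplx" where "fop f \<equiv> fps_op (cmap N) f"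

lemma P_cj: "P c (cj v) = cj (P (cnj c) v)"
  by (rule eig_part_cj) (rule cmap_M_cj)

lemma E_cj: "v \<in> E c \<Longrightarrow> cj v \<in> E (cnj c)"
  by (rule gen_eig_cj[OF clinT cmap_M_cj])

lemma cj_Int_gen: "cj ` A \<inter> E c = cj ` (A \<inter> E (cnj c))"
proof (rule set_eqI)
  fix v
  have "v \<in> E c \<longleftrightarrow> cj v \<in> E (cnj c)" using E_cj[of v c] E_cj[of "cj v" "cnj c"] by auto
  then show "v \<in> cj ` A \<inter> E c \<longleftrightarrow> v \<in> cj ` (A \<inter> E (cnj c))" by (simp add: cj_in_image)
qed

lemma gr_cj: "gr A \<Longrightarrow> gr (cj ` A)"
  by (auto simp: graded_def subspace_cj P_cj cj_in_image)

lemma gr_cset: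
  assumes "subspace U" "\<And>x. x \<in> U \<Longrightarrow> M x \<in> U" shows "gr (cset U)"
  by (rule gradedI[OF subspace_cset[OF assms(1)]]) (auto simp: cset_def cmap_def assms(2))

lemma gr_stable_ss:
  assumes A: "cplx.subspace A" "\<And>x. x \<in> A \<Longrightarrow> ss_cplx x \<in> A" shows "gr A"
proof -
  interpret s: finite_op ss_cplx by unfold_locales (rule clin_ss, rule finM)
  have "P c v \<in> A" if v: "v \<in> A" for c v
  proof -
    have sub: "E c \<subseteq> gen_eig ss_cplx c" for c
    proof
      fix v assume "v \<in> E c"
      then have "(shift_op ss_cplx c ^^ 1) v = 0" by (simp add: shift_op_def ss_cplx_on)
      then show "v \<in> gen_eig ss_cplx c" unfolding gen_eig_def by blast
    qed
    show ?thesis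
    proof (cases "c \<in> spectrum (cmap M)")
      case True
      show ?thesis
        by (rule stable_component[OF clin_ss A finite_spectrum, of "\<lambda>c. P c v"])
           (use True v subsetD[OF sub eig_part_in] in \<open>simp_all add: eig_part_sum\<close>)
    qed (use eig_part_not_spectrum cplx.subspace_0[OF A(1)] in auto)
  qed
  then show ?thesis using A by (simp add: graded_def)
qed

lemma eigsp_D: "eigsp M c = D {c}"
  by (simp add: eigsp_eq direct_part_single)

lemma eigsp_ne1_D: "eigsp_ne1 M = D (- {1})"
  by (simp add: eigsp_ne1_def eigsp_eq direct_part_span)

lemma D_cj: "(\<And>c. c \<in> C \<Longrightarrow> cnj c \<in> C) \<Longrightarrow> v \<in> D C \<Longrightarrow> cj v \<in> D C"
  by (metis P_cj cj_0 complex_cnj_cnj direct_part_iff)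

lemma cset_D: "(\<And>c. c \<in> C \<Longrightarrow> cnj c \<in> C) \<Longrightarrow> cset (real_points (D C)) = D C"
  by (rule cset_real_points[OF graded_subspace[OF graded_direct_part]]) (rule D_cj)

lemma fop_E: "v \<in> E c \<Longrightarrow> fop f v \<in> E c"
  by (rule fps_N_gen)

lemma clin_fop: "clin (fop f)"
  by (rule clin_fps_op[OF clin_N])

lemma P_N: "P c (cmap N v) = cmap N (P c v)"
  by (rule eig_part_commute[OF clin_N N_gen])

text \<open>
  A functional calculus: a family of power series, one for each eigenvalue, acts by substituting \<open>N\<close>.
  Families multiply as operators compose. The automorphism \<open>M\<close>, the operators \<open>N\<close> and \<open>\<kappa>\<close>, and the
  projections to sums of eigenspaces are of this form, and they all commute.
\<close>

definition blk :: "(complex \<Rightarrow> complex fps) \<Rightarrow> 'a cplx \<Rightarrow> 'a cplx" where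
  "blk g = blockwise (\<lambda>c. fop (g c))"

lemma clin_blk: "clin (blk g)"
  unfolding blk_def by (rule clin_blockwise[OF clin_fop])

lemma blk_on: "v \<in> E c \<Longrightarrow> blk g v = fop (g c) v"
  unfolding blk_def by (rule blockwise_on[OF clin_fop])

lemma blk_E: "v \<in> E c \<Longrightarrow> blk g v \<in> E c"
  by (simp add: blk_on fop_E)

lemma P_blk: "P c (blk g v) = blk g (P c v)"
  by (rule eig_part_commute[OF clin_blk blk_E])

lemma blk_mult: "blk g (blk h v) = blk (\<lambda>c. g c * h c) v"
proof -
  have "(\<lambda>v. blk g (blk h v)) = blk (\<lambda>c. g c * h c)"
    by (rule eq_on_eigen[OF clin_comp[OF clin_blk clin_blk] clin_blk])
       (simp add: blk_on fop_E fps_op_mult[OF nil_N])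
  then show ?thesis by metis
qed

lemma blk_1: "blk (\<lambda>c. 1) v = v"
proof -
  have "blk (\<lambda>c. 1) = (\<lambda>v. v)"
    by (rule eq_on_eigen[OF clin_blk clin_id]) (simp add: blk_on fps_op_1[OF nil_N])
  then show ?thesis by metis
qed

lemma blk_M: "cmap M v = blk (\<lambda>c. fps_const c * fps_exp 1) v"
proof -
  have "cmap M = blk (\<lambda>c. fps_const c * fps_exp 1)"
    by (rule eq_on_eigen[OF clinT clin_blk]) (simp only: blk_on M_on)
  then show ?thesis by metis
qed

lemma blk_N: "cmap N v = blk (\<lambda>c. fps_X) v"
proof -
  have "cmap N = blk (\<lambda>c. fps_X)"
    by (rule eq_on_eigen[OF clin_N clin_blk]) (simp add: blk_on fps_op_X[OF nil_N])
  then show ?thesis by metis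
qed

lemma blk_swap: "blk g (blk h v) = blk h (blk g v)"
  by (simp add: blk_mult mult.commute)

lemma blk_inverse:
  assumes "\<And>c. fps_nth (g c) 0 \<noteq> 0"
  shows "blk g (blk (\<lambda>c. inverse (g c)) v) = v" "blk (\<lambda>c. inverse (g c)) (blk g v) = v"
  using assms by (simp_all add: blk_mult blk_1 inverse_mult_eq_1 inverse_mult_eq_1')

lemma blk_cj:
  assumes "\<And>c k. fps_nth (g (cnj c)) k = cnj (fps_nth (g c) k)"
  shows "blk g (cj v) = cj (blk g v)"
  unfolding blk_def
  by (rule blockwise_cj[OF clin_fop cmap_M_cj]) (rule fps_op_cj[where T = "cmap N", OF cmap_N_cj], rule assms)

definition kappa :: "'a \<Rightarrow> 'a" where "kappa = re_op (blk seifert_fps)"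

lemma linear_kappa: "linear kappa" and cmap_kappa: "cmap kappa = blk seifert_fps"
  unfolding kappa_def
  by (rule linear_re_op cmap_re_op; rule clin_blk blk_cj; rule seifert_fps_cnj)+

lemma bij_cmap: "bij (cmap F) \<Longrightarrow> bij F"
  unfolding bij_def inj_def surj_def cmap_def by (metis fst_conv snd_conv prod.collapse)

lemma bij_kappa: "bij kappa"
proof (rule bij_cmap)
  show "bij (cmap kappa)" unfolding cmap_kappa
    by (rule o_bij[of "blk (\<lambda>c. inverse (seifert_fps c))"])
       (simp_all add: fun_eq_iff blk_inverse seifert_fps_0_nz)
qed

definition pr1 :: "'a \<Rightarrow> 'a" where "pr1 = re_op (P 1)"

lemma linear_pr1: "linear pr1" and cmap_pr1: "cmap pr1 = P 1"
  unfolding pr1_def by (rule linear_re_op cmap_re_op; (rule clin_eig_part | simp add: P_cj))+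

lemma pr1_eq: "P 1 (x, 0) = (pr1 x, 0)"
  unfolding cmap_pr1[symmetric] by (simp add: cmap_def linear_0[OF linear_pr1])

lemma ne1_iff: "x \<in> real_points (eigsp_ne1 M) \<longleftrightarrow> pr1 x = 0"
  by (auto simp: real_points_def eigsp_ne1_D direct_part_iff pr1_eq zero_prod_def)

lemma eq1_iff: "x \<in> real_points (eigsp M 1) \<longleftrightarrow> pr1 x = x"
proof
  assume "x \<in> real_points (eigsp M 1)"
  then show "pr1 x = x" using eig_part_on[of "(x, 0)" 1 1] by (simp add: real_points_def eigsp_eq pr1_eq)
next
  assume "pr1 x = x"
  then have "P 1 (x, 0) = (x, 0)" by (simp add: pr1_eq)
  then show "x \<in> real_points (eigsp M 1)" using eig_part_in[of 1 "(x, 0)"] by (simp add: real_points_def eigsp_eq)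
qed

lemma pr1_pr1: "pr1 (pr1 x) = pr1 x"
  using eig_part_twice[of 1 1 "(x, 0)"] by (simp add: pr1_eq)

lemma proj_1_eq: "proj_1 M x = pr1 x"
  unfolding proj_1_def
proof (rule the_equality)
  show "pr1 x \<in> real_points (eigsp M 1) \<and> x - pr1 x \<in> real_points (eigsp_ne1 M)"
    by (simp add: ne1_iff eq1_iff pr1_pr1 linear_diff[OF linear_pr1])
  show "y = pr1 x" if "y \<in> real_points (eigsp M 1) \<and> x - y \<in> real_points (eigsp_ne1 M)" for y
    using that by (simp add: ne1_iff eq1_iff linear_diff[OF linear_pr1])
qed

lemma kappa_pr1: "kappa (pr1 x) = pr1 (kappa x)"
proof -
  have "(pr1 (kappa x), 0) = P 1 (cmap kappa (x, 0))"
    by (simp add: cmap_def linear_0[OF linear_kappa] pr1_eq)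
  also have "\<dots> = cmap kappa (P 1 (x, 0))" unfolding cmap_kappa by (rule P_blk)
  also have "\<dots> = (kappa (pr1 x), 0)" by (simp add: cmap_def pr1_eq linear_0[OF linear_kappa])
  finally show ?thesis by simp
qed

lemma kappa_ne1:
  assumes "pr1 x = 0" shows "kappa x = M x - x"
proof -
  have "(kappa x, 0) = cmap kappa (x, 0)" by (simp add: cmap_def linear_0[OF linear_kappa])
  also have "\<dots> = (\<Sum>c\<in>spectrum (cmap M). fop (seifert_fps c) (P c (x, 0)))"
    unfolding cmap_kappa blk_def blockwise_def ..
  also have "\<dots> = (\<Sum>c\<in>spectrum (cmap M). cmap M (P c (x, 0)) - P c (x, 0))"
  proof (rule sum.cong[OF refl])
    fix c
    show "fop (seifert_fps c) (P c (x, 0)) = cmap M (P c (x, 0)) - P c (x, 0)"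
    proof (cases "c = 1")
      case True
      then have "P c (x, 0) = 0" using assms by (simp add: pr1_eq zero_prod_def)
      then show ?thesis by (simp add: clin_0[OF clin_fop] clin_0[OF clinT])
    next
      case False
      then show ?thesis by (simp add: seifert_fps_def fps_op_diff fps_op_1[OF nil_N] M_on[OF eig_part_in])
    qed
  qed
  also have "\<dots> = cmap M (x, 0) - (x, 0)"
    by (simp add: sum_subtractf eig_part_sum flip: clin_sum[OF clinT])
  finally show ?thesis by (simp add: cmap_def)
qed

lemma cmap_unit_series: "cmap (nil_series (\<lambda>k. 1 / fact (k + 1)) N) = fop (fps_shift 1 (fps_exp 1))"
  unfolding cmap_nil_series fps_op_def
  by (rule arg_cong[where f = "\<lambda>c. cnil_series c _"]) (simp add: fun_eq_iff del: fact_Suc)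

lemma kappa_1: "kappa (pr1 x) = - nil_series (\<lambda>k. 1 / fact (k + 1)) N (pr1 x)"
proof -
  let ?T = "nil_series (\<lambda>k. 1 / fact (k + 1)) N"
  note T = cmap_unit_series
  have "(kappa (pr1 x), kappa 0) = cmap kappa (pr1 x, 0)" by (simp add: cmap_def)
  also have "\<dots> = fop (seifert_fps 1) (pr1 x, 0)"
    unfolding cmap_kappa by (rule blk_on) (use eig_part_in[of 1 "(x, 0)"] in \<open>simp add: pr1_eq\<close>)
  also have "\<dots> = - cmap ?T (pr1 x, 0)" unfolding T by (simp add: seifert_fps_def fps_op_minus)
  finally show ?thesis by (simp add: cmap_def)
qed

lemma bij_unit_series: "bij (nil_series (\<lambda>k. 1 / fact (k + 1)) N)"
proof (rule bij_cmap)
  show "bij (cmap (nil_series (\<lambda>k. 1 / fact (k + 1)) N))"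
    unfolding cmap_unit_series by (rule fps_op_bij[OF nil_N]) simp
qed

text \<open>
  Both \<open>\<nu>\<close> and the inverse of \<open>\<kappa>\<close> respect the splitting into \<open>H\<^sub>1\<close> and \<open>H\<^sub>\<noteq>\<^sub>1\<close>, where \<open>\<kappa>\<close> is \<open>- (M - 1)/N\<close> and
  \<open>M - 1\<close>, respectively.
\<close>

lemma nu_eq: "nu N M = inv kappa"
proof
  fix x
  obtain y where y: "x = kappa y" using bij_kappa by (meson bij_pointE)
  let ?T = "nil_series (\<lambda>k. 1 / fact (k + 1)) N"
  have linT: "linear ?T" by (rule linear_nil_series[OF linear_N])
  have inj: "inj_on (\<lambda>y. M y - y) (real_points (eigsp_ne1 M))"
  proof (rule inj_onI)
    fix a b assume "a \<in> real_points (eigsp_ne1 M)" "b \<in> real_points (eigsp_ne1 M)" "M a - a = M b - b"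
    then have "kappa a = kappa b" by (simp add: ne1_iff kappa_ne1)
    then show "a = b" using bij_kappa by (simp add: bij_def inj_eq)
  qed
  have y0: "y - pr1 y \<in> real_points (eigsp_ne1 M)"
    by (simp add: ne1_iff linear_diff[OF linear_pr1] pr1_pr1)
  have "x - pr1 x = kappa (y - pr1 y)" by (simp add: y linear_diff[OF linear_kappa] kappa_pr1)
  also have "\<dots> = M (y - pr1 y) - (y - pr1 y)" using y0 by (intro kappa_ne1) (simp add: ne1_iff)
  finally have 1: "inv_into (real_points (eigsp_ne1 M)) (\<lambda>y. M y - y) (x - pr1 x) = y - pr1 y"
    using inv_into_f_f[OF inj y0] by simp
  have "pr1 x = ?T (- pr1 y)" unfolding y kappa_pr1[symmetric] kappa_1 linear_neg[OF linT] ..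
  then have 2: "inv ?T (pr1 x) = - pr1 y" using bij_unit_series by (simp add: bij_is_inj)
  show "nu N M x = inv kappa x"
    unfolding nu_def proj_1_eq 1 2 using bij_kappa y by (simp add: bij_is_inj)
qed

lemma inv_nu: "inv (nu N M) = kappa"
  by (simp add: nu_eq inv_inv_eq bij_kappa)

lemma seifert_eq: "seifert_normalized M S a b = - S a (kappa b)"
  by (simp add: seifert_normalized_def inv_nu)

end

section \<open>The automorphism \<open>- M\<close>\<close>

context automorphism
begin

lemma automorphism_tilde: "automorphism (tilde_M M)"
proof (rule automorphism.intro)
  show "linear (tilde_M M)" unfolding tilde_M_def[abs_def] using linM by (rule linear_compose_neg)
  have "bij (uminus \<circ> M)" by (rule bij_comp[OF bijM]) (simp add: bij_uminus)
  then show "bij (tilde_M M)" by (simp add: tilde_M_def[abs_def] o_def)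
qed (rule finM)

lemma jordan_tilde: "jordan_decomposition (tilde_M M) (\<lambda>x. - semisimple_part M x) (unipotent_part M)"
proof -
  let ?s = "semisimple_part M" and ?u = "unipotent_part M"
  have j: "linear ?s" "linear ?u" "semisimple ?s" "unipotent ?u" "M = ?s \<circ> ?u" "M = ?u \<circ> ?s"
    using jordan_parts by (auto simp: jordan_decomposition_def)
  have "{v. \<exists>c. cmap ?s v = cscale c v} \<subseteq> {v. \<exists>c. cmap (\<lambda>x. - ?s x) v = cscale c v}"
  proof clarify
    fix a b c assume "cmap ?s (a, b) = cscale c (a, b)"
    then have "cmap (\<lambda>x. - ?s x) (a, b) = cscale (- c) (a, b)" by (auto simp: cmap_def cscale_def prod_eq_iff)
    then show "\<exists>c. cmap (\<lambda>x. - ?s x) (a, b) = cscale c (a, b)" by blast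
  qed
  then have "semisimple (\<lambda>x. - ?s x)" using j(3) cplx.span_mono unfolding semisimple_def by blast
  moreover have "tilde_M M = (\<lambda>x. - ?s x) \<circ> ?u" using fun_cong[OF j(5)] by (auto simp: tilde_M_def fun_eq_iff)
  moreover have "tilde_M M = ?u \<circ> (\<lambda>x. - ?s x)"
    using fun_cong[OF j(6)] by (auto simp: tilde_M_def fun_eq_iff linear_neg[OF j(2)])
  ultimately show ?thesis using j linear_compose_neg[OF j(1)] by (simp add: jordan_decomposition_def)
qed

lemma semisimple_part_tilde: "semisimple_part (tilde_M M) = (\<lambda>x. - semisimple_part M x)"
  and unipotent_part_tilde: "unipotent_part (tilde_M M) = unipotent_part M"
proof -
  interpret t: automorphism "tilde_M M" by (rule automorphism_tilde)
  show "semisimple_part (tilde_M M) = (\<lambda>x. - semisimple_part M x)"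
    using t.jordan_unique(1)[OF jordan_tilde] by (simp add: t.semisimple_part_eq)
  show "unipotent_part (tilde_M M) = unipotent_part M"
    using t.jordan_unique(2)[OF jordan_tilde] by (simp add: t.unipotent_part_eq)
qed

lemma N_tilde: "log_unipotent (tilde_M M) = N"
  by (simp add: log_unipotent_def unipotent_part_tilde)

lemma gen_eig_tilde: "gen_eig (cmap (tilde_M M)) c = E (- c)"
proof -
  have e: "shift_op (cmap (tilde_M M)) c v = - shift_op (cmap M) (- c) v" for v
    by (simp add: shift_op_def tilde_M_def cmap_def prod_eq_iff)
  have "(shift_op (cmap (tilde_M M)) c ^^ n) v = cscale ((-1) ^ n) ((shift_op (cmap M) (- c) ^^ n) v)" for n v
    by (induction n) (auto simp: e clin_scale[OF clin_shift[OF clinT]])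
  then show ?thesis by (simp add: gen_eig_def)
qed

lemma eigsp_tilde: "eigsp (tilde_M M) c = eigsp M (- c)"
proof -
  interpret t: automorphism "tilde_M M" by (rule automorphism_tilde)
  show ?thesis by (simp add: t.eigsp_eq eigsp_eq gen_eig_tilde)
qed

lemma spectrum_tilde: "spectrum (cmap (tilde_M M)) = uminus ` spectrum (cmap M)"
proof (rule set_eqI)
  fix c
  have "c \<in> uminus ` S \<longleftrightarrow> - c \<in> S" for S :: "complex set"
    using image_iff minus_minus by fastforce
  then show "c \<in> spectrum (cmap (tilde_M M)) \<longleftrightarrow> c \<in> uminus ` spectrum (cmap M)"
    by (simp add: spectrum_def gen_eig_tilde)
qed

lemma eig_part_tilde: "eig_part (cmap (tilde_M M)) c = P (- c)"
proof
  fix v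
  interpret t: automorphism "tilde_M M" by (rule automorphism_tilde)
  show "eig_part (cmap (tilde_M M)) c v = P (- c) v"
  proof (rule t.eig_part_eqI)
    show "P (- c) v \<in> gen_eig (cmap (tilde_M M)) c" for c unfolding gen_eig_tilde by (rule eig_part_in)
    show "v = (\<Sum>c\<in>spectrum (cmap (tilde_M M)). P (- c) v)"
      unfolding spectrum_tilde by (subst sum.reindex) (auto simp: eig_part_sum)
  qed
qed

lemma graded_tilde: "graded (cmap (tilde_M M)) A = gr A"
  unfolding graded_def eig_part_tilde by (metis minus_minus)

lemma direct_part_tilde: "direct_part (cmap (tilde_M M)) C = D (uminus ` C)"
proof -
  have "c \<in> uminus ` C \<longleftrightarrow> - c \<in> C" for c
    using image_iff minus_minus by fastforce
  then have "(\<forall>c. c \<notin> C \<longrightarrow> P (- c) v = 0) \<longleftrightarrow> (\<forall>c. c \<notin> uminus ` C \<longrightarrow> P c v = 0)" for v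
    by (metis minus_minus)
  then show ?thesis unfolding direct_part_def eig_part_tilde by blast
qed

end

section \<open>Complex bilinear extension of a form\<close>

context
  fixes S :: "'a::real_vector \<Rightarrow> 'a \<Rightarrow> real"
  assumes S: "bilinear S"
begin

lemma cform_add_left: "cform S (a + a') b = cform S a b + cform S a' b"
  and cform_add_right: "cform S a (b + b') = cform S a b + cform S a b'"
  and cform_scale_left: "cform S (cscale z a) b = z * cform S a b"
  and cform_scale_right: "cform S a (cscale z b) = z * cform S a b"
  by (simp_all add: cform_def cscale_def complex_eq_iff algebra_simps bilinear_ladd[OF S]
      bilinear_radd[OF S] bilinear_lsub[OF S] bilinear_rsub[OF S] bilinear_lmul[OF S] bilinear_rmul[OF S])

lemma cform_0_left: "cform S 0 b = 0" and cform_0_right: "cform S a 0 = 0"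
  using cform_add_left[of 0 0 b] cform_add_right[of a 0 0] by simp_all

lemma cform_sum_left: "cform S (\<Sum>i\<in>I. f i) b = (\<Sum>i\<in>I. cform S (f i) b)"
  and cform_sum_right: "cform S a (\<Sum>i\<in>I. g i) = (\<Sum>i\<in>I. cform S a (g i))"
  by (induction I rule: infinite_finite_induct)
     (auto simp: cform_0_left cform_0_right cform_add_left cform_add_right)

lemma cform_real: "cform S (x, 0) (y, 0) = of_real (S x y)"
  by (simp add: cform_def bilinear_lzero[OF S] bilinear_rzero[OF S] complex_eq_iff)

text \<open>
  Each \<open>T\<close> that moves to the other argument changes the sign.
\<close>

lemma cform_fps_op:
  assumes "\<And>a b. cform S (T a) b = - cform S a (T b)"
  shows "cform S (fps_op T f a) b = cform S a (fps_op T (f oo - fps_X) b)"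
proof -
  have p: "cform S ((T ^^ k) a) b = (-1) ^ k * cform S a ((T ^^ k) b)" for k
  proof (induction k arbitrary: b)
    case (Suc k)
    have "cform S ((T ^^ Suc k) a) b = - cform S ((T ^^ k) a) (T b)" using assms by simp
    also have "\<dots> = (-1) ^ Suc k * cform S a ((T ^^ k) (T b))" using Suc[of "T b"] by simp
    finally show ?case by (simp add: funpow_swap1)
  qed simp
  show ?thesis
    by (simp add: fps_op_def cnil_series_def cform_sum_left cform_sum_right cform_scale_left
        cform_scale_right p fps_compose_uminus' mult_ac)
qed

lemma cform_cset_0:
  assumes "\<And>x y. x \<in> U \<Longrightarrow> y \<in> V \<Longrightarrow> S x y = 0" "a \<in> cset U" "b \<in> cset V" shows "cform S a b = 0"
  using assms by (auto simp: cform_def cset_def complex_eq_iff)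

end

lemma int_jump:
  fixes a b :: int
  assumes "\<not> Q a" "Q b" "\<And>j k. j \<le> k \<Longrightarrow> Q j \<Longrightarrow> Q k"
  shows "\<exists>k. Q k \<and> \<not> Q (k - 1)"
proof -
  have ab: "a < b" using assms by (meson not_le)
  have "\<exists>n. Q (a + int n)" using assms(2) ab by (intro exI[of _ "nat (b - a)"]) simp
  then have 1: "Q (a + int (LEAST n. Q (a + int n)))" by (rule LeastI_ex)
  let ?n = "LEAST n. Q (a + int n)"
  have "?n \<noteq> 0" using 1 assms(1) by (metis add_0_right of_nat_0)
  then have "\<not> Q (a + int (?n - 1))" by (intro not_less_Least) simp
  moreover have "a + int (?n - 1) = a + int ?n - 1" using \<open>?n \<noteq> 0\<close> by simp
  ultimately show ?thesis using 1 by metis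
qed

section \<open>Forms and the eigenspaces\<close>

lemma (in finite_op) biadditive_sum:
  fixes h :: "'a cplx \<Rightarrow> 'a cplx \<Rightarrow> complex"
  assumes l: "\<And>x x' y. h (x + x') y = h x y + h x' y" and r: "\<And>x y y'. h x (y + y') = h x y + h x y'"
  shows "h x y = (\<Sum>c\<in>spectrum T. \<Sum>d\<in>spectrum T. h (eig_part T c x) (eig_part T d y))"
proof -
  have l0: "h 0 y = 0" for y using l[of 0 0 y] by simp
  have r0: "h x 0 = 0" for x using r[of x 0 0] by simp
  have sl: "h (\<Sum>i\<in>I. u i) y = (\<Sum>i\<in>I. h (u i) y)" for I :: "complex set" and u y
    by (induction I rule: infinite_finite_induct) (auto simp: l0 l)
  have sr: "h x (\<Sum>i\<in>I. u i) = (\<Sum>i\<in>I. h x (u i))" for I :: "complex set" and u x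
    by (induction I rule: infinite_finite_induct) (auto simp: r0 r)
  have "h x y = h (\<Sum>c\<in>spectrum T. eig_part T c x) (\<Sum>c\<in>spectrum T. eig_part T c y)"
    by (simp only: eig_part_sum)
  then show ?thesis unfolding sl unfolding sr .
qed

lemma (in finite_op) biadditive_eqI:
  fixes f g :: "'a cplx \<Rightarrow> 'a cplx \<Rightarrow> complex"
  assumes "\<And>x x' y. f (x + x') y = f x y + f x' y" "\<And>x y y'. f x (y + y') = f x y + f x y'"
    and "\<And>x x' y. g (x + x') y = g x y + g x' y" "\<And>x y y'. g x (y + y') = g x y + g x y'"
    and "\<And>c d x y. x \<in> gen_eig T c \<Longrightarrow> y \<in> gen_eig T d \<Longrightarrow> f x y = g x y"
  shows "f x y = g x y"
proof -
  have "f x y = (\<Sum>c\<in>spectrum T. \<Sum>d\<in>spectrum T. f (eig_part T c x) (eig_part T d y))"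
    by (rule biadditive_sum) (rule assms(1), rule assms(2))
  also have "\<dots> = (\<Sum>c\<in>spectrum T. \<Sum>d\<in>spectrum T. g (eig_part T c x) (eig_part T d y))"
    by (intro sum.cong refl assms(5)[OF eig_part_in eig_part_in])
  also have "\<dots> = g x y" by (rule biadditive_sum[symmetric]) (rule assms(3), rule assms(4))
  finally show ?thesis .
qed

text \<open>
  By invariance \<open>S(a, b) = S(M a, M b)\<close>, which is \<open>c d S(a, b)\<close> plus terms where \<open>(M - c) a\<close> replaces \<open>a\<close> or
  \<open>(M - d) b\<close> replaces \<open>b\<close>. These terms vanish by induction on the orders of nilpotency.
\<close>

lemma (in automorphism) invariant_orth:
  assumes S: "bilinear S" and inv: "\<And>a b. S (M a) (M b) = S a b"
    and a: "a \<in> E c" and b: "b \<in> E d" and cd: "c * d \<noteq> 1"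
  shows "cform S a b = 0"
proof -
  have inv': "cform S (cmap M a) (cmap M b) = cform S a b" for a b
    by (simp add: cform_def cmap_def inv)
  obtain n k where n: "(shift_op (cmap M) c ^^ n) a = 0" and k: "(shift_op (cmap M) d ^^ k) b = 0"
    using a b unfolding gen_eig_def by blast
  have "n + k \<le> s \<Longrightarrow> (shift_op (cmap M) c ^^ n) a = 0 \<Longrightarrow> (shift_op (cmap M) d ^^ k) b = 0 \<Longrightarrow> cform S a b = 0" for s
  proof (induction s arbitrary: n k a b)
    case 0 then show ?case by (simp add: cform_0_left[OF S])
  next
    case (Suc s)
    show ?case
    proof (cases "n = 0 \<or> k = 0")
      case True then show ?thesis using Suc.prems by (auto simp: cform_0_left[OF S] cform_0_right[OF S])
    next
      case False
      then obtain n' k' where nk: "n = Suc n'" "k = Suc k'" by (metis not0_implies_Suc)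
      let ?a = "shift_op (cmap M) c a" and ?b = "shift_op (cmap M) d b"
      have a': "(shift_op (cmap M) c ^^ n') ?a = 0" and b': "(shift_op (cmap M) d ^^ k') ?b = 0"
        using Suc.prems nk by (simp_all add: funpow_swap1)
      have z: "cform S ?a b = 0" "cform S a ?b = 0" "cform S ?a ?b = 0"
        using Suc.IH[of n' k ?a b] Suc.IH[of n k' a ?b] Suc.IH[of n' k' ?a ?b] a' b' Suc.prems nk by auto
      have "cmap M a = cscale c a + ?a" "cmap M b = cscale d b + ?b" by (simp_all add: shift_op_def)
      then have "cform S a b = cform S (cscale c a + ?a) (cscale d b + ?b)" using inv' by metis
      also have "\<dots> = c * d * cform S a b"
        by (simp add: cform_add_left[OF S] cform_add_right[OF S] cform_scale_left[OF S] cform_scale_right[OF S] z)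
      finally show ?thesis using cd by (metis mult_cancel_right1)
    qed
  qed
  then show ?thesis using n k by blast
qed

lemma (in automorphism) set_sum_D:
  assumes "gr A" "gr B" shows "set_sum (A \<inter> D C) (B \<inter> D C) = set_sum A B \<inter> D C"
proof (rule graded_eqI)
  note g = graded_direct_part[of C]
  show "gr (set_sum (A \<inter> D C) (B \<inter> D C))" "gr (set_sum A B \<inter> D C)"
    by (intro graded_set_sum graded_Int assms g)+
  fix c
  have "set_sum (A \<inter> D C) (B \<inter> D C) \<inter> E c = set_sum (A \<inter> (D C \<inter> E c)) (B \<inter> (D C \<inter> E c))"
    by (simp add: set_sum_gen graded_Int assms g Int_assoc)
  also have "\<dots> = set_sum A B \<inter> (D C \<inter> E c)"
  proof (cases "c \<in> C")
    case True then show ?thesis by (simp add: direct_part_gen set_sum_gen assms)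
  next
    case False
    have "0 \<in> A" "0 \<in> B" "0 \<in> set_sum A B"
      using assms graded_set_sum graded_subspace cplx.subspace_0 by blast+
    then show ?thesis using False by (auto simp: direct_part_gen set_sum_def zero_prod_def)
  qed
  finally show "set_sum (A \<inter> D C) (B \<inter> D C) \<inter> E c = set_sum A B \<inter> D C \<inter> E c" by (simp add: Int_assoc)
qed

section \<open>Filtrations compatible with the eigenspaces\<close>

context automorphism
begin

lemma graded_eqI':
  assumes "gr A" "gr B" "\<And>c. c \<in> spectrum (cmap M) \<Longrightarrow> A \<inter> E c = B \<inter> E c" shows "A = B"
proof (rule graded_eqI[OF assms(1,2)])
  fix c
  have "0 \<in> A" "0 \<in> B" using assms(1,2) graded_subspace cplx.subspace_0 by blast+
  then show "A \<inter> E c = B \<inter> E c"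
    using assms(3) not_spectrum[of c] by (cases "c \<in> spectrum (cmap M)") auto
qed

lemma graded_blk:
  assumes A: "gr A" and N: "\<And>v. v \<in> A \<Longrightarrow> cmap N v \<in> A" and v: "v \<in> A" shows "blk g v \<in> A"
  unfolding blk_def blockwise_def
  by (intro cplx.subspace_sum graded_subspace[OF A] fps_op_stable[OF graded_subspace[OF A] N] graded_part[OF A v])

definition block_proj :: "complex set \<Rightarrow> 'a cplx \<Rightarrow> 'a cplx" where
  "block_proj C = blk (\<lambda>c. if c \<in> C then 1 else 0)"

lemma P_block_proj: "P c (block_proj C v) = (if c \<in> C then P c v else 0)"
  unfolding block_proj_def P_blk blk_on[OF eig_part_in]
  by (simp add: fps_op_1[OF nil_N] fps_op_const[OF nil_N, of 0, simplified])

lemma P_ext: "(\<And>c. P c v = P c w) \<Longrightarrow> v = w"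
  by (metis (no_types, lifting) eig_part_sum sum.cong)

lemma block_proj_in: "block_proj C v \<in> D C"
  by (simp add: direct_part_iff P_block_proj)

lemma block_proj_id: "v \<in> D C \<Longrightarrow> block_proj C v = v"
  by (rule P_ext) (auto simp: P_block_proj direct_part_iff)

lemma clin_block_proj: "clin (block_proj C)"
  unfolding block_proj_def by (rule clin_blk)

lemma block_proj_N: "block_proj C (cmap N v) = cmap N (block_proj C v)"
  unfolding block_proj_def blk_N by (rule blk_swap)

lemma block_proj_graded: "gr A \<Longrightarrow> v \<in> A \<Longrightarrow> block_proj C v \<in> A"
proof -
  assume A: "gr A" and v: "v \<in> A"
  have "(\<Sum>c\<in>spectrum (cmap M). P c (block_proj C v)) \<in> A"
    by (intro cplx.subspace_sum graded_subspace[OF A])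
       (use graded_part[OF A v] cplx.subspace_0[OF graded_subspace[OF A]] in \<open>simp add: P_block_proj\<close>)
  then show ?thesis by (simp add: eig_part_sum)
qed

definition real_block_proj :: "complex set \<Rightarrow> 'a \<Rightarrow> 'a" where "real_block_proj C = re_op (block_proj C)"

context
  fixes C :: "complex set" assumes C: "\<And>c. c \<in> C \<Longrightarrow> cnj c \<in> C"
begin

lemma C_cnj: "cnj c \<in> C \<longleftrightarrow> c \<in> C"
  using C by (metis complex_cnj_cnj)

lemma block_proj_cj: "block_proj C (cj v) = cj (block_proj C v)"
  unfolding block_proj_def by (rule blk_cj) (simp add: C_cnj)

lemma linear_real_block_proj: "linear (real_block_proj C)" and cmap_real_block_proj: "cmap (real_block_proj C) = block_proj C"
  unfolding real_block_proj_def by (rule linear_re_op[OF clin_block_proj block_proj_cj], rule cmap_re_op[OF clin_block_proj block_proj_cj])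

lemma block_proj_real: "block_proj C (x, 0) = (real_block_proj C x, 0)"
  unfolding cmap_real_block_proj[symmetric] by (simp add: cmap_def linear_0[OF linear_real_block_proj])

lemma real_block_proj_in: "real_block_proj C x \<in> real_points (D C)"
  using block_proj_in[of C "(x, 0)"] by (simp add: real_points_def block_proj_real)

lemma real_block_proj_id: "x \<in> real_points (D C) \<Longrightarrow> real_block_proj C x = x"
  using block_proj_id[of "(x, 0)" C] by (simp add: real_points_def block_proj_real)

lemma real_block_proj_N: "real_block_proj C (N x) = N (real_block_proj C x)"
  using block_proj_N[of C "(x, 0)"] by (simp add: cmap_def linear_0[OF linear_N] block_proj_real)

lemma real_block_proj_W: "gr (cset U) \<Longrightarrow> x \<in> U \<Longrightarrow> 0 \<in> U \<Longrightarrow> real_block_proj C x \<in> U"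
  using block_proj_graded[of "cset U" "(x, 0)" C] by (simp add: cset_def block_proj_real)

lemma cset_D': "cset (real_points (D C)) = D C"
  by (rule cset_D[OF C])

lemma D_cj': "v \<in> D C \<Longrightarrow> cj v \<in> D C"
  by (rule D_cj) (rule C)

lemma F_Gr_D:
  assumes F: "\<And>p. gr (F p)" and W: "\<And>k. gr (cset (W k))"
  shows "F_Gr (\<lambda>p. F p \<inter> D C) (\<lambda>k. W k \<inter> real_points (D C)) k p = F_Gr F W k p \<inter> D C"
proof -
  have "F p \<inter> D C \<inter> cset (W k \<inter> real_points (D C)) = F p \<inter> cset (W k) \<inter> D C"
    by (auto simp: cset_Int cset_D')
  then show ?thesis unfolding F_Gr_def cset_Int cset_D'
    using set_sum_D[OF graded_Int[OF F W] W, of p k C "k - 1"] by (simp add: Int_ac)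
qed

lemma gr_F_Gr': 
  assumes F: "\<And>p. gr (F p)" and W: "\<And>k. gr (cset (W k))" shows "gr (F_Gr F W k p)"
  unfolding F_Gr_def by (intro graded_set_sum graded_Int F W)

text \<open>
  Sums, intersections and conjugation of graded subspaces commute with intersecting with a sum of
  eigenspaces that is stable under conjugation.
\<close>

lemma mhs_restrict:
  assumes F: "\<And>p. gr (F p)" and W: "\<And>k. gr (cset (W k))" and m: "mhs UNIV F W"
  shows "mhs (real_points (D C)) (\<lambda>p. F p \<inter> D C) (\<lambda>k. W k \<inter> real_points (D C))"
proof -
  have Ff: "decreasing_filtration UNIV F" and Wf: "increasing_filtration UNIV W"
    and h: "\<And>k. pure_hodge_quotient k (cset (W k)) (cset (W (k - 1))) (F_Gr F W k)"
    using m by (simp_all add: mhs_def)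
  have Fm: "\<And>p q. p \<le> q \<Longrightarrow> F q \<subseteq> F p" and Fs: "\<And>p. cplx.subspace (F p)"
    using Ff by (simp_all add: decreasing_filtration_def)
  have Wm: "\<And>j k. j \<le> k \<Longrightarrow> W j \<subseteq> W k" and Ws: "\<And>k. subspace (W k)"
    using Wf by (simp_all add: increasing_filtration_def)
  note sD = graded_subspace[OF graded_direct_part, of C]
  have sV: "subspace (real_points (D C))" by (rule real_points_direct[OF sD])
  have 1: "decreasing_filtration (real_points (D C)) (\<lambda>p. F p \<inter> D C)"
    unfolding decreasing_filtration_def cset_D'
  proof (intro conjI allI impI)
    show "\<exists>p. F p \<inter> D C = {0}"
    proof -
      obtain p where "F p = {0}" using Ff by (auto simp: decreasing_filtration_def)
      then show ?thesis using cplx.subspace_0[OF sD] by (intro exI[of _ p]) simp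
    qed
    show "\<exists>p. F p \<inter> D C = D C"
    proof -
      obtain p where "F p = UNIV" using Ff by (auto simp: decreasing_filtration_def cset_def)
      then show ?thesis by (intro exI[of _ p]) simp
    qed
    show "F q \<inter> D C \<subseteq> F p \<inter> D C" if "p \<le> q" for p q
      using Fm[OF that] by blast
    show "cplx.subspace (F p \<inter> D C)" for p by (rule cplx.subspace_inter[OF Fs sD])
  qed simp
  have 2: "increasing_filtration (real_points (D C)) (\<lambda>k. W k \<inter> real_points (D C))"
    unfolding increasing_filtration_def
  proof (intro conjI allI impI)
    show "\<exists>k. W k \<inter> real_points (D C) = {0}"
    proof -
      obtain k where "W k = {0}" using Wf by (auto simp: increasing_filtration_def)
      then show ?thesis using subspace_0[OF sV] by (intro exI[of _ k]) simp
    qed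
    show "\<exists>k. W k \<inter> real_points (D C) = real_points (D C)"
    proof -
      obtain k where "W k = UNIV" using Wf by (auto simp: increasing_filtration_def)
      then show ?thesis by (intro exI[of _ k]) simp
    qed
    show "W j \<inter> real_points (D C) \<subseteq> W k \<inter> real_points (D C)" if "j \<le> k" for j k
      using Wm[OF that] by blast
    show "subspace (W k \<inter> real_points (D C))" for k by (rule subspace_inter[OF Ws sV])
  qed simp
  have 3: "pure_hodge_quotient k (cset (W k \<inter> real_points (D C))) (cset (W (k - 1) \<inter> real_points (D C)))
     (F_Gr (\<lambda>p. F p \<inter> D C) (\<lambda>k. W k \<inter> real_points (D C)) k)" for k
    unfolding pure_hodge_quotient_def F_Gr_D[where F = F and W = W, OF F W] cset_Int cset_D'
  proof
    fix p
    let ?A = "F_Gr F W k p" and ?B = "cj ` F_Gr F W k (k + 1 - p)"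
    have g: "gr ?A" "gr ?B" by (rule gr_F_Gr'[OF F W], rule gr_cj[OF gr_F_Gr'[OF F W]])
    have DC: "cj v \<in> D C \<longleftrightarrow> v \<in> D C" for v using D_cj'[of v] D_cj'[of "cj v"] by auto
    have c: "cj ` (F_Gr F W k (k + 1 - p) \<inter> D C) = ?B \<inter> D C"
      by (rule set_eqI) (simp add: cj_in_image DC)
    have hp: "set_sum ?A ?B = cset (W k)" "?A \<inter> ?B = cset (W (k - 1))"
      using h[of k] by (simp_all add: pure_hodge_quotient_def)
    show "set_sum (?A \<inter> D C) (cj ` (F_Gr F W k (k + 1 - p) \<inter> D C)) = cset (W k) \<inter> D C \<and>
          (?A \<inter> D C) \<inter> cj ` (F_Gr F W k (k + 1 - p) \<inter> D C) = cset (W (k - 1)) \<inter> D C"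
      unfolding c set_sum_D[OF g] hp(1) using hp(2) by blast
  qed
  show ?thesis unfolding mhs_def using sV 1 2 3 by blast
qed

end

text \<open>
  For \<open>tilde_F\<close>, which is a span of pieces over all unit complex numbers: the span is graded and has no other
  components than the given pieces.
\<close>

lemma span_pieces:
  assumes A: "\<And>c. c \<in> U \<Longrightarrow> cplx.subspace (A c)" "\<And>c. c \<in> U \<Longrightarrow> A c \<subseteq> E c" and U: "spectrum (cmap M) \<subseteq> U"
  shows "cplx.span (\<Union>c\<in>U. A c) = {v. \<forall>c\<in>spectrum (cmap M). P c v \<in> A c}" (is "?Z = ?R")
proof
  have sR: "cplx.subspace ?R"
  proof (rule cplx.subspaceI)
    have "0 \<in> A c" if "c \<in> spectrum (cmap M)" for c
      using cplx.subspace_0[OF A(1)] U that by blast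
    then show "0 \<in> ?R" by (simp add: clin_0[OF clin_eig_part])
    show "x + y \<in> ?R" if "x \<in> ?R" "y \<in> ?R" for x y
      using that A(1) U cplx.subspace_add by (simp add: clin_add[OF clin_eig_part]) blast
    show "cscale z x \<in> ?R" if "x \<in> ?R" for x z
      using that A(1) U cplx.subspace_scale by (simp add: clin_scale[OF clin_eig_part]) blast
  qed
  show "?Z \<subseteq> ?R"
  proof (rule cplx.span_minimal[OF _ sR], rule UN_least, rule subsetI)
    fix c v assume c: "c \<in> U" and v: "v \<in> A c"
    then have "v \<in> E c" using A by blast
    then have "P d v = (if d = c then v else 0)" for d by (rule eig_part_on)
    then show "v \<in> ?R" using v A(1) U cplx.subspace_0 by auto
  qed
  show "?R \<subseteq> ?Z"
  proof
    fix v assume "v \<in> ?R"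
    then have "P c v \<in> ?Z" if "c \<in> spectrum (cmap M)" for c
      using that U by (intro cplx.span_base) blast
    then have "(\<Sum>c\<in>spectrum (cmap M). P c v) \<in> ?Z" by (rule cplx.span_sum)
    then show "v \<in> ?Z" by (simp add: eig_part_sum)
  qed
qed

lemma span_pieces_gen:
  assumes A: "\<And>c. c \<in> U \<Longrightarrow> cplx.subspace (A c)" "\<And>c. c \<in> U \<Longrightarrow> A c \<subseteq> E c" and U: "spectrum (cmap M) \<subseteq> U"
  shows "gr (cplx.span (\<Union>c\<in>U. A c))" "c \<in> U \<Longrightarrow> cplx.span (\<Union>c\<in>U. A c) \<inter> E c = A c"
proof -
  let ?Z = "cplx.span (\<Union>c\<in>U. A c)"
  have Z: "?Z = {v. \<forall>c\<in>spectrum (cmap M). P c v \<in> A c}" by (rule span_pieces[OF A U])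
  have A0: "c \<in> U \<Longrightarrow> 0 \<in> A c" for c using A(1) by (rule cplx.subspace_0)
  have "P d v \<in> ?Z" if "v \<in> ?Z" for d v
    using that A0 U unfolding Z by (auto simp: eig_part_twice)
  then show "gr ?Z" by (simp add: graded_def)
  show "?Z \<inter> E c = A c" if c: "c \<in> U"
  proof
    show "A c \<subseteq> ?Z \<inter> E c" using A(2)[OF c] c by (auto intro: cplx.span_base)
    show "?Z \<inter> E c \<subseteq> A c"
    proof
      fix v assume v: "v \<in> ?Z \<inter> E c"
      show "v \<in> A c"
      proof (cases "c \<in> spectrum (cmap M)")
        case True
        then have "P c v \<in> A c" using v unfolding Z by blast
        then show ?thesis using v eig_part_on[of v c c] by simp
      next
        case False
        then show ?thesis using v not_spectrum A0[OF c] by auto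
      qed
    qed
  qed
qed

text \<open>
  Modulo \<open>B'\<close> the operator \<open>N\<close> vanishes on \<open>B\<close>, so a unit power series acts as a nonzero scalar and does not
  move the image of \<open>A \<inter> B\<close>. This is why the Gamma series are invisible on the graded pieces.
\<close>

lemma set_sum_unit:
  assumes A: "cplx.subspace A" and B: "cplx.subspace B" "cplx.subspace B'" "B' \<subseteq> B"
    and N: "\<And>v. v \<in> B \<Longrightarrow> cmap N v \<in> B'" and f: "fps_nth f 0 \<noteq> 0"
  shows "set_sum (fop f ` A \<inter> B) B' = set_sum (A \<inter> B) B'"
proof -
  have NB: "cmap N v \<in> B" if "v \<in> B" for v using N[OF that] B(3) by blast
  have fB: "fop g v \<in> B" if "v \<in> B" for g v by (rule fps_op_stable[OF B(1) NB that])
  have tail: "fop g v - cscale (fps_nth g 0) v \<in> B'" if "v \<in> B" for g v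
    using fps_op_tail[OF nil_N, of g v] N[OF fB[OF that]] by simp
  let ?z = "fps_nth f 0"
  show ?thesis
  proof
    show "set_sum (fop f ` A \<inter> B) B' \<subseteq> set_sum (A \<inter> B) B'"
    proof
      fix x assume "x \<in> set_sum (fop f ` A \<inter> B) B'"
      then obtain a b where x: "x = fop f a + b" "a \<in> A" "fop f a \<in> B" "b \<in> B'"
        by (auto simp: set_sum_def)
      have aB: "a \<in> B" using fB[OF x(3), of "inverse f"] by (simp add: fps_op_inverse[OF nil_N f])
      have "x = cscale ?z a + ((fop f a - cscale ?z a) + b)" using x(1) by simp
      moreover have "cscale ?z a \<in> A \<inter> B" using x(2) aB A B(1) by (simp add: cplx.subspace_scale)
      moreover have "(fop f a - cscale ?z a) + b \<in> B'" by (rule cplx.subspace_add[OF B(2) tail[OF aB] x(4)])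
      ultimately show "x \<in> set_sum (A \<inter> B) B'" using set_sumI by metis
    qed
    show "set_sum (A \<inter> B) B' \<subseteq> set_sum (fop f ` A \<inter> B) B'"
    proof
      fix x assume "x \<in> set_sum (A \<inter> B) B'"
      then obtain a b where x: "x = a + b" "a \<in> A" "a \<in> B" "b \<in> B'" by (auto simp: set_sum_def)
      let ?a = "cscale (1 / ?z) a"
      have a: "?a \<in> A" "?a \<in> B" using x A B by (simp_all add: cplx.subspace_scale)
      have "cscale ?z ?a = a" using f by simp
      then have "x = fop f ?a + (b - (fop f ?a - cscale ?z ?a))" using x(1) by simp
      moreover have "fop f ?a \<in> fop f ` A \<inter> B" using a fB by blast
      moreover have "b - (fop f ?a - cscale ?z ?a) \<in> B'" by (rule cplx.subspace_diff[OF B(2) x(4) tail[OF a(2)]])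
      ultimately show "x \<in> set_sum (fop f ` A \<inter> B) B'" using set_sumI by metis
    qed
  qed
qed

end

section \<open>Steenbrink polarized mixed Hodge structures eigenspace by eigenspace\<close>

locale steenbrink =
  fixes X :: "'a::real_vector steenbrink_data"
  assumes finX: "finite_dimensional (UNIV :: 'a set)" and X: "steenbrink_pmhs X"
begin

abbreviation "m \<equiv> wt X"
abbreviation "F \<equiv> FF X"
abbreviation "W \<equiv> WW X"
abbreviation "M \<equiv> MM X"
abbreviation "S \<equiv> SS X"

lemma st: "steenbrink_mhs m F W M" and S: "bilinear S" and S_nondeg: "nondegenerate_on UNIV S"
  and S_inv: "S (M a) (M b) = S a b"
  using X by (simp_all add: steenbrink_pmhs_def)

sublocale automorphism "MM X"
  by (rule automorphism.intro) (use st finX in \<open>simp_all add: steenbrink_mhs_def\<close>)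

lemma mhs: "mhs UNIV F W" using st by (simp add: steenbrink_mhs_def)

lemma F_filt: "decreasing_filtration UNIV F" and W_filt: "increasing_filtration UNIV W"
  and hodge: "pure_hodge_quotient k (cset (W k)) (cset (W (k - 1))) (F_Gr F W k)"
  using mhs by (simp_all add: mhs_def)

lemma F_sub: "cplx.subspace (F p)" and F_mono: "p \<le> q \<Longrightarrow> F q \<subseteq> F p"
  and F_ends: "\<exists>p. F p = {0}" "\<exists>p. F p = UNIV"
  using F_filt by (simp_all add: decreasing_filtration_def cset_def)

lemma W_sub: "subspace (W k)" and W_mono: "j \<le> k \<Longrightarrow> W j \<subseteq> W k"
  and W_ends: "\<exists>k. W k = {0}" "\<exists>k. W k = UNIV"
  using W_filt by (simp_all add: increasing_filtration_def)

lemma cW_sub: "cplx.subspace (cset (W k))"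
  by (rule subspace_cset[OF W_sub])

lemma cW_mono: "j \<le> k \<Longrightarrow> cset (W j) \<subseteq> cset (W k)"
  using W_mono by (auto simp: cset_def)

lemma cW_cj: "cj v \<in> cset (W k) \<longleftrightarrow> v \<in> cset (W k)"
  using cj_cset[OF W_sub] by (metis cj_in_image)

lemma gr_F: "gr (F p)"
proof (rule gr_stable_ss[OF F_sub])
  have "cmap (semisimple_part M) ` F p \<subseteq> F p" using st by (simp add: steenbrink_mhs_def)
  then show "ss_cplx x \<in> F p" if "x \<in> F p" for x
    using that unfolding cmap_semisimple_part by blast
qed

lemma gr_W: "gr (cset (W k))"
proof (rule gr_cset[OF W_sub])
  have "M ` W k = W k" using st by (simp add: steenbrink_mhs_def)
  then show "M x \<in> W k" if "x \<in> W k" for x using that by blast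
qed

lemma N_F: "v \<in> F p \<Longrightarrow> cmap N v \<in> F (p - 1)"
  using st by (auto simp: steenbrink_mhs_def image_subset_iff)

text \<open>
  The weight of the polarized structure that contains the eigenspace of \<open>c\<close>; the eigenvalues of that
  structure are \<open>block_set c\<close> below. This treats \<open>H\<^sub>1\<close> and \<open>H\<^sub>\<noteq>\<^sub>1\<close> at once.
\<close>

definition w0 :: "complex \<Rightarrow> int" where "w0 c = m + theta c"

definition block_set :: "complex \<Rightarrow> complex set" where "block_set c = (if c = 1 then {1} else - {1})"

abbreviation V :: "complex \<Rightarrow> 'a set" where "V c \<equiv> real_points (D (block_set c))"

lemma block_set_cnj: "d \<in> block_set c \<Longrightarrow> cnj d \<in> block_set c"
  by (auto simp: block_set_def split: if_splits)

lemma D_block_set_cj: "v \<in> D (block_set c) \<Longrightarrow> cj v \<in> D (block_set c)"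
  by (rule D_cj) (auto intro: block_set_cnj)

lemma cset_V: "cset (V c) = D (block_set c)"
  by (rule cset_D[OF block_set_cnj])

lemma E_block_set: "E c \<subseteq> D (block_set c)"
  using direct_part_gen[of "block_set c" c] by (auto simp: block_set_def split: if_splits)

lemma block: "pmhs (w0 c) (V c) (\<lambda>p. F p \<inter> D (block_set c)) (\<lambda>k. W k \<inter> V c) N S"
  using X by (cases "c = 1")
    (simp_all add: steenbrink_pmhs_def w0_def theta_def block_set_def eigsp_D eigsp_ne1_D)

lemma block_weight: "is_weight_filtration (V c) N (w0 c) (\<lambda>k. W k \<inter> V c)"
  using block[of c] by (simp add: pmhs_def)

lemma mem_V:
  assumes "v \<in> E c" shows "fst v \<in> V c \<and> snd v \<in> V c"
proof -
  have "v \<in> cset (V c)" unfolding cset_V using assms E_block_set by blast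
  then show ?thesis unfolding cset_def by (rule mem_Times_iff[THEN iffD1])
qed

lemma N_W_E: "v \<in> cset (W k) \<Longrightarrow> v \<in> E c \<Longrightarrow> cmap N v \<in> cset (W (k - 2))"
  using weight_filtration_N[OF block_weight[of c], of _ k] mem_V[of v c]
  by (auto simp: cset_def cmap_def)

lemma N_cW: "v \<in> cset (W k) \<Longrightarrow> cmap N v \<in> cset (W (k - 2))"
proof -
  assume v: "v \<in> cset (W k)"
  have "cmap N v = (\<Sum>c\<in>spectrum (cmap M). cmap N (P c v))"
    by (simp add: eig_part_sum flip: clin_sum[OF clin_N])
  also have "\<dots> \<in> cset (W (k - 2))"
    by (intro cplx.subspace_sum cW_sub N_W_E[OF graded_part[OF gr_W v] eig_part_in])
  finally show ?thesis .
qed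

lemma N_pow_cW: "v \<in> cset (W k) \<Longrightarrow> (cmap N ^^ l) v \<in> cset (W (k - 2 * int l))"
proof (induction l)
  case (Suc l)
  have e: "k - 2 * int (Suc l) = k - 2 * int l - 2" by simp
  show ?case unfolding e funpow.simps comp_apply by (rule N_cW[OF Suc.IH[OF Suc.prems]])
qed simp

lemma N_pow_E: "v \<in> E c \<Longrightarrow> (cmap N ^^ l) v \<in> E c"
  by (rule pow_stable[OF N_gen])

lemma N_pow_cj: "(cmap N ^^ l) (cj v) = cj ((cmap N ^^ l) v)"
  by (rule comm_pow[of "cmap N" cj, OF cmap_N_cj])

lemma fop_cW: "v \<in> cset (W k) \<Longrightarrow> fop f v \<in> cset (W k)"
proof (rule fps_op_stable[OF cW_sub])
  show "cmap N x \<in> cset (W k)" if "x \<in> cset (W k)" for x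
    using N_cW[OF that] cW_mono[of "k - 2" k] by auto
qed

lemma weight_surj:
  assumes z: "z \<in> cset (W (w0 c - int l))" "z \<in> E c"
  shows "\<exists>y\<in>cset (W (w0 c + int l)) \<inter> E c. z - (cmap N ^^ l) y \<in> cset (W (w0 c - int l - 1))"
proof -
  have q: "quotient_iso (N ^^ l) (W (w0 c + int l) \<inter> V c) (W (w0 c + int l - 1) \<inter> V c)
      (W (w0 c - int l) \<inter> V c) (W (w0 c - int l - 1) \<inter> V c)"
    using block_weight[of c] by (simp add: is_weight_filtration_def)
  have s: "\<exists>x\<in>W (w0 c + int l). u - (N ^^ l) x \<in> W (w0 c - int l - 1)" if "u \<in> W (w0 c - int l)" "u \<in> V c" for u
    using q that unfolding quotient_iso_def by blast
  have "fst z \<in> W (w0 c - int l)" "snd z \<in> W (w0 c - int l)" using z by (auto simp: cset_def)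
  then obtain x1 x2 where x: "x1 \<in> W (w0 c + int l)" "fst z - (N ^^ l) x1 \<in> W (w0 c - int l - 1)"
    "x2 \<in> W (w0 c + int l)" "snd z - (N ^^ l) x2 \<in> W (w0 c - int l - 1)"
    using s mem_V[OF z(2)] by metis
  let ?y = "(x1, x2)"
  have y: "?y \<in> cset (W (w0 c + int l))" "z - (cmap N ^^ l) ?y \<in> cset (W (w0 c - int l - 1))"
    using x by (auto simp: cset_def cmap_pow cmap_def mem_Times_iff)
  have "P c (z - (cmap N ^^ l) ?y) = z - (cmap N ^^ l) (P c ?y)"
    using eig_part_on[OF z(2), of c] comm_pow2[of "P c" "cmap N" l ?y, OF P_N]
    by (simp add: clin_diff[OF clin_eig_part])
  then have "z - (cmap N ^^ l) (P c ?y) \<in> cset (W (w0 c - int l - 1))"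
    using graded_part[OF gr_W y(2), of c] by simp
  then show ?thesis using graded_part_Int[OF gr_W y(1), of c] by blast
qed

lemma form_orth: "a \<in> E c \<Longrightarrow> b \<in> E d \<Longrightarrow> c * d \<noteq> 1 \<Longrightarrow> cform S a b = 0"
  by (rule invariant_orth[OF S S_inv])

lemma block_set_inverse: "c * d = 1 \<Longrightarrow> block_set d = block_set c" "c * d = 1 \<Longrightarrow> w0 d = w0 c"
  by (auto simp: block_set_def w0_def theta_def)

lemma form_skew: "cform S (cmap N a) b = - cform S a (cmap N b)"
proof (rule biadditive_eqI[where f = "\<lambda>a b. cform S (cmap N a) b" and g = "\<lambda>a b. - cform S a (cmap N b)"])
  fix c d a b assume a: "a \<in> E c" and b: "b \<in> E d"
  show "cform S (cmap N a) b = - cform S a (cmap N b)"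
  proof (cases "c * d = 1")
    case True
    have sk: "S (N x) y = - S x (N y)" if "x \<in> V c" "y \<in> V c" for x y
      using block[of c] that by (simp add: pmhs_def eq_neg_iff_add_eq_0)
    have "b \<in> E d" "block_set d = block_set c" using b block_set_inverse[OF True] by auto
    then have "fst b \<in> V c" "snd b \<in> V c" using mem_V[of b d] by auto
    then show ?thesis using mem_V[OF a] sk by (simp add: cform_def cmap_def complex_eq_iff)
  next
    case False
    then show ?thesis using form_orth[OF N_gen[OF a] b] form_orth[OF a N_gen[OF b]] by simp
  qed
qed (simp_all add: cform_add_left[OF S] cform_add_right[OF S] clin_add[OF clin_N])

lemma form_sym:
  assumes "a \<in> E c" "b \<in> E d" "c * d = 1" shows "cform S a b = (-1) powi w0 c * cform S b a"
proof -
  have "\<forall>a\<in>V c. \<forall>b\<in>V c. S a b = (-1) powi w0 c * S b a"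
    using block[of c] unfolding pmhs_def by (elim conjE)
  then have sy: "S x y = (-1) powi w0 c * S y x" if "x \<in> V c" "y \<in> V c" for x y
    using that by blast
  define k :: real where "k = (-1) powi w0 c"
  have r: "((-1) powi w0 c :: complex) = of_real k" by (simp add: k_def)
  have "fst b \<in> V c" "snd b \<in> V c" using mem_V[OF assms(2)] block_set_inverse[OF assms(3)] by auto
  then have "S (fst a) (fst b) = (-1) powi w0 c * S (fst b) (fst a)" "S (snd a) (snd b) = (-1) powi w0 c * S (snd b) (snd a)"
     "S (fst a) (snd b) = (-1) powi w0 c * S (snd b) (fst a)" "S (snd a) (fst b) = (-1) powi w0 c * S (fst b) (snd a)"
    using mem_V[OF assms(1)] sy by blast+
  then show ?thesis unfolding r cform_def k_def[symmetric] by (simp add: complex_eq_iff algebra_simps)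
qed

lemma form_F:
  assumes "a \<in> F p" "a \<in> E c" "b \<in> F q" "b \<in> E d" "c * d = 1" "p + q = w0 c + 1"
  shows "cform S a b = 0"
proof -
  have "\<forall>p. \<forall>a\<in>F p \<inter> D (block_set c). \<forall>b\<in>F (w0 c + 1 - p) \<inter> D (block_set c). cform S a b = 0"
    using block[of c] unfolding pmhs_def by blast
  moreover have "w0 c + 1 - p = q" using assms by simp
  moreover have "b \<in> D (block_set c)" using E_block_set[of d] assms block_set_inverse by auto
  ultimately show ?thesis using assms E_block_set[of c] by blast
qed

lemma form_W:
  assumes "a \<in> cset (W j)" "a \<in> E c" "b \<in> cset (W k)" "b \<in> E d" "c * d = 1" "j + k < 2 * w0 c"
  shows "cform S a b = 0"
proof (rule cform_cset_0[OF S])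
  show "a \<in> cset (W j \<inter> V c)" using assms mem_V[of a c] by (auto simp: cset_def)
  show "b \<in> cset (W k \<inter> V c)" using assms mem_V[of b d] block_set_inverse[OF assms(5)] by (auto simp: cset_def)
  have sk: "S (N x) y + S x (N y) = 0" if "x \<in> V c" "y \<in> V c" for x y
    using block[of c] that by (simp add: pmhs_def)
  show "S x y = 0" if "x \<in> W j \<inter> V c" "y \<in> W k \<inter> V c" for x y
    by (rule weight_filtration_orth[OF block_weight linear_N S sk assms(6) that])
qed

lemma gr_F_Gr: "gr (F_Gr F W k p)"
  unfolding F_Gr_def by (intro graded_set_sum graded_Int gr_F gr_W)

lemma F_Gr_block: "F_Gr (\<lambda>p. F p \<inter> D (block_set c)) (\<lambda>k. W k \<inter> V c) k p = F_Gr F W k p \<inter> D (block_set c)"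
  by (rule F_Gr_D[OF _ gr_F gr_W]) (rule block_set_cnj)

lemma F_Gr_le: "F_Gr F W k p \<subseteq> cset (W k)"
  unfolding F_Gr_def using cplx.subspace_add[OF cW_sub, of _ k] cW_mono[of "k - 1" k]
  by (auto simp: set_sum_def)

lemma positivity:
  assumes a: "a \<in> E c" "a \<in> F_Gr F W (w0 c + int l) p" "cj a \<in> F_Gr F W (w0 c + int l) (w0 c + int l - p)"
    and prim: "(cmap N ^^ (l + 1)) a \<in> cset (W (w0 c - int l - 3))" and nz: "a \<notin> cset (W (w0 c + int l - 1))"
  shows "\<i> powi (2 * p - w0 c - int l) * cform S a ((cmap N ^^ l) (cj a)) \<in> \<real>"
    and "Re (\<i> powi (2 * p - w0 c - int l) * cform S a ((cmap N ^^ l) (cj a))) > 0"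
proof -
  let ?W = "\<lambda>k. W k \<inter> V c" and ?F = "\<lambda>p. F p \<inter> D (block_set c)"
  have cW: "cset (?W k) = cset (W k) \<inter> D (block_set c)" for k by (simp add: cset_Int cset_V)
  have aD: "a \<in> D (block_set c)" using a E_block_set by blast
  then have cD: "cj a \<in> D (block_set c)" by (rule D_block_set_cj)
  have aW: "a \<in> cset (W (w0 c + int l))" using a F_Gr_le by blast
  have p1: "a \<in> primitive ?W N (w0 c) l"
    using aW aD prim N_pow_E[OF a(1), of "l + 1"] E_block_set by (auto simp: primitive_def cW)
  have "(cmap N ^^ (l + 1)) (cj a) \<in> cset (W (w0 c - int l - 3))"
    unfolding N_pow_cj cW_cj by (rule prim)
  moreover have "(cmap N ^^ (l + 1)) (cj a) \<in> D (block_set c)"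
    unfolding N_pow_cj using N_pow_E[OF a(1), of "l + 1"] E_block_set by (intro D_block_set_cj) auto
  ultimately have p2: "cj a \<in> primitive ?W N (w0 c) l"
    using aW cD by (auto simp: primitive_def cW cW_cj)
  have "a \<in> (F_Gr ?F ?W (w0 c + int l) p \<inter> primitive ?W N (w0 c) l) \<inter>
            cj ` (F_Gr ?F ?W (w0 c + int l) (w0 c + int l - p) \<inter> primitive ?W N (w0 c) l)"
    unfolding F_Gr_block using p1 p2 aD cD a by (auto simp: cj_in_image)
  moreover have "a \<notin> cset (?W (w0 c + int l - 1))" using nz by (simp add: cW)
  moreover have "\<forall>(l::nat) p. \<forall>a \<in> (F_Gr ?F ?W (w0 c + int l) p \<inter> primitive ?W N (w0 c) l) \<inter>
                    cj ` (F_Gr ?F ?W (w0 c + int l) (w0 c + int l - p) \<inter> primitive ?W N (w0 c) l).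
        a \<notin> cset (?W (w0 c + int l - 1)) \<longrightarrow>
        (let z = \<i> powi (2 * p - w0 c - int l) * cform S a ((cmap N ^^ l) (cj a))
         in z \<in> \<real> \<and> Re z > 0)"
    using block[of c] unfolding pmhs_def by blast
  ultimately have "let z = \<i> powi (2 * p - w0 c - int l) * cform S a ((cmap N ^^ l) (cj a)) in z \<in> \<real> \<and> Re z > 0"
    by blast
  then show "\<i> powi (2 * p - w0 c - int l) * cform S a ((cmap N ^^ l) (cj a)) \<in> \<real>"
    and "Re (\<i> powi (2 * p - w0 c - int l) * cform S a ((cmap N ^^ l) (cj a))) > 0"
    by (simp_all add: Let_def)
qed

text \<open>
  The part of weight \<open>w - l'\<close> is hit by \<open>N\<^bsup>l'\<^esup>\<close> from weight \<open>w + l'\<close>, where the eigenspace has nothing.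
\<close>

lemma weight_drop:
  assumes "l' > 0" "E c \<subseteq> cset (W (w0 c + int l' - 1))"
  shows "E c \<inter> cset (W (w0 c - int l')) \<subseteq> cset (W (w0 c - int l' - 1))"
proof
  fix z assume z: "z \<in> E c \<inter> cset (W (w0 c - int l'))"
  obtain y where y: "y \<in> E c" "z - (cmap N ^^ l') y \<in> cset (W (w0 c - int l' - 1))"
    using weight_surj[of z c l'] z by blast
  have "(cmap N ^^ l') y \<in> cset (W (w0 c + int l' - 1 - 2 * int l'))" using N_pow_cW assms y by blast
  then have "(cmap N ^^ l') y \<in> cset (W (w0 c - int l' - 1))" by (simp add: algebra_simps)
  then have "z - (cmap N ^^ l') y + (cmap N ^^ l') y \<in> cset (W (w0 c - int l' - 1))"
    by (rule cplx.subspace_add[OF cW_sub y(2)])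
  then show "z \<in> cset (W (w0 c - int l' - 1))" by simp
qed

text \<open>
  A vector of top weight and pure type in an eigenspace is primitive. The polarization is positive on
  it and so pairs the eigenspaces of \<open>c\<close> and \<open>cnj c\<close> nontrivially, which forces \<open>c * cnj c = 1\<close>.
\<close>

lemma norm_spectrum:
  assumes "c \<in> spectrum (cmap M)" shows "norm c = 1"
proof (rule ccontr)
  assume n: "norm c \<noteq> 1"
  have cc: "c * cnj c \<noteq> 1" using n
    by (metis complex_mod_mult_cnj norm_one power2_eq_1_iff norm_ge_zero not_one_le_zero neg_0_le_iff_le order.trans zero_neq_one)
  have En: "E c \<noteq> {0}" using assms by (simp add: spectrum_def)
  obtain ka where ka: "W ka = {0}" using W_ends(1) by (rule exE)
  obtain kb where kb: "W kb = UNIV" using W_ends(2) by (rule exE)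
  note k = ka kb
  \<comment> \<open>the top weight of the eigenspace; it is at least the middle weight by the symmetry of the weights\<close>
  have "\<exists>k. E c \<subseteq> cset (W k) \<and> \<not> E c \<subseteq> cset (W (k - 1))"
  proof (rule int_jump)
    show "\<not> E c \<subseteq> cset (W ka)" using En zero_in_gen by (auto simp: k cset_def zero_prod_def)
    show "E c \<subseteq> cset (W kb)" by (auto simp: k cset_def)
  qed (use cW_mono in blast)
  then obtain k where k1: "E c \<subseteq> cset (W k)" and k2: "\<not> E c \<subseteq> cset (W (k - 1))" by blast
  have "k \<ge> w0 c"
  proof (rule ccontr)
    assume "\<not> k \<ge> w0 c"
    then have l': "nat (w0 c - k) > 0" "k = w0 c - int (nat (w0 c - k))" by auto
    have "E c \<subseteq> cset (W (w0 c + int (nat (w0 c - k)) - 1))"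
      using k1 cW_mono[of k "w0 c + int (nat (w0 c - k)) - 1"] l' by force
    from weight_drop[OF l'(1) this] k1 k2 l'(2) show False by auto
  qed
  then obtain l where l: "k = w0 c + int l" by (metis zle_iff_zadd)
  have prim: "(cmap N ^^ (l + 1)) a \<in> cset (W (w0 c - int l - 3))" if "a \<in> E c" for a
  proof -
    have "(cmap N ^^ (l + 1)) a \<in> cset (W (w0 c + int l - 2 * int (l + 1)))"
      using N_pow_cW k1 l that by blast
    moreover have "w0 c + int l - 2 * int (l + 1) = w0 c - int (l + 2)" by simp
    ultimately have "(cmap N ^^ (l + 1)) a \<in> E c \<inter> cset (W (w0 c - int (l + 2)))"
      using N_pow_E[OF that, of "l + 1"] by (metis IntI)
    moreover have "E c \<subseteq> cset (W (w0 c + int (l + 2) - 1))"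
      using k1 cW_mono[of k "w0 c + int (l + 2) - 1"] l by auto
    ultimately have "(cmap N ^^ (l + 1)) a \<in> cset (W (w0 c - int (l + 2) - 1))"
      using weight_drop[of "l + 2" c] by auto
    moreover have "w0 c - int (l + 2) - 1 = w0 c - int l - 3" by simp
    ultimately show ?thesis by (simp only:)
  qed
  obtain pa where pa: "F pa = {0}" using F_ends(1) by (rule exE)
  obtain pb where pb: "F pb = UNIV" using F_ends(2) by (rule exE)
  note p = pa pb
  \<comment> \<open>the last step of the Hodge filtration that the eigenspace meets in top weight; a vector there is of
    pure type after subtraction of a vector of lower weight\<close>
  let ?Q = "\<lambda>q. \<not> E c \<inter> F_Gr F W k (- q) \<subseteq> cset (W (k - 1))"
  have "\<exists>q. ?Q q \<and> \<not> ?Q (q - 1)"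
  proof (rule int_jump)
    show "\<not> ?Q (- pa)" using cplx.subspace_0[OF cW_sub] by (auto simp: F_Gr_def p set_sum_def)
    have "cset (W k) \<subseteq> F_Gr F W k pb"
    proof
      fix v assume "v \<in> cset (W k)"
      then have "v + 0 \<in> F_Gr F W k pb"
        unfolding F_Gr_def by (intro set_sumI cplx.subspace_0[OF cW_sub]) (simp add: p)
      then show "v \<in> F_Gr F W k pb" by simp
    qed
    then show "?Q (- pb)" using k1 k2 by (metis Int_absorb2 minus_minus order.trans)
    show "?Q q'" if "q \<le> q'" "?Q q" for q q'
    proof -
      have "F_Gr F W k (- q) \<subseteq> F_Gr F W k (- q')"
        unfolding F_Gr_def using F_mono[of "- q'" "- q"] that(1) by (auto simp: set_sum_def)
      then show ?thesis using that(2) by blast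
    qed
  qed
  then obtain q where q1: "\<not> E c \<inter> F_Gr F W k (- q) \<subseteq> cset (W (k - 1))"
    and q2: "E c \<inter> F_Gr F W k (- (q - 1)) \<subseteq> cset (W (k - 1))" by blast
  define r where "r = - q"
  have r2: "E c \<inter> F_Gr F W k (r + 1) \<subseteq> cset (W (k - 1))" using q2 by (simp add: r_def add.commute)
  obtain x where x: "x \<in> E c" "x \<in> F_Gr F W k r" "x \<notin> cset (W (k - 1))" using q1 by (auto simp: r_def)
  have "set_sum (F_Gr F W k (r + 1)) (cj ` F_Gr F W k (k + 1 - (r + 1))) = cset (W k)"
    using hodge[of k] unfolding pure_hodge_quotient_def by blast
  then have "x \<in> set_sum (F_Gr F W k (r + 1)) (cj ` F_Gr F W k (k - r)) \<inter> E c"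
    using x k1 by auto
  then have "x \<in> set_sum (F_Gr F W k (r + 1) \<inter> E c) (cj ` F_Gr F W k (k - r) \<inter> E c)"
    using set_sum_gen[OF gr_F_Gr gr_cj[OF gr_F_Gr]] by blast
  then obtain y a where ya: "x = y + a" "y \<in> F_Gr F W k (r + 1) \<inter> E c" "a \<in> cj ` F_Gr F W k (k - r) \<inter> E c"
    by (rule set_sumE)
  have y: "y \<in> cset (W (k - 1))" using r2 ya by blast
  have "a \<notin> cset (W (k - 1))"
    using x(3) cplx.subspace_add[OF cW_sub y] unfolding ya(1) by blast
  moreover have "a \<in> F_Gr F W k r"
  proof -
    have "0 + y \<in> F_Gr F W k r" unfolding F_Gr_def
      by (intro set_sumI y) (simp add: cplx.subspace_0 F_sub cW_sub)
    then have "x - y \<in> F_Gr F W k r" using cplx.subspace_diff[OF graded_subspace[OF gr_F_Gr] x(2)] by simp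
    then show ?thesis using ya(1) by simp
  qed
  moreover have "cj a \<in> F_Gr F W k (k - r)" "a \<in> E c" using ya(3) by (auto simp: cj_in_image)
  ultimately have "Re (\<i> powi (2 * r - w0 c - int l) * cform S a ((cmap N ^^ l) (cj a))) > 0"
    using positivity(2)[of a c l r] prim l by auto
  moreover have "cform S a ((cmap N ^^ l) (cj a)) = 0"
    by (rule form_orth[OF \<open>a \<in> E c\<close> N_pow_E[OF E_cj[OF \<open>a \<in> E c\<close>]] cc])
  ultimately show False by simp
qed

end

section \<open>Arguments of unit complex numbers\<close>

abbreviation unit_exp :: "real \<Rightarrow> complex" where "unit_exp \<alpha> \<equiv> exp (- (2 * of_real pi * \<i> * of_real \<alpha>))"

definition alpha :: "complex \<Rightarrow> real" where
  "alpha c = (THE \<alpha>. 0 < \<alpha> \<and> \<alpha> \<le> 1 \<and> unit_exp \<alpha> = c)"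

lemma unit_exp_eq_iff: "unit_exp \<alpha> = unit_exp \<beta> \<longleftrightarrow> (\<exists>n::int. \<alpha> = \<beta> + of_int n)"
proof -
  have "unit_exp \<alpha> = unit_exp \<beta> \<longleftrightarrow> (\<exists>n::int. - (2 * of_real pi * \<i> * of_real \<alpha>) = - (2 * of_real pi * \<i> * of_real \<beta>) + of_int (2 * n) * of_real pi * \<i>)"
    by (simp add: exp_eq)
  also have "\<dots> \<longleftrightarrow> (\<exists>n::int. \<alpha> = \<beta> + of_int (- n))"
  proof (rule iff_exI)
    fix n :: int
    have eq: "- (2 * of_real pi * \<i> * of_real \<alpha>) - (- (2 * of_real pi * \<i> * of_real \<beta>) + of_int (2 * n) * of_real pi * \<i>)
        = of_real (2 * pi * (\<beta> - \<alpha> - of_int n)) * \<i>"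
      by (simp add: algebra_simps)
    have "- (2 * of_real pi * \<i> * of_real \<alpha>) = - (2 * of_real pi * \<i> * of_real \<beta>) + of_int (2 * n) * of_real pi * \<i>
        \<longleftrightarrow> of_real (2 * pi * (\<beta> - \<alpha> - of_int n)) * \<i> = 0"
      unfolding eq[symmetric] by (rule right_minus_eq[symmetric])
    also have "\<dots> \<longleftrightarrow> 2 * pi * (\<beta> - \<alpha> - of_int n) = 0" by (simp only: mult_eq_0_iff of_real_eq_0_iff) simp
    also have "\<dots> \<longleftrightarrow> \<alpha> = \<beta> + of_int (- n)" by auto
    finally show "- (2 * of_real pi * \<i> * of_real \<alpha>) = - (2 * of_real pi * \<i> * of_real \<beta>) + of_int (2 * n) * of_real pi * \<i>
        \<longleftrightarrow> \<alpha> = \<beta> + of_int (- n)" .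
  qed
  also have "\<dots> \<longleftrightarrow> (\<exists>n::int. \<alpha> = \<beta> + of_int n)" by (metis minus_minus)
  finally show ?thesis .
qed

lemma norm_unit_exp: "norm (unit_exp \<alpha>) = 1"
  by (simp add: norm_exp)

lemma alpha_ex: "norm c = 1 \<Longrightarrow> \<exists>\<alpha>. 0 < \<alpha> \<and> \<alpha> \<le> 1 \<and> unit_exp \<alpha> = c"
proof -
  assume c: "norm c = 1"
  then have "c = exp (\<i> * of_real (Arg c))" using Arg_eq[of c] by (cases "c = 0") auto
  define b where "b = - Arg c / (2 * pi)"
  have "- (2 * of_real pi * \<i> * of_real b) = \<i> * of_real (Arg c)" by (simp add: b_def field_simps)
  then have eb: "unit_exp b = c" using \<open>c = exp _\<close> by simp
  let ?a = "b - of_int (\<lceil>b\<rceil> - 1)"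
  have "unit_exp ?a = unit_exp b" unfolding unit_exp_eq_iff by (rule exI[of _ "- (\<lceil>b\<rceil> - 1)"]) simp
  moreover have "0 < ?a" "?a \<le> 1" by linarith+
  ultimately show ?thesis using eb by blast
qed

lemma alpha_unique:
  assumes "0 < \<alpha>" "\<alpha> \<le> 1" "0 < \<beta>" "\<beta> \<le> 1" "unit_exp \<alpha> = unit_exp \<beta>" shows "\<alpha> = \<beta>"
proof -
  obtain n :: int where n: "\<alpha> = \<beta> + of_int n" using assms(5) unit_exp_eq_iff by blast
  then have "real_of_int n < 1" "real_of_int n > -1" using assms by linarith+
  then have "n = 0" by linarith
  then show ?thesis using n by simp
qed

lemma alpha_eqI: "0 < \<alpha> \<Longrightarrow> \<alpha> \<le> 1 \<Longrightarrow> alpha (unit_exp \<alpha>) = \<alpha>"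
  unfolding alpha_def by (rule the_equality) (auto intro: alpha_unique)

lemma alpha:
  assumes "norm c = 1" shows "0 < alpha c" "alpha c \<le> 1" "unit_exp (alpha c) = c"
proof -
  obtain a where "0 < a \<and> a \<le> 1 \<and> unit_exp a = c" using alpha_ex[OF assms] by blast
  then have "alpha c = a" using alpha_eqI by blast
  then show "0 < alpha c" "alpha c \<le> 1" "unit_exp (alpha c) = c" using \<open>0 < a \<and> _\<close> by auto
qed

lemma unit_exp_half: "unit_exp (\<alpha> + 1/2) = - unit_exp \<alpha>" "unit_exp (\<alpha> - 1/2) = - unit_exp \<alpha>"
proof -
  have "- (2 * of_real pi * \<i> * of_real (\<alpha> + 1/2)) = - (2 * of_real pi * \<i> * of_real \<alpha>) - of_real pi * \<i>"
    "- (2 * of_real pi * \<i> * of_real (\<alpha> - 1/2)) = - (2 * of_real pi * \<i> * of_real \<alpha>) + of_real pi * \<i>"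
    by (simp_all add: field_simps)
  then show "unit_exp (\<alpha> + 1/2) = - unit_exp \<alpha>" "unit_exp (\<alpha> - 1/2) = - unit_exp \<alpha>"
    by (simp_all only: exp_add exp_diff exp_pi_i) simp_all
qed

lemma unit_exp_1: "unit_exp 1 = 1"
  using unit_exp_eq_iff[of 1 0] by (metis add_0 exp_zero minus_zero mult_zero_right of_int_1 of_real_0)

lemma cnj_unit_exp: "cnj (unit_exp \<alpha>) = unit_exp (1 - \<alpha>)"
proof -
  have "cnj (unit_exp \<alpha>) = unit_exp (- \<alpha>)" by (simp add: exp_cnj)
  also have "\<dots> = unit_exp (1 - \<alpha>)" unfolding unit_exp_eq_iff by (rule exI[of _ "-1"]) simp
  finally show ?thesis .
qed

lemma alpha_neg:
  assumes "norm c = 1" shows "alpha (- c) = (if alpha c \<le> 1/2 then alpha c + 1/2 else alpha c - 1/2)"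
proof -
  have h: "unit_exp (alpha c + 1/2) = - c" "unit_exp (alpha c - 1/2) = - c"
    unfolding unit_exp_half alpha(3)[OF assms] by (rule refl)+
  have "alpha (unit_exp (alpha c + 1/2)) = alpha c + 1/2" if "alpha c \<le> 1/2"
    by (rule alpha_eqI) (use alpha[OF assms] that in auto)
  moreover have "alpha (unit_exp (alpha c - 1/2)) = alpha c - 1/2" if "\<not> alpha c \<le> 1/2"
    by (rule alpha_eqI) (use alpha[OF assms] that in auto)
  ultimately show ?thesis unfolding h by simp
qed

lemma alpha_1: "alpha 1 = 1"
  using alpha_eqI[of 1] unit_exp_1 by simp

lemma alpha_eq_1: "norm c = 1 \<Longrightarrow> alpha c = 1 \<longleftrightarrow> c = 1"
  using alpha(3)[of c] unit_exp_1 alpha_1 by metis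

lemma alpha_m1: "alpha (- 1) = 1/2"
  using alpha_neg[of 1] alpha_1 by simp

lemma alpha_eq_half: "norm c = 1 \<Longrightarrow> alpha c = 1/2 \<longleftrightarrow> c = - 1"
  using alpha(3)[of c] alpha(3)[of "-1"] alpha_m1 by (metis norm_minus_cancel norm_one)

lemma alpha_cnj:
  assumes "norm c = 1" "c \<noteq> 1" shows "alpha (cnj c) = 1 - alpha c"
proof -
  have "alpha c < 1" using alpha(2)[OF assms(1)] alpha_eq_1[OF assms(1)] assms(2) by linarith
  then have "alpha (unit_exp (1 - alpha c)) = 1 - alpha c" using alpha(1)[OF assms(1)] by (intro alpha_eqI) auto
  then show ?thesis using cnj_unit_exp[of "alpha c"] alpha(3)[OF assms(1)] by simp
qed

text \<open>
  The index shift of the Hodge filtration on the eigenspace of \<open>c\<close>.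
\<close>

definition eps :: "complex \<Rightarrow> int" where "eps c = (if alpha c \<le> 1/2 then 1 else 0)"

text \<open>
  The index shift of the weight filtration on the eigenspace of \<open>c\<close>.
\<close>

definition delta :: "complex \<Rightarrow> int" where "delta c = 1 + theta (- c) - theta c"

lemma eps_neg: "norm c = 1 \<Longrightarrow> eps c + eps (- c) = 1"
  using alpha(1,2)[of c] by (auto simp: eps_def alpha_neg)

lemma delta_neg: "delta c + delta (- c) = 2"
  by (simp add: delta_def)

lemma eps_cnj:
  assumes "norm c = 1" shows "eps c + eps (cnj c) = delta c"
proof (cases "c = 1 \<or> c = - 1")
  case True
  then show ?thesis by (auto simp: eps_def delta_def theta_def alpha_1 alpha_m1)
next
  case False
  then have "alpha c \<noteq> 1/2" using alpha_eq_half[OF assms] by blast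
  moreover have "- c \<noteq> 1" using False by (metis minus_minus)
  ultimately show ?thesis using False alpha_cnj[OF assms] by (auto simp: eps_def delta_def theta_def)
qed

section \<open>The isomorphism of Hodge filtrations and the modified form\<close>

abbreviation gam :: "complex \<Rightarrow> complex fps" where "gam c \<equiv> gamma_fps (alpha c)"

text \<open>
  Since \<open>alpha (- c) = alpha c \<plusminus> 1/2\<close>, this is the series of \<open>(G\<^bsup>(\<alpha>\<plusminus>1/2)\<^esup>)\<^sup>-\<^sup>1 G\<^bsup>(\<alpha>)\<^esup>\<close>.
\<close>

definition phi :: "complex \<Rightarrow> complex fps" where "phi c = gam c * inverse (gam (- c))"

text \<open>
  The operator \<open>\<kappa>\<close> of \<open>- M\<close> acts on the eigenspace of \<open>c\<close> by \<open>seifert_fps (- c)\<close>. The quotient \<open>\<rho>\<close> is what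
  turns the old form into the new one.
\<close>

definition rho :: "complex \<Rightarrow> complex fps" where "rho c = seifert_fps c * inverse (seifert_fps (- c))"

lemma gamma_fps_nz: "\<beta> > 0 \<Longrightarrow> fps_nth (gamma_fps \<beta>) 0 \<noteq> 0"
  unfolding gamma_fps_0 by (metis Gamma_real_pos of_real_eq_0_iff order_less_irrefl)

lemma gam_nz: "norm c = 1 \<Longrightarrow> fps_nth (gam c) 0 \<noteq> 0"
  by (rule gamma_fps_nz) (rule alpha)

lemma phi_nz: "norm c = 1 \<Longrightarrow> fps_nth (phi c) 0 \<noteq> 0"
  using gam_nz[of c] gam_nz[of "- c"] by (simp add: phi_def)

lemma rho_nz: "fps_nth (rho c) 0 \<noteq> 0"
  using seifert_fps_0_nz by (simp add: rho_def)

lemma rho_neg: "rho (- c) * rho c = 1"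
proof -
  have "rho (- c) * rho c = (seifert_fps (- c) * inverse (seifert_fps (- c))) * (seifert_fps c * inverse (seifert_fps c))"
    by (simp add: rho_def mult_ac)
  then show ?thesis by (simp add: inverse_mult_eq_1' seifert_fps_0_nz)
qed

lemma phi_neg: "norm c = 1 \<Longrightarrow> phi (- c) * phi c = 1"
proof -
  assume c: "norm c = 1"
  have "phi (- c) * phi c = (gam (- c) * inverse (gam (- c))) * (gam c * inverse (gam c))"
    by (simp add: phi_def mult_ac)
  then show ?thesis using c by (simp add: inverse_mult_eq_1' gam_nz)
qed

lemma mult_fps_cnj:
  "(\<And>k. fps_nth g k = cnj (fps_nth f k)) \<Longrightarrow> (\<And>k. fps_nth g' k = cnj (fps_nth f' k)) \<Longrightarrow>
   fps_nth (g * g') k = cnj (fps_nth (f * f') k)"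
  by (simp add: fps_mult_nth cnj_sum)

lemma inverse_fps_cnj:
  assumes "fps_nth f 0 \<noteq> 0" "\<And>k. fps_nth g k = cnj (fps_nth f k)"
  shows "fps_nth (inverse g) k = cnj (fps_nth (inverse f) k)"
proof -
  let ?h = "Abs_fps (\<lambda>k. cnj (fps_nth (inverse f) k))"
  have "fps_nth (g * ?h) k = cnj (fps_nth (f * inverse f) k)" for k
    by (rule mult_fps_cnj) (simp_all add: assms(2))
  then have "g * ?h = 1" using assms(1) by (simp add: fps_eq_iff inverse_mult_eq_1')
  then have "inverse g = ?h" by (rule fps_inverse_unique)
  then show ?thesis by simp
qed

lemma rho_cnj: "fps_nth (rho (cnj c)) k = cnj (fps_nth (rho c) k)"
  unfolding rho_def
proof (rule mult_fps_cnj)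
  show "fps_nth (inverse (seifert_fps (- cnj c))) k = cnj (fps_nth (inverse (seifert_fps (- c))) k)" for k
    using seifert_fps_cnj[of "- c"] by (intro inverse_fps_cnj seifert_fps_0_nz) simp
qed (rule seifert_fps_cnj)

text \<open>
  The reflection formula, uniformly for all \<open>c\<close> on the unit circle. Replacing \<open>N\<close> by \<open>- N\<close> in the first
  factor is passing to the adjoint.
\<close>

lemma pairing:
  assumes c: "norm c = 1"
  shows "\<exists>r. r \<noteq> 0 \<and> (gam (cnj c) oo - fps_X) * gam c * seifert_fps c = fps_const r * fps_exp (1 / 2)"
proof (cases "c = 1")
  case True
  have m: "fps_const (- 1 :: complex) = - 1" by (metis fps_const_1_eq_1 fps_const_neg)
  have "(gam (cnj c) oo - fps_X) * gam c * seifert_fps c = - fps_exp (1 / 2)"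
    using gamma_pairing_1 True by (simp only: alpha_1 seifert_fps_def complex_cnj_one if_True simp_thms)
  then show ?thesis by (intro exI[of _ "-1"]) (simp only: m mult_minus_left mult_1_left, simp)
next
  case False
  have "alpha c < 1" using alpha(2)[OF c] alpha_eq_1[OF c] False by linarith
  then show ?thesis using gamma_pairing[of "alpha c"] alpha[OF c] alpha_cnj[OF c False] False
    by (intro exI[of _ "- 2 * of_real pi * \<i> * exp (- (of_real pi * \<i> * of_real (alpha c)))"])
       (simp add: seifert_fps_def)
qed

text \<open>
  The identity \<open>pairing\<close> for \<open>c\<close> is divided by the one for \<open>- c\<close>, and the two factors \<open>exp (N/2)\<close> cancel. So
  \<open>\<phi>\<close> is an isometry up to a constant from the old form to the new one.
\<close>

lemma phi_pairing:
  assumes c: "norm c = 1"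
  shows "\<exists>r. (phi (cnj c) oo - fps_X) * phi c * rho c = fps_const r"
proof -
  have c': "norm (- c) = 1" "norm (cnj c) = 1" "norm (- cnj c) = 1" using c by auto
  obtain r where r: "r \<noteq> 0" "(gam (cnj c) oo - fps_X) * gam c * seifert_fps c = fps_const r * fps_exp (1 / 2)"
    using pairing[OF c] by blast
  obtain r' where r': "r' \<noteq> 0" "(gam (- cnj c) oo - fps_X) * gam (- c) * seifert_fps (- c) = fps_const r' * fps_exp (1 / 2)"
    using pairing[OF c'(1)] by auto
  have "phi (cnj c) oo - fps_X = (gam (cnj c) oo - fps_X) * inverse (gam (- cnj c) oo - fps_X)"
    unfolding phi_def
    by (simp add: fps_compose_mult_distrib fps_inverse_compose gam_nz[OF c'(3)])
  then have "(phi (cnj c) oo - fps_X) * phi c * rho c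
      = ((gam (cnj c) oo - fps_X) * gam c * seifert_fps c) * inverse ((gam (- cnj c) oo - fps_X) * gam (- c) * seifert_fps (- c))"
    by (simp add: phi_def rho_def fps_inverse_mult mult_ac)
  also have "\<dots> = fps_const r * fps_const (inverse r') * (fps_exp (1 / 2) * inverse (fps_exp (1 / 2)))"
    unfolding r r' by (simp add: fps_inverse_mult fps_const_inverse mult_ac)
  also have "\<dots> = fps_const (r * inverse r')" by (simp add: inverse_mult_eq_1')
  finally show ?thesis by blast
qed

text \<open>
  The adjoint of \<open>M\<close> is its inverse, so the adjoint of \<open>M - 1\<close> is \<open>- M\<^sup>-\<^sup>1 (M - 1)\<close>. Division by \<open>N\<close>, which is
  skew, removes the sign on \<open>H\<^sub>1\<close>.
\<close>

lemma seifert_fps_adjoint: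
  assumes "c \<noteq> 0"
  shows "seifert_fps (inverse c) = fps_const ((if c = 1 then 1 else - 1) / c) * fps_exp 1 * (seifert_fps c oo - fps_X)"
proof (cases "c = 1")
  case True
  have X: "fps_X * fps_shift 1 (fps_exp 1) = fps_exp 1 - (1 :: complex fps)"
    by (rule fps_ext) (auto simp: gr0_conv_Suc)
  have "(fps_X * fps_shift 1 (fps_exp 1)) oo - fps_X = (fps_exp 1 - 1) oo (- fps_X :: complex fps)"
    unfolding X ..
  then have X': "- fps_X * (fps_shift 1 (fps_exp 1) oo - fps_X) = fps_exp (- 1) - (1 :: complex fps)"
    by (simp add: fps_compose_mult_distrib fps_compose_sub_distrib fps_exp_compose_linear[of 1 "-1", simplified])
  have e: "fps_exp 1 * fps_exp (-1) = (1 :: complex fps)" by (simp flip: fps_exp_add_mult)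
  have "fps_X * (fps_exp 1 * (fps_shift 1 (fps_exp 1) oo - fps_X)) = - (fps_exp 1 * (fps_exp (-1) - (1 :: complex fps)))"
    unfolding X'[symmetric] by (simp add: mult_ac)
  also have "\<dots> = fps_X * fps_shift 1 (fps_exp 1)" unfolding X by (simp add: right_diff_distrib e)
  finally have "fps_exp 1 * (fps_shift 1 (fps_exp 1) oo - fps_X) = (fps_shift 1 (fps_exp 1) :: complex fps)"
    by (simp only: mult_cancel_left fps_X_neq_zero) simp
  then show ?thesis using True by (simp add: seifert_fps_def fps_compose_uminus)
next
  case False
  have e: "fps_exp 1 * fps_exp (-1) = (1 :: complex fps)" by (simp flip: fps_exp_add_mult)
  have sf: "seifert_fps c oo - fps_X = fps_const c * fps_exp (-1) - 1"
    using False by (simp add: seifert_fps_def fps_compose_sub_distrib fps_compose_mult_distrib fps_exp_compose_linear[of 1 "-1", simplified])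
  have k: "fps_const (- 1 / c) * fps_const c = - 1" "fps_const (- 1 / c) = - fps_const (1 / c)"
    using assms by (simp_all add: fps_const_neg[symmetric] del: fps_const_neg)
  have "fps_const (- 1 / c) * fps_exp 1 * (seifert_fps c oo - fps_X)
      = (fps_const (- 1 / c) * fps_const c) * (fps_exp 1 * fps_exp (-1)) - fps_const (- 1 / c) * fps_exp 1"
    unfolding sf by (simp only: right_diff_distrib mult_1_left mult_1_right mult_ac)
  also have "\<dots> = fps_const (1 / c) * fps_exp 1 - 1"
    unfolding e k(1) unfolding k(2)
    by (simp only: mult_1_right mult_minus_left diff_minus_eq_add uminus_add_conv_diff)
  finally show ?thesis using False assms by (simp add: seifert_fps_def inverse_eq_divide inverse_eq_1_iff)
qed

text \<open>
  The parity of the weight changes with \<open>delta c\<close>, and with it the symmetry of the form.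
\<close>

lemma rho_adjoint:
  assumes c: "norm c = 1"
  shows "rho (cnj c) = fps_const ((-1) powi delta c) * (rho c oo - fps_X)"
proof -
  have c0: "c \<noteq> 0" "- c \<noteq> 0" using c by auto
  have ci: "cnj c = inverse c" using c by (simp add: complex_eq_iff inverse_complex.sel cmod_def)
  let ?s = "if c = 1 then 1 else - 1 :: complex" and ?t = "if - c = 1 then 1 else - 1 :: complex"
  have 1: "seifert_fps (cnj c) = fps_const (?s / c) * fps_exp 1 * (seifert_fps c oo - fps_X)"
    unfolding ci by (rule seifert_fps_adjoint[OF c0(1)])
  have "- cnj c = inverse (- c)" by (simp add: ci)
  then have 2: "seifert_fps (- cnj c) = fps_const (?t / (- c)) * fps_exp 1 * (seifert_fps (- c) oo - fps_X)"
    using seifert_fps_adjoint[OF c0(2)] by simp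
  have "rho c oo - fps_X = (seifert_fps c oo - fps_X) * inverse (seifert_fps (- c) oo - fps_X)"
    unfolding rho_def by (simp add: fps_compose_mult_distrib fps_inverse_compose seifert_fps_0_nz)
  moreover have "rho (cnj c) = fps_const (?s / c) * inverse (fps_const (?t / (- c))) * (fps_exp 1 * inverse (fps_exp 1))
      * ((seifert_fps c oo - fps_X) * inverse (seifert_fps (- c) oo - fps_X))"
    unfolding rho_def 1 2 by (simp add: fps_inverse_mult mult_ac)
  moreover have "fps_const (?s / c) * inverse (fps_const (?t / (- c))) = fps_const (- ?s * ?t)"
    using c0 by (simp add: fps_const_inverse)
  moreover have "fps_exp 1 * inverse (fps_exp 1) = (1 :: complex fps)" by (simp add: inverse_mult_eq_1')
  moreover have "- ?s * ?t = (-1) powi delta c"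
  proof -
    have m: "- c = 1 \<longleftrightarrow> c = - 1" by (metis minus_minus)
    show ?thesis unfolding m by (auto simp: delta_def theta_def m)
  qed
  ultimately show ?thesis by simp
qed

lemma cset_inject: "cset A = cset B \<Longrightarrow> A = B"
  by (auto simp: cset_def times_eq_iff)

lemma cset_set_sum: "cset (set_sum A B) = set_sum (cset A) (cset B)"
proof
  show "cset (set_sum A B) \<subseteq> set_sum (cset A) (cset B)"
  proof
    fix v assume "v \<in> cset (set_sum A B)"
    then have "fst v \<in> set_sum A B" "snd v \<in> set_sum A B" by (auto simp: cset_def)
    then obtain a b a' b' where ab: "fst v = a + b" "snd v = a' + b'" "a \<in> A" "a' \<in> A" "b \<in> B" "b' \<in> B"
      by (auto simp: set_sum_def)
    have "v = (a, a') + (b, b')" using ab by (simp add: prod_eq_iff)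
    moreover have "(a, a') \<in> cset A" "(b, b') \<in> cset B" using ab by (auto simp: cset_def)
    ultimately show "v \<in> set_sum (cset A) (cset B)" using set_sumI by metis
  qed
  show "set_sum (cset A) (cset B) \<subseteq> cset (set_sum A B)"
    by (auto simp: cset_def elim!: set_sumE intro!: set_sumI)
qed

lemma set_sum_zero: "set_sum A {0} = A" "set_sum {0} A = A"
  for A :: "'b::ab_group_add set"
  by (auto simp: set_sum_def)

lemma set_sum_mono: "A \<subseteq> A' \<Longrightarrow> B \<subseteq> B' \<Longrightarrow> set_sum A B \<subseteq> set_sum A' B'"
  by (auto simp: set_sum_def)

lemma delta_1: "delta 1 = 0" and delta_m1: "delta (- 1) = 2"
  and delta_other: "c \<noteq> 1 \<Longrightarrow> c \<noteq> - 1 \<Longrightarrow> delta c = 1"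
  by (auto simp: delta_def theta_def minus_equation_iff)

lemma delta_bounds: "0 \<le> delta c" "delta c \<le> 2"
  by (auto simp: delta_def theta_def)

section \<open>The new filtrations\<close>

context steenbrink
begin

abbreviation "Ft \<equiv> tilde_F M F"
abbreviation "Wt \<equiv> tilde_W m M"
abbreviation "St \<equiv> tilde_S M S"

lemma spectrum_unit: "spectrum (cmap M) \<subseteq> {c. norm c = 1}"
  using norm_spectrum by blast

lemma tilde_F_eig_eq:
  assumes "0 < \<alpha>" "\<alpha> \<le> 1"
  shows "tilde_F_eig M F \<alpha> p = fop (phi (unit_exp \<alpha>)) ` (F (p - eps (unit_exp \<alpha>)) \<inter> E (unit_exp \<alpha>))"
proof -
  have a: "alpha (unit_exp \<alpha>) = \<alpha>" by (rule alpha_eqI[OF assms])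
  have an: "alpha (- unit_exp \<alpha>) = (if \<alpha> \<le> 1/2 then \<alpha> + 1/2 else \<alpha> - 1/2)"
    using alpha_neg[OF norm_unit_exp[of \<alpha>]] unfolding a .
  have e: "eigsp (tilde_M M) (- unit_exp \<alpha>) = E (unit_exp \<alpha>)" by (simp add: eigsp_tilde eigsp_eq)
  have i: "inv (GG N \<beta>) ` GG N \<alpha> ` A = fop (gamma_fps \<alpha> * inverse (gamma_fps \<beta>)) ` A" if "\<beta> > 0" for \<beta> A
    unfolding GG_eq inv_fps_op[OF nil_N gamma_fps_nz[OF that]] image_image fps_op_mult[OF nil_N, symmetric]
    by (simp only: mult.commute)
  show ?thesis
  proof (cases "\<alpha> \<le> 1/2")
    case True
    then have "tilde_F_eig M F \<alpha> p = inv (GG N (\<alpha> + 1/2)) ` GG N \<alpha> ` (F (p - 1) \<inter> E (unit_exp \<alpha>))"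
      unfolding tilde_F_eig_def Let_def e by (simp only: if_True)
    then show ?thesis using True assms i[of "\<alpha> + 1/2"] unfolding phi_def eps_def a an by simp
  next
    case False
    then have "tilde_F_eig M F \<alpha> p = inv (GG N (\<alpha> - 1/2)) ` GG N \<alpha> ` (F p \<inter> E (unit_exp \<alpha>))"
      unfolding tilde_F_eig_def Let_def e by (simp only: if_False)
    then show ?thesis using False assms i[of "\<alpha> - 1/2"] unfolding phi_def eps_def a an by simp
  qed
qed

abbreviation Fpiece :: "int \<Rightarrow> complex \<Rightarrow> 'a cplx set" where
  "Fpiece p c \<equiv> fop (phi c) ` (F (p - eps c) \<inter> E c)"

lemma Ft_span: "Ft p = cplx.span (\<Union>c\<in>{c. norm c = 1}. Fpiece p c)"
proof -
  have "(\<Union>\<alpha>\<in>{0<..1}. tilde_F_eig M F \<alpha> p) = (\<Union>c\<in>{c. norm c = 1}. Fpiece p c)"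
  proof (intro equalityI UN_least)
    fix \<alpha> :: real assume "\<alpha> \<in> {0<..1}"
    then have "tilde_F_eig M F \<alpha> p = Fpiece p (unit_exp \<alpha>)" by (intro tilde_F_eig_eq) auto
    then show "tilde_F_eig M F \<alpha> p \<subseteq> (\<Union>c\<in>{c. norm c = 1}. Fpiece p c)" using norm_unit_exp by blast
  next
    fix c :: complex assume "c \<in> {c. norm c = 1}"
    then have c: "norm c = 1" by simp
    have "tilde_F_eig M F (alpha c) p = Fpiece p c"
      using tilde_F_eig_eq[OF alpha(1,2)[OF c]] unfolding alpha(3)[OF c] .
    then show "Fpiece p c \<subseteq> (\<Union>\<alpha>\<in>{0<..1}. tilde_F_eig M F \<alpha> p)"
      using alpha(1,2)[OF c] by force
  qed
  then show ?thesis unfolding tilde_F_def by (rule arg_cong)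
qed

lemma subspace_fop_image: "cplx.subspace A \<Longrightarrow> cplx.subspace (fop f ` A)"
proof (rule cplx.subspaceI)
  assume A: "cplx.subspace A"
  show "0 \<in> fop f ` A" using cplx.subspace_0[OF A] clin_0[OF clin_fop] by (metis image_eqI)
  show "x + y \<in> fop f ` A" if xy: "x \<in> fop f ` A" "y \<in> fop f ` A" for x y
  proof -
    obtain a b where "x = fop f a" "a \<in> A" "y = fop f b" "b \<in> A" using xy by blast
    then show ?thesis using clin_add[OF clin_fop] cplx.subspace_add[OF A] by (metis image_eqI)
  qed
  show "cscale z x \<in> fop f ` A" if x: "x \<in> fop f ` A" for z x
  proof -
    obtain a where "x = fop f a" "a \<in> A" using x by blast
    then show ?thesis using clin_scale[OF clin_fop] cplx.subspace_scale[OF A] by (metis image_eqI)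
  qed
qed

lemma Fpiece_sub: "cplx.subspace (Fpiece p c)" "Fpiece p c \<subseteq> E c"
  by (intro subspace_fop_image cplx.subspace_inter F_sub subspace_gen) (auto intro: fop_E)

lemma gr_Ft: "gr (Ft p)" and Ft_E: "norm c = 1 \<Longrightarrow> Ft p \<inter> E c = Fpiece p c"
  using span_pieces_gen[where U = "{c. norm c = 1}" and A = "Fpiece p", OF Fpiece_sub spectrum_unit]
  unfolding Ft_span[symmetric] by auto

lemma Ft_filt: "decreasing_filtration UNIV Ft"
  unfolding decreasing_filtration_def
proof (intro conjI allI impI)
  show "cplx.subspace (Ft p)" for p by (rule graded_subspace[OF gr_Ft])
  show "Ft p \<subseteq> cset UNIV" for p by (simp add: cset_def)
  have le: "Ft q \<subseteq> Ft p" if "p \<le> q" for p q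
    unfolding Ft_span
  proof (rule cplx.span_mono, rule UN_mono)
    fix c
    show "Fpiece q c \<subseteq> Fpiece p c" using F_mono[of "p - eps c" "q - eps c"] that by auto
  qed simp
  then show "\<And>p q. p \<le> q \<Longrightarrow> Ft q \<subseteq> Ft p" .
  have eps: "0 \<le> eps c" "eps c \<le> 1" for c by (auto simp: eps_def)
  obtain pa where pa: "F pa = {0}" using F_ends(1) by (rule exE)
  obtain pb where pb: "F pb = UNIV" using F_ends(2) by (rule exE)
  have "Ft (pa + 1) = {0}"
  proof (rule graded_eqI'[OF gr_Ft])
    show "gr {0}" by (simp add: graded_def clin_0[OF clin_eig_part])
    fix c assume "c \<in> spectrum (cmap M)"
    then have c: "norm c = 1" by (rule norm_spectrum)
    have "F (pa + 1 - eps c) \<subseteq> {0}" using F_mono[of pa "pa + 1 - eps c"] eps[of c] pa by auto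
    then have "F (pa + 1 - eps c) \<inter> E c = {0}" using cplx.subspace_0[OF F_sub] zero_in_gen by blast
    then show "Ft (pa + 1) \<inter> E c = {0} \<inter> E c"
      unfolding Ft_E[OF c] using zero_in_gen by (simp add: clin_0[OF clin_fop])
  qed
  then show "\<exists>p. Ft p = {0}" by blast
  have "Ft pb = UNIV"
  proof (rule graded_eqI'[OF gr_Ft])
    show "gr UNIV" by (simp add: graded_def cplx.subspace_UNIV)
    fix c assume "c \<in> spectrum (cmap M)"
    then have c: "norm c = 1" by (rule norm_spectrum)
    have "F (pb - eps c) = UNIV" using F_mono[of "pb - eps c" pb] eps[of c] pb by auto
    then have "Ft pb \<inter> E c = fop (phi c) ` E c" unfolding Ft_E[OF c] by simp
    also have "\<dots> = E c"
    proof
      show "E c \<subseteq> fop (phi c) ` E c"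
      proof
        fix v assume "v \<in> E c"
        then have "fop (inverse (phi c)) v \<in> E c" by (rule fop_E)
        moreover have "v = fop (phi c) (fop (inverse (phi c)) v)"
          using fps_op_inverse(1)[OF nil_N phi_nz[OF c]] by simp
        ultimately show "v \<in> fop (phi c) ` E c" by blast
      qed
    qed (auto intro: fop_E)
    finally show "Ft pb \<inter> E c = UNIV \<inter> E c" by simp
  qed
  then show "\<exists>p. Ft p = cset UNIV" unfolding cset_def by auto
qed

lemma N_Ft: "v \<in> Ft p \<Longrightarrow> cmap N v \<in> Ft (p - 1)"
proof -
  assume v: "v \<in> Ft p"
  have "cmap N (P c v) \<in> Ft (p - 1)" if "c \<in> spectrum (cmap M)" for c
  proof -
    have c: "norm c = 1" using that by (rule norm_spectrum)
    have "P c v \<in> Fpiece p c" using graded_part_Int[OF gr_Ft v, of c] unfolding Ft_E[OF c] .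
    then obtain a where a: "P c v = fop (phi c) a" "a \<in> F (p - eps c)" "a \<in> E c" by auto
    have "cmap N (P c v) = fop (phi c) (cmap N a)"
      unfolding a(1) by (rule fps_op_commute[OF clin_N]) simp
    moreover have "p - eps c - 1 = p - 1 - eps c" by simp
    ultimately have "cmap N (P c v) \<in> Fpiece (p - 1) c"
      using N_F[OF a(2)] N_gen[OF a(3)] by (metis IntI image_eqI)
    then show ?thesis using Ft_E[OF c] by blast
  qed
  then have "(\<Sum>c\<in>spectrum (cmap M). cmap N (P c v)) \<in> Ft (p - 1)"
    by (rule cplx.subspace_sum[OF graded_subspace[OF gr_Ft]])
  then show ?thesis by (simp add: eig_part_sum flip: clin_sum[OF clin_N])
qed

lemma single_cnj: "c \<in> {1} \<Longrightarrow> cnj c \<in> {1 :: complex}" "c \<in> {-1} \<Longrightarrow> cnj c \<in> {-1 :: complex}"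
  "c \<in> - {1, -1} \<Longrightarrow> cnj c \<in> - {1, -1 :: complex}" "c \<in> - {-1} \<Longrightarrow> cnj c \<in> - {-1 :: complex}"
  using complex_cnj_cancel_iff[of c "-1"] by (auto simp: complex_eq_iff)

lemma subspace_rD: "subspace (real_points (D C))"
  by (rule real_points_direct[OF graded_subspace[OF graded_direct_part]])

lemma D_mono: "C \<subseteq> C' \<Longrightarrow> D C \<subseteq> D C'"
  by (auto simp: direct_part_def)

lemma weight_D:
  assumes C: "\<And>d. d \<in> C \<Longrightarrow> cnj d \<in> C" and sub: "C \<subseteq> block_set c"
  shows "is_weight_filtration (real_points (D C)) N (w0 c) (\<lambda>k. W k \<inter> real_points (D C))"
proof -
  let ?V = "real_points (D C)"
  have le: "?V \<subseteq> V c" using D_mono[OF sub] by (auto simp: real_points_def)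
  have gV: "gr (cset (W k \<inter> V c))" for k
    unfolding cset_Int cset_V by (intro graded_Int gr_W graded_direct_part)
  have "is_weight_filtration ?V N (w0 c) (\<lambda>k. (W k \<inter> V c) \<inter> ?V)"
  proof (rule weight_filtration_restrict[OF block_weight linear_N subspace_rD le linear_real_block_proj[OF C]])
    show "real_block_proj C x \<in> ?V" for x by (rule real_block_proj_in[OF C])
    show "real_block_proj C x = x" if "x \<in> ?V" for x by (rule real_block_proj_id[OF C that])
    show "real_block_proj C (N x) = N (real_block_proj C x)" for x by (rule real_block_proj_N[OF C])
    show "real_block_proj C x \<in> W k \<inter> V c" if "x \<in> W k \<inter> V c" for k x
      by (rule real_block_proj_W[OF _ gV that], rule C, assumption, intro IntI subspace_0 W_sub subspace_rD)
  qed
  moreover have "(W k \<inter> V c) \<inter> ?V = W k \<inter> ?V" for k using le by blast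
  ultimately show ?thesis by simp
qed

text \<open>
  The real subspaces for the eigenvalue \<open>1\<close>, for those other than \<open>\<plusminus> 1\<close>, for \<open>- 1\<close>, and for all other than
  \<open>- 1\<close>. The last two are \<open>H\<^sub>1\<close> and \<open>H\<^sub>\<noteq>\<^sub>1\<close> of \<open>- M\<close>; the weights of the first three shift by \<open>0\<close>, \<open>1\<close> and \<open>2\<close>.
\<close>

abbreviation "V1 \<equiv> real_points (D {1})"
abbreviation "Vo \<equiv> real_points (D (- {1, -1}))"
abbreviation "Vm \<equiv> real_points (D {-1})"
abbreviation "Vt \<equiv> real_points (D (- {-1}))"

lemma cV: "cset V1 = D {1}" "cset Vo = D (- {1, -1})" "cset Vm = D {-1}" "cset Vt = D (- {-1})"
  by (rule cset_D; rule single_cnj; assumption)+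

lemma weight_m: "is_weight_filtration Vm N (m + 2) (\<lambda>k. W (k - 2) \<inter> Vm)"
  using weight_filtration_shift[OF weight_D[of "{-1}" "-1"], of 2]
  by (simp add: block_set_def w0_def theta_def single_cnj)

lemma D_set_sum: "set_sum (D {1}) (D (- {1, -1})) = D (- {-1})"
proof (rule graded_eqI)
  show "gr (set_sum (D {1}) (D (- {1, -1})))" by (intro graded_set_sum graded_direct_part)
  show "gr (D (- {-1}))" by (rule graded_direct_part)
  show "set_sum (D {1}) (D (- {1, -1})) \<inter> E c = D (- {-1}) \<inter> E c" for c
    by (auto simp: set_sum_gen graded_direct_part direct_part_gen set_sum_zero)
qed

lemma Vt_sum: "set_sum V1 Vo = Vt"
  by (rule cset_inject) (simp only: cset_set_sum cV D_set_sum)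

text \<open>
  Apart from the eigenvalue \<open>1\<close>, whose weight \<open>m + 1\<close> is kept, the eigenvalues of \<open>M\<close> other than \<open>- 1\<close> move
  from weight \<open>m\<close> to weight \<open>m + 1\<close>.
\<close>

lemma weight_t: "is_weight_filtration Vt N (m + 1) (\<lambda>k. set_sum (W k \<inter> V1) (W (k - 1) \<inter> Vo))"
  unfolding Vt_sum[symmetric]
proof (rule weight_filtration_sum[OF _ _ linear_N])
  have "is_weight_filtration V1 N (w0 1) (\<lambda>k. W k \<inter> V1)"
    by (rule weight_D) (auto simp: block_set_def)
  then show "is_weight_filtration V1 N (m + 1) (\<lambda>k. W k \<inter> V1)" by (simp add: w0_def theta_def)
  have "is_weight_filtration Vo N (w0 (-1)) (\<lambda>k. W k \<inter> Vo)"
    by (rule weight_D[OF single_cnj(3)]) (auto simp: block_set_def)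
  from weight_filtration_shift[OF this, of 1]
  show "is_weight_filtration Vo N (m + 1) (\<lambda>k. W (k - 1) \<inter> Vo)" by (simp add: w0_def theta_def)
  show "V1 \<inter> Vo = {0}"
  proof -
    have "x = 0" if "x \<in> V1" "x \<in> Vo" for x
    proof -
      have "P c (x, 0) = P c 0" for c
        using that by (cases "c = 1") (simp_all add: real_points_def direct_part_iff clin_0[OF clin_eig_part])
      then have "(x, 0) = (0 :: 'a cplx)" by (rule P_ext)
      then show ?thesis by (simp add: zero_prod_def)
    qed
    then show ?thesis using subspace_0[OF subspace_rD] by blast
  qed
qed

lemma eigsp_ne1_tilde: "eigsp_ne1 (tilde_M M) = D (- {-1})"
  and eigsp_1_tilde: "eigsp (tilde_M M) 1 = D {-1}"
proof -
  interpret t: automorphism "tilde_M M" by (rule automorphism_tilde)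
  have "uminus ` (- {1 :: complex}) = - {-1}"
    by (simp add: bij_image_Compl_eq bij_uminus)
  then show "eigsp_ne1 (tilde_M M) = D (- {-1})" unfolding t.eigsp_ne1_D direct_part_tilde by simp
  show "eigsp (tilde_M M) 1 = D {-1}" by (simp add: eigsp_tilde eigsp_D)
qed

lemma Wt_eq: "Wt k = set_sum (set_sum (W k \<inter> V1) (W (k - 1) \<inter> Vo)) (W (k - 2) \<inter> Vm)"
  unfolding tilde_W_def eigsp_ne1_tilde eigsp_1_tilde
    weight_filtration_eqI[OF weight_t] weight_filtration_eqI[OF weight_m] ..

lemma cWt_eq: "cset (Wt k) = set_sum (set_sum (cset (W k) \<inter> D {1}) (cset (W (k - 1)) \<inter> D (- {1, -1}))) (cset (W (k - 2)) \<inter> D {-1})"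
  unfolding Wt_eq cset_set_sum cset_Int cV ..

lemma gr_Wt: "gr (cset (Wt k))"
  unfolding cWt_eq by (intro graded_set_sum graded_Int gr_W graded_direct_part)

lemma cW_0: "0 \<in> cset (W k)"
  by (rule cplx.subspace_0[OF cW_sub])

lemma Wt_E: "cset (Wt k) \<inter> E c = cset (W (k - delta c)) \<inter> E c"
proof -
  have "cset (Wt k) \<inter> E c = set_sum (set_sum (cset (W k) \<inter> (D {1} \<inter> E c)) (cset (W (k - 1)) \<inter> (D (- {1, -1}) \<inter> E c))) (cset (W (k - 2)) \<inter> (D {-1} \<inter> E c))"
    unfolding cWt_eq
    by (simp add: set_sum_gen graded_set_sum graded_Int gr_W graded_direct_part Int_assoc)
  moreover have z: "cset (W k) \<inter> {0} = {0}" for k using cW_0 by blast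
  ultimately show ?thesis
    by (cases "c = 1"; cases "c = -1")
       (simp_all add: direct_part_gen z set_sum_zero delta_1 delta_m1 delta_other)
qed

lemma Wt_Vt: "Wt k \<inter> Vt = set_sum (W k \<inter> V1) (W (k - 1) \<inter> Vo)"
proof (rule cset_inject, rule graded_eqI)
  show "gr (cset (Wt k \<inter> Vt))" unfolding cset_Int cV by (intro graded_Int gr_Wt graded_direct_part)
  show "gr (cset (set_sum (W k \<inter> V1) (W (k - 1) \<inter> Vo)))"
    unfolding cset_set_sum cset_Int cV by (intro graded_set_sum graded_Int gr_W graded_direct_part)
  fix c
  have z: "cset (W k) \<inter> {0} = {0}" for k using cW_0 by blast
  have "cset (Wt k \<inter> Vt) \<inter> E c = (cset (Wt k) \<inter> E c) \<inter> (D (- {-1}) \<inter> E c)"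
    unfolding cset_Int cV by blast
  also have "\<dots> = set_sum (cset (W k) \<inter> (D {1} \<inter> E c)) (cset (W (k - 1)) \<inter> (D (- {1, -1}) \<inter> E c))"
    unfolding Wt_E using cW_0 zero_in_gen
    by (cases "c = 1"; cases "c = -1")
       (auto simp: direct_part_gen z set_sum_zero delta_1 delta_m1 delta_other)
  also have "\<dots> = cset (set_sum (W k \<inter> V1) (W (k - 1) \<inter> Vo)) \<inter> E c"
    unfolding cset_set_sum cset_Int cV
    by (simp add: set_sum_gen graded_Int gr_W graded_direct_part Int_assoc)
  finally show "cset (Wt k \<inter> Vt) \<inter> E c = cset (set_sum (W k \<inter> V1) (W (k - 1) \<inter> Vo)) \<inter> E c" .
qed

lemma Wt_Vm: "Wt k \<inter> Vm = W (k - 2) \<inter> Vm"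
proof (rule cset_inject, rule graded_eqI)
  show "gr (cset (Wt k \<inter> Vm))" "gr (cset (W (k - 2) \<inter> Vm))"
    unfolding cset_Int cV by (intro graded_Int gr_Wt gr_W graded_direct_part)+
  fix c
  have "cset (Wt k \<inter> Vm) \<inter> E c = (cset (Wt k) \<inter> E c) \<inter> (D {-1} \<inter> E c)"
    unfolding cset_Int cV by blast
  also have "\<dots> = cset (W (k - 2)) \<inter> (D {-1} \<inter> E c)"
    unfolding Wt_E using cW_0 zero_in_gen by (cases "c = -1") (auto simp: direct_part_gen delta_m1)
  finally show "cset (Wt k \<inter> Vm) \<inter> E c = cset (W (k - 2) \<inter> Vm) \<inter> E c"
    unfolding cset_Int cV by blast
qed

lemma weight_Vt: "is_weight_filtration Vt N (m + 1) (\<lambda>k. Wt k \<inter> Vt)"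
  and weight_Vm: "is_weight_filtration Vm N (m + 2) (\<lambda>k. Wt k \<inter> Vm)"
  using weight_t weight_m by (simp_all only: Wt_Vt Wt_Vm)

lemma Wt_sub: "subspace (Wt k)"
  unfolding Wt_eq by (intro subspace_set_sum subspace_inter W_sub subspace_rD)

lemma cWt_sub: "cplx.subspace (cset (Wt k))"
  by (rule subspace_cset[OF Wt_sub])

lemma Wt_mono: "j \<le> k \<Longrightarrow> Wt j \<subseteq> Wt k"
  unfolding Wt_eq using W_mono[of j k] W_mono[of "j - 1" "k - 1"] W_mono[of "j - 2" "k - 2"]
  by (intro set_sum_mono) auto

lemma Wt_filt: "increasing_filtration UNIV Wt"
  unfolding increasing_filtration_def
proof (intro conjI allI impI)
  obtain ka where ka: "W ka = {0}" using W_ends(1) by (rule exE)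
  obtain kb where kb: "W kb = UNIV" using W_ends(2) by (rule exE)
  have 0: "W (ka - 1) = {0}" "W (ka - 2) = {0}"
    using W_mono[of "ka - 1" ka] W_mono[of "ka - 2" ka] ka subspace_0[OF W_sub] by auto
  have z: "{0} \<inter> real_points (D C) = {0}" for C using subspace_0[OF subspace_rD] by blast
  have "Wt ka = {0}" unfolding Wt_eq ka 0 z set_sum_zero ..
  then show "\<exists>k. Wt k = {0}" by blast
  have "cset (Wt (kb + 2)) = UNIV"
  proof (rule graded_eqI[OF gr_Wt])
    show "gr UNIV" by (simp add: graded_def cplx.subspace_UNIV)
    fix c
    have "W (kb + 2 - delta c) = UNIV"
      using W_mono[of kb "kb + 2 - delta c"] delta_bounds(2)[of c] kb by auto
    then show "cset (Wt (kb + 2)) \<inter> E c = UNIV \<inter> E c" unfolding Wt_E by (simp add: cset_def)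
  qed
  moreover have "cset (UNIV :: 'a set) = UNIV" by (simp add: cset_def)
  ultimately have "cset (Wt (kb + 2)) = cset UNIV" by (rule trans[OF _ sym])
  then have "Wt (kb + 2) = UNIV" by (rule cset_inject)
  then show "\<exists>k. Wt k = UNIV" by blast
qed (simp_all add: Wt_sub Wt_mono)

lemma N_cWt: "v \<in> cset (Wt k) \<Longrightarrow> cmap N v \<in> cset (Wt (k - 2))"
proof -
  assume v: "v \<in> cset (Wt k)"
  have "cmap N (P c v) \<in> cset (Wt (k - 2))" for c
  proof -
    have "P c v \<in> cset (Wt k) \<inter> E c" by (rule graded_part_Int[OF gr_Wt v])
    then have "P c v \<in> cset (W (k - delta c)) \<inter> E c" unfolding Wt_E .
    then have "cmap N (P c v) \<in> cset (W (k - delta c - 2)) \<inter> E c" using N_cW N_gen by blast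
    moreover have "k - delta c - 2 = k - 2 - delta c" by simp
    ultimately have "cmap N (P c v) \<in> cset (Wt (k - 2)) \<inter> E c" unfolding Wt_E by simp
    then show ?thesis by simp
  qed
  then have "(\<Sum>c\<in>spectrum (cmap M). cmap N (P c v)) \<in> cset (Wt (k - 2))"
    by (rule cplx.subspace_sum[OF cWt_sub])
  then show ?thesis by (simp add: eig_part_sum flip: clin_sum[OF clin_N])
qed

lemma blk_Wt: "v \<in> cset (Wt k) \<Longrightarrow> blk g v \<in> cset (Wt k)"
proof (rule graded_blk[OF gr_Wt])
  show "cmap N v \<in> cset (Wt k)" if "v \<in> cset (Wt k)" for v
    using N_cWt[OF that] Wt_mono[of "k - 2" k] by (auto simp: cset_def)
qed

lemma M_Wt: "tilde_M M ` Wt k = Wt k"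
proof -
  \<comment> \<open>\<open>0\<close> is not an eigenvalue; the value \<open>1\<close> there makes every series of the family invertible\<close>
  let ?g = "\<lambda>c :: complex. if c = 0 then 1 else fps_const c * fps_exp 1"
  have "cmap M = blk ?g"
  proof (rule eq_on_eigen[OF clinT clin_blk])
    fix c v assume v: "v \<in> E c"
    show "cmap M v = blk ?g v"
    proof (cases "c = 0")
      case True
      then have "v = 0" using v gen_eig_0 by simp
      then show ?thesis by (simp add: clin_0[OF clinT] clin_0[OF clin_blk])
    qed (simp add: blk_on[OF v] M_on[OF v])
  qed
  then have M': "cmap M v = blk ?g v" for v by simp
  have g0: "fps_nth (?g c) 0 \<noteq> 0" for c
    by (cases "c = 0") (simp_all add: fps_mult_nth_0)
  have fwd: "M x \<in> Wt k" if "x \<in> Wt k" for x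
  proof -
    have "cmap M (x, 0) \<in> cset (Wt k)" unfolding M'
      by (rule blk_Wt) (use that subspace_0[OF Wt_sub] in \<open>simp add: cset_def\<close>)
    then show ?thesis by (simp add: cmap_def cset_def)
  qed
  have bwd: "\<exists>y\<in>Wt k. M y = x" if "x \<in> Wt k" for x
  proof -
    let ?w = "blk (\<lambda>c. inverse (?g c)) (x, 0)"
    have "?w \<in> cset (Wt k)"
      by (rule blk_Wt) (use that subspace_0[OF Wt_sub] in \<open>simp add: cset_def\<close>)
    moreover have "cmap M ?w = (x, 0)" unfolding M' by (rule blk_inverse(1)[OF g0])
    ultimately show ?thesis by (auto simp: cset_def cmap_def mem_Times_iff intro!: bexI[of _ "fst ?w"])
  qed
  show ?thesis
  proof
    show "tilde_M M ` Wt k \<subseteq> Wt k" using fwd subspace_neg[OF Wt_sub] by (auto simp: tilde_M_def)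
    show "Wt k \<subseteq> tilde_M M ` Wt k"
    proof
      fix x assume "x \<in> Wt k"
      then obtain y where "y \<in> Wt k" "M y = - x" using bwd subspace_neg[OF Wt_sub] by blast
      then show "x \<in> tilde_M M ` Wt k" by (auto simp: tilde_M_def intro!: image_eqI[of _ _ y])
    qed
  qed
qed

text \<open>
  On the graded pieces of the weight filtration, \<open>N\<close> vanishes and the new Hodge filtration is the old
  one with shifted indices.
\<close>

lemma F_Gr_piece:
  assumes c: "norm c = 1"
  shows "set_sum (Ft p \<inter> cset (Wt k) \<inter> E c) (cset (Wt (k - 1)) \<inter> E c)
       = set_sum (F (p - eps c) \<inter> cset (W (k - delta c)) \<inter> E c) (cset (W (k - 1 - delta c)) \<inter> E c)"
proof -
  let ?B = "cset (W (k - delta c)) \<inter> E c" and ?B' = "cset (W (k - 1 - delta c)) \<inter> E c"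
  have s: "cplx.subspace (F (p - eps c) \<inter> E c)" "cplx.subspace ?B" "cplx.subspace ?B'"
    by (intro cplx.subspace_inter F_sub cW_sub subspace_gen)+
  have "Ft p \<inter> cset (Wt k) \<inter> E c = (Ft p \<inter> E c) \<inter> (cset (Wt k) \<inter> E c)" by blast
  then have "set_sum (Ft p \<inter> cset (Wt k) \<inter> E c) (cset (Wt (k - 1)) \<inter> E c)
      = set_sum (fop (phi c) ` (F (p - eps c) \<inter> E c) \<inter> ?B) ?B'"
    unfolding Wt_E Ft_E[OF c] by simp
  also have "\<dots> = set_sum (F (p - eps c) \<inter> E c \<inter> ?B) ?B'"
  proof (rule set_sum_unit[OF s _ _ phi_nz[OF c]])
    show "?B' \<subseteq> ?B" using cW_mono[of "k - 1 - delta c" "k - delta c"] by auto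
    show "cmap N v \<in> ?B'" if "v \<in> ?B" for v
      using that N_cW[of v "k - delta c"] N_gen[of v c] cW_mono[of "k - delta c - 2" "k - 1 - delta c"] by auto
  qed
  also have "F (p - eps c) \<inter> E c \<inter> ?B = F (p - eps c) \<inter> cset (W (k - delta c)) \<inter> E c" by blast
  finally show ?thesis .
qed

lemma F_Gr_E:
  assumes c: "norm c = 1"
  shows "F_Gr Ft Wt k p \<inter> E c = F_Gr F W (k - delta c) (p - eps c) \<inter> E c"
proof -
  have 1: "F_Gr Ft Wt k p \<inter> E c = set_sum (Ft p \<inter> cset (Wt k) \<inter> E c) (cset (Wt (k - 1)) \<inter> E c)"
    unfolding F_Gr_def by (intro set_sum_gen graded_Int gr_Ft gr_Wt)
  have e: "k - 1 - delta c = k - delta c - 1" by simp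
  have 2: "F_Gr F W (k - delta c) (p - eps c) \<inter> E c = set_sum (F (p - eps c) \<inter> cset (W (k - delta c)) \<inter> E c) (cset (W (k - 1 - delta c)) \<inter> E c)"
    unfolding F_Gr_def e by (intro set_sum_gen graded_Int gr_F gr_W)
  show ?thesis unfolding 1 2 by (rule F_Gr_piece[OF c])
qed

lemma gr_F_Gr_t: "gr (F_Gr Ft Wt k p)"
  unfolding F_Gr_def by (intro graded_set_sum graded_Int gr_Ft gr_Wt)

text \<open>
  Conjugation maps the eigenspace of \<open>c\<close> to that of \<open>cnj c\<close>. Because \<open>eps c + eps (cnj c) = delta c\<close>, the
  two opposed filtrations are those of the old structure in weight \<open>k - delta c\<close>.
\<close>

lemma hodge_t: "pure_hodge_quotient k (cset (Wt k)) (cset (Wt (k - 1))) (F_Gr Ft Wt k)"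
  unfolding pure_hodge_quotient_def
proof (intro allI conjI)
  fix p
  let ?A = "F_Gr Ft Wt k p" and ?B = "cj ` F_Gr Ft Wt k (k + 1 - p)"
  have g: "gr ?A" "gr ?B" by (rule gr_F_Gr_t, rule gr_cj[OF gr_F_Gr_t])
  have key: "set_sum ?A ?B \<inter> E c = cset (Wt k) \<inter> E c \<and> ?A \<inter> ?B \<inter> E c = cset (Wt (k - 1)) \<inter> E c"
    if "c \<in> spectrum (cmap M)" for c
  proof -
    have c: "norm c = 1" and c': "norm (cnj c) = 1" using norm_spectrum[OF that] by simp_all
    let ?k = "k - delta c"
    have dc: "delta (cnj c) = delta c" using eps_cnj[OF c] eps_cnj[OF c'] by simp
    have ix: "k + 1 - p - eps (cnj c) = ?k + 1 - (p - eps c)" using eps_cnj[OF c] by simp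
    let ?A' = "F_Gr F W ?k (p - eps c)" and ?B' = "cj ` F_Gr F W ?k (?k + 1 - (p - eps c))"
    have g': "gr ?A'" "gr ?B'" by (rule gr_F_Gr, rule gr_cj[OF gr_F_Gr])
    have A: "?A \<inter> E c = ?A' \<inter> E c" by (rule F_Gr_E[OF c])
    have B: "?B \<inter> E c = ?B' \<inter> E c"
      unfolding cj_Int_gen F_Gr_E[OF c'] dc ix ..
    have h: "set_sum ?A' ?B' = cset (W ?k)" "?A' \<inter> ?B' = cset (W (?k - 1))"
      using hodge[of ?k] by (simp_all add: pure_hodge_quotient_def)
    have e: "k - 1 - delta c = ?k - 1" by simp
    have "set_sum ?A ?B \<inter> E c = set_sum ?A' ?B' \<inter> E c"
      unfolding set_sum_gen[OF g] set_sum_gen[OF g'] A B ..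
    moreover have "?A \<inter> ?B \<inter> E c = ?A' \<inter> ?B' \<inter> E c" using A B by blast
    ultimately show ?thesis unfolding Wt_E h e by simp
  qed
  show "set_sum ?A ?B = cset (Wt k)"
    by (rule graded_eqI'[OF graded_set_sum[OF g] gr_Wt]) (use key in blast)
  show "?A \<inter> ?B = cset (Wt (k - 1))"
    by (rule graded_eqI'[OF graded_Int[OF g] gr_Wt]) (use key in blast)
qed

lemma mhs_t: "mhs UNIV Ft Wt"
  unfolding mhs_def using Ft_filt Wt_filt hodge_t by simp

lemma ss_Ft: "cmap (semisimple_part (tilde_M M)) ` Ft p \<subseteq> Ft p"
proof
  fix x assume "x \<in> cmap (semisimple_part (tilde_M M)) ` Ft p"
  then obtain v where v: "v \<in> Ft p" "x = cmap (\<lambda>y. - semisimple_part M y) v"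
    unfolding semisimple_part_tilde by blast
  have "x = - cmap (semisimple_part M) v" using v(2) by (simp add: cmap_def)
  then have x: "x = - ss_cplx v" using fun_cong[OF cmap_semisimple_part, of v] by simp
  have "ss_cplx v = (\<Sum>c\<in>spectrum (cmap M). ss_cplx (P c v))"
    by (simp add: eig_part_sum flip: clin_sum[OF clin_ss])
  also have "\<dots> \<in> Ft p"
  proof (rule cplx.subspace_sum[OF graded_subspace[OF gr_Ft]])
    fix c
    have "ss_cplx (P c v) = cscale c (P c v)" by (rule ss_cplx_on[OF eig_part_in])
    then show "ss_cplx (P c v) \<in> Ft p"
      using cplx.subspace_scale[OF graded_subspace[OF gr_Ft] graded_part[OF gr_Ft v(1)]] by simp
  qed
  finally show "x \<in> Ft p" unfolding x by (rule cplx.subspace_neg[OF graded_subspace[OF gr_Ft]])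
qed

lemma steenbrink_mhs_t: "steenbrink_mhs (m + 1) Ft Wt (tilde_M M)"
proof -
  interpret t: automorphism "tilde_M M" by (rule automorphism_tilde)
  have "m + 1 + 1 = m + 2" by simp
  then show ?thesis
    unfolding steenbrink_mhs_def N_tilde eigsp_ne1_tilde eigsp_1_tilde
    using mhs_t t.linM t.bijM M_Wt ss_Ft N_Ft weight_Vt weight_Vm
    by (auto simp only: image_subset_iff simp_thms)
qed

end

section \<open>The new form\<close>

context automorphism
begin

lemma blk_tilde: "automorphism.blk (tilde_M M) g = blk (\<lambda>c. g (- c))"
proof -
  interpret t: automorphism "tilde_M M" by (rule automorphism_tilde)
  show ?thesis
  proof (rule eq_on_eigen[OF t.clin_blk clin_blk])
    fix c v assume v: "v \<in> E c"
    then have "v \<in> gen_eig (cmap (tilde_M M)) (- c)" by (simp add: gen_eig_tilde)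
    then show "t.blk g v = blk (\<lambda>c. g (- c)) v" using v by (simp add: t.blk_on blk_on N_tilde)
  qed
qed

definition form_op :: "'a \<Rightarrow> 'a" where "form_op = re_op (blk rho)"

lemma linear_form_op: "linear form_op" and cmap_form_op: "cmap form_op = blk rho"
  unfolding form_op_def by (rule linear_re_op cmap_re_op; rule clin_blk blk_cj; rule rho_cnj)+

lemma bij_form_op: "bij form_op"
proof (rule bij_cmap)
  show "bij (cmap form_op)" unfolding cmap_form_op
    by (rule o_bij[of "blk (\<lambda>c. inverse (rho c))"]) (simp_all add: fun_eq_iff blk_inverse rho_nz)
qed

lemma form_op_M: "form_op (M x) = M (form_op x)"
proof -
  have "cmap form_op (cmap M (x, 0)) = cmap M (cmap form_op (x, 0))"
    unfolding cmap_form_op blk_M by (rule blk_swap)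
  then show ?thesis by (simp add: cmap_def)
qed

text \<open>
  The new form is \<open>S(a, \<kappa> \<nu>' b)\<close> with \<open>\<nu>'\<close> the operator \<open>\<nu>\<close> of \<open>- M\<close>, whose inverse acts on the eigenspace of
  \<open>c\<close> by \<open>seifert_fps (- c)\<close>.
\<close>

lemma tilde_S_eq: "tilde_S M S a b = S a (form_op b)"
proof -
  interpret t: automorphism "tilde_M M" by (rule automorphism_tilde)
  have "cmap form_op (cmap t.kappa v) = cmap kappa v" for v
  proof -
    have "cmap form_op (cmap t.kappa v) = blk (\<lambda>c. rho c * seifert_fps (- c)) v"
      unfolding cmap_form_op t.cmap_kappa blk_tilde blk_mult ..
    moreover have "rho c * seifert_fps (- c) = seifert_fps c" for c
      by (simp add: rho_def mult.assoc inverse_mult_eq_1 seifert_fps_0_nz)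
    ultimately show ?thesis unfolding cmap_kappa by simp
  qed
  from this[of "(x, 0)" for x] have k: "form_op (t.kappa x) = kappa x" for x by (simp add: cmap_def)
  have "tilde_S M S a b = S a (kappa (nu N (tilde_M M) b))"
    by (simp add: tilde_S_def seifert_eq)
  also have "nu N (tilde_M M) = inv t.kappa" using t.nu_eq by (simp add: N_tilde)
  also have "kappa (inv t.kappa b) = form_op b"
    unfolding k[symmetric] by (simp add: surj_f_inv_f[OF bij_is_surj[OF t.bij_kappa]])
  finally show ?thesis .
qed

end

lemma power_int_m1_mult: "(-1) powi a * (-1) powi (a :: int) = (1 :: complex)"
  by (cases "even a") (auto simp: power_int_minus_left)

text \<open>
  For \<open>d = cnj c\<close> other than \<open>\<plusminus> 1\<close> the constant term is \<open>(1 - d)/(1 + d) = - 2i Im d / |1 + d|\<^sup>2\<close>. The sign of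
  \<open>Im d = sin (2\<pi> alpha c)\<close> decides between \<open>eps c = 1\<close> and \<open>eps c = 0\<close>.
\<close>

lemma rho_sign:
  assumes c: "norm c = 1"
  shows "\<exists>t>0. \<i> powi (2 * eps c - delta c) * fps_nth (rho (cnj c)) 0 = of_real t"
proof -
  consider "c = 1" | "c = - 1" | "c \<noteq> 1" "c \<noteq> - 1" by blast
  then show ?thesis
  proof cases
    case 1
    then show ?thesis
      by (intro exI[of _ "1/2"]) (simp add: eps_def alpha_1 delta_1 rho_def seifert_fps_0)
  next
    case 2
    then show ?thesis
      by (intro exI[of _ 2]) (simp add: eps_def alpha_m1 delta_m1 rho_def seifert_fps_0)
  next
    case 3
    let ?d = "cnj c"
    have d: "?d \<noteq> 1" "?d \<noteq> - 1" "- ?d \<noteq> 1"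
      using 3 complex_cnj_cancel_iff[of c 1] complex_cnj_cancel_iff[of c "-1"] by (auto simp: minus_equation_iff)
    have n0: "1 + ?d \<noteq> 0" using d by (metis add_eq_0_iff)
    have n: "(norm (1 + ?d))\<^sup>2 > 0" using n0 by simp
    have "?d * c = 1" using c by (metis complex_norm_square mult.commute of_real_1 power_one)
    then have "(1 - ?d) * cnj (1 + ?d) = - 2 * \<i> * of_real (Im ?d)"
      by (simp add: algebra_simps complex_eq_iff)
    moreover have "(1 + ?d) * cnj (1 + ?d) = of_real ((norm (1 + ?d))\<^sup>2)"
      by (metis complex_norm_square)
    ultimately have q: "(1 - ?d) / (1 + ?d) = - 2 * \<i> * of_real (Im ?d) / of_real ((norm (1 + ?d))\<^sup>2)"
      by (metis mult_divide_mult_cancel_right complex_cnj_zero_iff n0)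
    have "fps_nth (rho ?d) 0 = (?d - 1) / (- ?d - 1)"
      using d by (simp add: rho_def seifert_fps_0 divide_inverse)
    also have "\<dots> = (1 - ?d) / (1 + ?d)"
    proof -
      have "?d - 1 = - (1 - ?d)" "- ?d - 1 = - (1 + ?d)" by simp_all
      then show ?thesis by (simp only: minus_divide_divide)
    qed
    finally have r: "fps_nth (rho ?d) 0 = - 2 * \<i> * of_real (Im ?d) / of_real ((norm (1 + ?d))\<^sup>2)"
      using q by simp
    have im: "Im ?d = sin (2 * pi * alpha c)"
    proof -
      have "Im (unit_exp (alpha c)) = - sin (2 * pi * alpha c)" by (simp add: Im_exp)
      then show ?thesis using alpha(3)[OF c] by simp
    qed
    have a: "0 < alpha c" "alpha c < 1" "alpha c \<noteq> 1/2"
      using alpha[OF c] alpha_eq_1[OF c] alpha_eq_half[OF c] 3 by auto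
    have g: "\<i> * (- 2 * \<i> * of_real y / of_real n) = of_real (2 * y / n)"
      "inverse \<i> * (- 2 * \<i> * of_real y / of_real n) = of_real (- 2 * y / n)" for y n :: real
      by (simp_all add: field_simps)
    show ?thesis
    proof (cases "alpha c \<le> 1/2")
      case True
      then have "sin (2 * pi * alpha c) > 0" using a by (intro sin_gt_zero) auto
      then have "2 * Im ?d / (norm (1 + ?d))\<^sup>2 > 0" using im n by simp
      moreover have "\<i> powi (2 * eps c - delta c) * fps_nth (rho ?d) 0 = of_real (2 * Im ?d / (norm (1 + ?d))\<^sup>2)"
      proof -
        have e: "2 * eps c - delta c = 1" using True 3 by (simp add: eps_def delta_other)
        show ?thesis unfolding r e power_int_1_right by (rule g(1))
      qed
      ultimately show ?thesis by blast
    next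
      case False
      then have "sin (2 * pi * alpha c - pi) > 0" using a by (intro sin_gt_zero) (auto simp: algebra_simps)
      then have "sin (2 * pi * alpha c) < 0" by (simp add: sin_diff)
      then have "- 2 * Im ?d / (norm (1 + ?d))\<^sup>2 > 0" using im n by (simp add: divide_neg_pos)
      moreover have "\<i> powi (2 * eps c - delta c) * fps_nth (rho ?d) 0 = of_real (- 2 * Im ?d / (norm (1 + ?d))\<^sup>2)"
      proof -
        have e: "2 * eps c - delta c = - 1" using False 3 by (simp add: eps_def delta_other)
        show ?thesis unfolding r e power_int_minus power_int_1_right by (rule g(2))
      qed
      ultimately show ?thesis by blast
    qed
  qed
qed

context steenbrink
begin

text \<open>
  The weight of the new polarized structure that contains the eigenspace of \<open>c\<close>.
\<close>

definition w1 :: "complex \<Rightarrow> int" where "w1 c = w0 c + delta c"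

lemma w1_eq: "w1 c = m + 1 + theta (- c)"
  by (simp add: w1_def w0_def delta_def)

lemma St_eq: "St a b = S a (form_op b)"
  by (rule tilde_S_eq)

lemma bilinear_St: "bilinear St"
  unfolding bilinear_def St_eq
  using S linear_compose[OF linear_form_op, unfolded comp_def] by (auto simp: bilinear_def)

lemma cform_St: "cform St a b = cform S a (blk rho b)"
  unfolding cmap_form_op[symmetric] by (simp add: cform_def cmap_def St_eq)

lemma St_nondeg: "nondegenerate_on UNIV St"
  unfolding nondegenerate_on_def
proof (intro conjI ballI impI)
  fix x assume "\<forall>y\<in>UNIV. St x y = 0"
  then have "\<forall>y. S x y = 0" unfolding St_eq using bij_form_op by (metis bij_pointE UNIV_I)
  then show "x = 0" using S_nondeg by (simp add: nondegenerate_on_def)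
next
  fix y assume "\<forall>x\<in>UNIV. St x y = 0"
  then have "form_op y = 0" using S_nondeg by (simp add: nondegenerate_on_def St_eq)
  then show "y = 0" using bij_form_op linear_0[OF linear_form_op] by (metis bij_is_inj injD)
qed

lemma St_inv: "St (tilde_M M a) (tilde_M M b) = St a b"
  by (simp add: St_eq tilde_M_def linear_neg[OF linear_form_op] bilinear_lneg[OF S] bilinear_rneg[OF S] form_op_M S_inv)

lemma St_orth: "a \<in> E c \<Longrightarrow> b \<in> E d \<Longrightarrow> c * d \<noteq> 1 \<Longrightarrow> cform St a b = 0"
  unfolding cform_St by (rule form_orth[OF _ blk_E])

lemma St_skew: "cform St (cmap N a) b = - cform St a (cmap N b)"
proof -
  have "blk rho (cmap N b) = cmap N (blk rho b)" unfolding blk_N by (rule blk_swap)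
  then show ?thesis by (simp add: cform_St form_skew)
qed

lemma inverse_cnj: "norm c = 1 \<Longrightarrow> c * d = 1 \<Longrightarrow> d = cnj c"
  by (metis complex_norm_square mult.commute mult_left_cancel mult_zero_left of_real_1 power_one zero_neq_one)

lemma cnj_mult_1: "norm c = 1 \<Longrightarrow> c * cnj c = 1"
  by (metis complex_norm_square of_real_1 power_one)

lemma St_sym:
  assumes a: "a \<in> E c" and b: "b \<in> E d" and cd: "c * d = 1" and c: "norm c = 1"
  shows "cform St a b = (-1) powi w1 c * cform St b a"
proof -
  have d: "d = cnj c" by (rule inverse_cnj[OF c cd])
  let ?q = "cform S a (fop (rho c oo - fps_X) b)"
  have "cform St b a = cform S b (fop (rho c) a)" unfolding cform_St blk_on[OF a] ..
  also have "\<dots> = (-1) powi w0 c * cform S (fop (rho c) a) b"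
    using form_sym[OF b fop_E[OF a]] block_set_inverse(2)[OF cd] cd by (simp add: mult.commute)
  also have "cform S (fop (rho c) a) b = ?q" by (rule cform_fps_op[OF S form_skew])
  finally have 1: "cform St b a = (-1) powi w0 c * ?q" .
  have "cform St a b = cform S a (fop (rho (cnj c)) b)" unfolding cform_St blk_on[OF b] d ..
  also have "\<dots> = (-1) powi delta c * ?q"
    unfolding rho_adjoint[OF c] fps_op_mult[OF nil_N] fps_op_const[OF nil_N] cform_scale_right[OF S] ..
  also have "\<dots> = (-1) powi delta c * ((-1) powi w0 c * (-1) powi w0 c) * ?q"
    unfolding power_int_m1_mult by simp
  also have "\<dots> = (-1) powi w1 c * cform St b a"
    unfolding 1 w1_def by (simp add: power_int_add mult_ac)
  finally show ?thesis .
qed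

text \<open>
  Moving \<open>\<phi>\<close> and \<open>\<rho>\<close> to one argument leaves the constant of \<open>phi_pairing\<close>, and the index shifts of the two
  arguments add up to the shift of the weight.
\<close>

lemma St_F:
  assumes a: "a \<in> Ft p" "a \<in> E c" and b: "b \<in> Ft q" "b \<in> E d" and cd: "c * d = 1" and c: "norm c = 1"
    and pq: "p + q = w1 c + 1"
  shows "cform St a b = 0"
proof -
  have d: "d = cnj c" by (rule inverse_cnj[OF c cd])
  have nd: "norm d = 1" using c d by simp
  have cd': "cnj d = c" using d by simp
  have "a \<in> Fpiece p c" using a Ft_E[OF c] by blast
  then obtain a0 where a0: "a = fop (phi c) a0" "a0 \<in> F (p - eps c)" "a0 \<in> E c" by auto
  have "b \<in> Fpiece q d" using b Ft_E[OF nd] by blast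
  then obtain b0 where b0: "b = fop (phi d) b0" "b0 \<in> F (q - eps d)" "b0 \<in> E d" by auto
  obtain r where r: "(phi c oo - fps_X) * phi d * rho d = fps_const r"
    using phi_pairing[OF nd] unfolding cd' by blast
  have "cform St a b = cform S (fop (phi c) a0) (fop (rho d) (fop (phi d) b0))"
    unfolding cform_St blk_on[OF b(2)] unfolding a0(1) b0(1) ..
  also have "\<dots> = cform S a0 (fop (phi c oo - fps_X) (fop (rho d) (fop (phi d) b0)))"
    by (rule cform_fps_op[OF S form_skew])
  also have "\<dots> = cform S a0 (fop ((phi c oo - fps_X) * phi d * rho d) b0)"
    unfolding fps_op_mult[OF nil_N, symmetric] by (simp only: mult_ac)
  also have "\<dots> = r * cform S a0 b0"
    unfolding r fps_op_const[OF nil_N] cform_scale_right[OF S] ..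
  also have "cform S a0 b0 = 0"
    by (rule form_F[OF a0(2,3) b0(2,3) cd]) (use pq eps_cnj[OF c] d in \<open>simp add: w1_def\<close>)
  finally show ?thesis by simp
qed

text \<open>
  The terms of \<open>\<rho>\<close> with a positive power of \<open>N\<close> lower the weight and contribute nothing, so the new value is
  the old one times the constant of \<open>rho_sign\<close>.
\<close>

lemma St_pos:
  assumes c: "norm c = 1" and a: "a \<in> E c" "a \<in> F_Gr Ft Wt (w1 c + int l) p"
    "cj a \<in> F_Gr Ft Wt (w1 c + int l) (w1 c + int l - p)"
    and prim: "(cmap N ^^ (l + 1)) a \<in> cset (Wt (w1 c - int l - 3))"
  shows "\<exists>t. \<i> powi (2 * p - w1 c - int l) * cform St a ((cmap N ^^ l) (cj a)) = of_real t \<and> t \<ge> 0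
           \<and> (a \<notin> cset (Wt (w1 c + int l - 1)) \<longrightarrow> t > 0)"
proof -
  let ?d = "cnj c" let ?b = "(cmap N ^^ l) (cj a)"
  have nd: "norm ?d = 1" and cd: "c * ?d = 1" using c cnj_mult_1[OF c] by simp_all
  have ca: "cj a \<in> E ?d" by (rule E_cj[OF a(1)])
  have b: "?b \<in> E ?d" by (rule N_pow_E[OF ca])
  have dd: "delta ?d = delta c" using eps_cnj[OF c] eps_cnj[OF nd] by simp
  have ix: "w1 c + int l - delta c = w0 c + int l" "w1 c + int l - p - eps ?d = w0 c + int l - (p - eps c)"
    "w1 c - int l - 3 - delta c = w0 c - int l - 3" "w1 c + int l - 1 - delta c = w0 c + int l - 1"
    using eps_cnj[OF c] by (simp_all add: w1_def)
  have a': "a \<in> F_Gr F W (w0 c + int l) (p - eps c)"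
    using F_Gr_E[OF c, of "w1 c + int l" p] a unfolding ix by blast
  have ca': "cj a \<in> F_Gr F W (w0 c + int l) (w0 c + int l - (p - eps c))"
    using F_Gr_E[OF nd, of "w1 c + int l" "w1 c + int l - p"] a(3) ca unfolding dd ix by blast
  have prim': "(cmap N ^^ (l + 1)) a \<in> cset (W (w0 c - int l - 3))"
    using Wt_E[of "w1 c - int l - 3" c] prim N_pow_E[OF a(1)] unfolding ix by blast
  have nz: "a \<in> cset (Wt (w1 c + int l - 1)) \<longleftrightarrow> a \<in> cset (W (w0 c + int l - 1))"
    using Wt_E[of "w1 c + int l - 1" c] a(1) unfolding ix by blast
  have aW: "a \<in> cset (W (w0 c + int l))" using a' F_Gr_le by blast
  have bW: "?b \<in> cset (W (w0 c + int l - 2 * int l))" by (rule N_pow_cW) (simp add: cW_cj aW)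
  let ?t0 = "fps_nth (rho ?d) 0" and ?g = "fop (fps_shift 1 (rho ?d)) ?b"
  have g: "cmap N ?g \<in> cset (W (w0 c + int l - 2 * int l - 2))" "cmap N ?g \<in> E ?d"
    by (intro N_cW fop_cW bW, intro N_gen fop_E b)
  have "cform St a ?b = cform S a (cscale ?t0 ?b + cmap N ?g)"
    unfolding cform_St blk_on[OF b] by (subst fps_op_tail[OF nil_N]) (rule refl)
  also have "\<dots> = ?t0 * cform S a ?b"
    using form_W[OF aW a(1) g cd] by (simp add: cform_add_right[OF S] cform_scale_right[OF S])
  finally have Sb: "cform St a ?b = ?t0 * cform S a ?b" .
  obtain t where t: "t > 0" "\<i> powi (2 * eps c - delta c) * ?t0 = of_real t" using rho_sign[OF c] by blast
  let ?y = "\<i> powi (2 * (p - eps c) - w0 c - int l) * cform S a ?b"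
  have e: "2 * p - w1 c - int l = (2 * eps c - delta c) + (2 * (p - eps c) - w0 c - int l)" by (simp add: w1_def)
  have ii: "\<i> powi (2 * p - w1 c - int l) = \<i> powi (2 * eps c - delta c) * \<i> powi (2 * (p - eps c) - w0 c - int l)"
    unfolding e by (rule power_int_add) simp
  have "\<i> powi (2 * p - w1 c - int l) * cform St a ?b = (\<i> powi (2 * eps c - delta c) * ?t0) * ?y"
    unfolding Sb ii by (simp only: mult_ac)
  then have z: "\<i> powi (2 * p - w1 c - int l) * cform St a ?b = of_real t * ?y" unfolding t(2) .
  show ?thesis
  proof (cases "a \<in> cset (W (w0 c + int l - 1))")
    case True
    have "cform S a ?b = 0" by (rule form_W[OF True a(1) bW b cd]) simp
    then show ?thesis using z nz True by (intro exI[of _ 0]) simp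
  next
    case False
    have "?y \<in> \<real>" "Re ?y > 0" using positivity[OF a(1) a' ca' prim' False] by simp_all
    from this(1) obtain y where y1: "?y = of_real y" by (rule Reals_cases)
    have "y > 0" using \<open>Re ?y > 0\<close> unfolding y1 by (simp only: Re_complex_of_real)
    note y = y1 this
    show ?thesis unfolding z y(1) using t(1) y(2) by (intro exI[of _ "t * y"]) simp
  qed
qed

lemma cform_St_part:
  assumes a: "a \<in> E c" and c: "norm c = 1"
  shows "cform St a b = cform St a (P (cnj c) b)"
proof -
  have "cform St a b = (\<Sum>d\<in>spectrum (cmap M). cform St a (P d b))"
    by (simp add: eig_part_sum flip: cform_sum_right[OF bilinear_St])
  also have "\<dots> = (\<Sum>d\<in>spectrum (cmap M). if d = cnj c then cform St a (P (cnj c) b) else 0)"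
  proof (rule sum.cong[OF refl])
    fix d
    show "cform St a (P d b) = (if d = cnj c then cform St a (P (cnj c) b) else 0)"
      using St_orth[OF a eig_part_in, of d b] inverse_cnj[OF c, of d] by auto
  qed
  also have "\<dots> = cform St a (P (cnj c) b)"
    using finite_spectrum eig_part_not_spectrum[of "cnj c" b] by (auto simp: cform_0_right[OF bilinear_St])
  finally show ?thesis .
qed

text \<open>
  Each condition is bilinear, or splits into the eigenspaces, and only the pairs of eigenspaces for \<open>c\<close> and
  \<open>cnj c\<close> contribute. The two polarized structures of \<open>- M\<close> are instances.
\<close>

lemma pmhs_tilde:
  assumes C: "\<And>c. c \<in> C \<Longrightarrow> cnj c \<in> C" and w: "\<And>c. c \<in> C \<Longrightarrow> w1 c = w"
    and weight: "is_weight_filtration (real_points (D C)) N w (\<lambda>k. Wt k \<inter> real_points (D C))"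
  shows "pmhs w (real_points (D C)) (\<lambda>p. Ft p \<inter> D C) (\<lambda>k. Wt k \<inter> real_points (D C)) N St"
proof -
  let ?V = "real_points (D C)"
  note B = bilinear_St
  have mhs': "mhs ?V (\<lambda>p. Ft p \<inter> D C) (\<lambda>k. Wt k \<inter> ?V)"
    by (rule mhs_restrict[OF _ gr_Ft gr_Wt mhs_t]) (rule C)
  have NV: "N ` ?V \<subseteq> ?V" using real_block_proj_id[OF C] real_block_proj_in[OF C] real_block_proj_N[OF C] by (metis image_subsetI)
  have nil: "nilpotent_on ?V N"
  proof -
    have "(N ^^ dim (UNIV :: 'a set)) x = 0" for x
      using nil_op_pow[OF nil_N order_refl, of "(x, 0)"] by (simp add: cmap_pow cmap_def zero_prod_def)
    then show ?thesis unfolding nilpotent_on_def by blast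
  qed
  have toV: "x \<in> ?V \<longleftrightarrow> (x, 0) \<in> D C" for x by (simp add: real_points_def)
  have sum2: "cform St a b = (\<Sum>c\<in>spectrum (cmap M). \<Sum>d\<in>spectrum (cmap M). cform St (P c a) (P d b))" for a b
    by (rule biadditive_sum) (simp_all add: cform_add_left[OF B] cform_add_right[OF B])
  have compl: "cform St a b = 0" if ab: "a \<in> D C \<and> b \<in> D (- C) \<or> a \<in> D (- C) \<and> b \<in> D C" for a b
    unfolding sum2[of a b]
  proof (intro sum.neutral ballI)
    fix c d assume "c \<in> spectrum (cmap M)" "d \<in> spectrum (cmap M)"
    then have c: "norm c = 1" using norm_spectrum by blast
    show "cform St (P c a) (P d b) = 0"
    proof (cases "c * d = 1")
      case True
      then have "d \<in> C \<longleftrightarrow> c \<in> C" using inverse_cnj[OF c True] C_cnj[OF C] by simp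
      then have "P c a = 0 \<or> P d b = 0" using ab by (auto simp: direct_part_iff)
      then show ?thesis by (auto simp: cform_0_left[OF B] cform_0_right[OF B])
    qed (rule St_orth[OF eig_part_in eig_part_in])
  qed
  have split: "(y, 0) - block_proj C (y, 0) \<in> D (- C)" for y :: 'a
    by (simp add: direct_part_iff clin_diff[OF clin_eig_part] P_block_proj)
  have split': "(y, 0) - block_proj C (y, 0) = (y - real_block_proj C y, 0)" for y :: 'a by (simp add: block_proj_real[OF C])
  have rest: "St x y = St x (real_block_proj C y)" "St y x = St (real_block_proj C y) x" if "x \<in> ?V" for x y
  proof -
    have "(y - real_block_proj C y, 0) \<in> D (- C)" using split[of y] unfolding split' .
    then have "cform St (x, 0) (y - real_block_proj C y, 0) = 0" "cform St (y - real_block_proj C y, 0) (x, 0) = 0"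
      using compl[of "(x, 0)" "(y - real_block_proj C y, 0)"] compl[of "(y - real_block_proj C y, 0)" "(x, 0)"] that toV by blast+
    then show "St x y = St x (real_block_proj C y)" "St y x = St (real_block_proj C y) x"
      by (simp_all add: cform_real[OF B] bilinear_rsub[OF B] bilinear_lsub[OF B])
  qed
  have nd: "nondegenerate_on ?V St"
    unfolding nondegenerate_on_def
  proof (intro conjI ballI impI)
    fix x assume x: "x \<in> ?V" "\<forall>y\<in>?V. St x y = 0"
    then have "St x y = 0" for y using rest(1)[OF x(1), of y] real_block_proj_in[OF C] by simp
    then show "x = 0" using St_nondeg by (simp add: nondegenerate_on_def)
  next
    fix x assume x: "x \<in> ?V" "\<forall>y\<in>?V. St y x = 0"
    then have "St y x = 0" for y using rest(2)[OF x(1), of y] real_block_proj_in[OF C] by simp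
    then show "x = 0" using St_nondeg by (simp add: nondegenerate_on_def)
  qed
  have symc: "cform St a b = (-1) powi w * cform St b a" if ab: "a \<in> D C" "b \<in> D C" for a b
  proof -
    have "cform St (P c a) (P d b) = (-1) powi w * cform St (P d b) (P c a)"
      if cd: "c \<in> spectrum (cmap M)" "d \<in> spectrum (cmap M)" for c d
    proof (cases "c * d = 1")
      case True
      have c: "norm c = 1" by (rule norm_spectrum[OF cd(1)])
      show ?thesis
      proof (cases "c \<in> C")
        case in_C: True
        show ?thesis using St_sym[OF eig_part_in eig_part_in True c] w[OF in_C] by simp
      next
        case False
        then have "P c a = 0" using ab by (simp add: direct_part_iff)
        then show ?thesis by (simp add: cform_0_left[OF B] cform_0_right[OF B])
      qed
    next
      case False
      then have "d * c \<noteq> 1" by (simp add: mult.commute)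
      then show ?thesis using St_orth[OF eig_part_in eig_part_in] False by simp
    qed
    then have "cform St a b = (\<Sum>c\<in>spectrum (cmap M). \<Sum>d\<in>spectrum (cmap M). (-1) powi w * cform St (P d b) (P c a))"
      unfolding sum2[of a b] by (intro sum.cong refl) blast
    also have "\<dots> = (-1) powi w * (\<Sum>d\<in>spectrum (cmap M). \<Sum>c\<in>spectrum (cmap M). cform St (P d b) (P c a))"
      by (subst sum.swap) (simp add: sum_distrib_left)
    finally show ?thesis unfolding sum2[of b a] .
  qed
  have sym: "\<forall>a\<in>?V. \<forall>b\<in>?V. St a b = (-1) powi w * St b a"
  proof (intro ballI)
    fix x y assume "x \<in> ?V" "y \<in> ?V"
    then have "cform St (x, 0) (y, 0) = (-1) powi w * cform St (y, 0) (x, 0)"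
      using symc toV by blast
    then have "complex_of_real (St x y) = of_real ((-1) powi w * St y x)" by (simp add: cform_real[OF B])
    then show "St x y = (-1) powi w * St y x" by (simp only: of_real_eq_iff)
  qed
  have skew: "\<forall>a\<in>?V. \<forall>b\<in>?V. St (N a) b + St a (N b) = 0"
  proof (intro ballI)
    fix x y
    have "cmap N (z, 0) = (N z, 0)" for z by (simp add: cmap_def linear_0[OF linear_N])
    then have "complex_of_real (St (N x) y) = of_real (- St x (N y))"
      using St_skew[of "(x, 0)" "(y, 0)"] by (simp add: cform_real[OF B])
    then show "St (N x) y + St x (N y) = 0" by (simp only: of_real_eq_iff)
  qed
  have NF: "\<forall>p. cmap N ` (Ft p \<inter> D C) \<subseteq> Ft (p - 1) \<inter> D C"
  proof (intro allI image_subsetI IntI)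
    fix p x assume x: "x \<in> Ft p \<inter> D C"
    then show "cmap N x \<in> Ft (p - 1)" by (intro N_Ft) simp
    show "cmap N x \<in> D C" using x by (simp add: direct_part_iff P_N clin_0[OF clin_N])
  qed
  have SF: "\<forall>p. \<forall>a\<in>Ft p \<inter> D C. \<forall>b\<in>Ft (w + 1 - p) \<inter> D C. cform St a b = 0"
  proof (intro allI ballI)
    fix p a b assume a: "a \<in> Ft p \<inter> D C" and b: "b \<in> Ft (w + 1 - p) \<inter> D C"
    show "cform St a b = 0"
      unfolding sum2[of a b]
    proof (intro sum.neutral ballI)
      fix c d assume cd: "c \<in> spectrum (cmap M)" "d \<in> spectrum (cmap M)"
      have c: "norm c = 1" by (rule norm_spectrum[OF cd(1)])
      show "cform St (P c a) (P d b) = 0"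
      proof (cases "c \<in> C \<and> c * d = 1")
        case True
        show ?thesis
          by (rule St_F[of _ p c _ "w + 1 - p" d])
             (use a b True c w[of c] graded_part[OF gr_Ft] eig_part_in in auto)
      next
        case False
        then show ?thesis
          using St_orth[OF eig_part_in eig_part_in, of c d a b] a
          by (cases "c * d = 1") (auto simp: direct_part_iff cform_0_left[OF B])
      qed
    qed
  qed
  have cW: "cset (Wt k \<inter> ?V) = cset (Wt k) \<inter> D C" for k by (simp add: cset_Int cset_D'[OF C])
  have FG: "F_Gr (\<lambda>p. Ft p \<inter> D C) (\<lambda>k. Wt k \<inter> ?V) k p = F_Gr Ft Wt k p \<inter> D C" for k p
    by (rule F_Gr_D[OF _ gr_Ft gr_Wt]) (rule C)
  have pos: "let z = \<i> powi (2 * p - w - int l) * cform St a ((cmap N ^^ l) (cj a)) in z \<in> \<real> \<and> Re z > 0"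
    if a: "a \<in> (F_Gr Ft Wt (w + int l) p \<inter> D C \<inter> primitive (\<lambda>k. Wt k \<inter> ?V) N w l) \<inter>
            cj ` (F_Gr Ft Wt (w + int l) (w + int l - p) \<inter> D C \<inter> primitive (\<lambda>k. Wt k \<inter> ?V) N w l)"
    and nz: "a \<notin> cset (Wt (w + int l - 1)) \<inter> D C" for l p a
  proof -
    let ?Sp = "spectrum (cmap M)"
    let ?z = "\<lambda>a. \<i> powi (2 * p - w - int l) * cform St a ((cmap N ^^ l) (cj a))"
    have aD: "a \<in> D C" and aF: "a \<in> F_Gr Ft Wt (w + int l) p"
      and cF: "cj a \<in> F_Gr Ft Wt (w + int l) (w + int l - p)"
      and prim: "(cmap N ^^ (l + 1)) a \<in> cset (Wt (w - int l - 3))"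
      using a by (auto simp: cj_in_image primitive_def cW)
    have ex: "\<exists>t. ?z (P c a) = of_real t \<and> t \<ge> 0 \<and> (P c a \<notin> cset (Wt (w + int l - 1)) \<longrightarrow> t > 0)"
      if cS: "c \<in> ?Sp" for c
    proof (cases "c \<in> C")
      case True
      have Pcj: "cj (P c a) = P (cnj c) (cj a)" by (simp add: P_cj)
      have PN: "(cmap N ^^ (l + 1)) (P c a) = P c ((cmap N ^^ (l + 1)) a)"
        by (rule comm_pow[of "cmap N" "P c"]) (simp add: P_N)
      have "cj (P c a) \<in> F_Gr Ft Wt (w + int l) (w + int l - p)"
        unfolding Pcj by (rule graded_part[OF gr_F_Gr_t cF])
      moreover have "(cmap N ^^ (l + 1)) (P c a) \<in> cset (Wt (w - int l - 3))"
        unfolding PN by (rule graded_part[OF gr_Wt prim])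
      ultimately show ?thesis
        using St_pos[OF norm_spectrum[OF cS] eig_part_in, of a l p] graded_part[OF gr_F_Gr_t aF, of c]
        unfolding w[OF True] by blast
    next
      case False
      then have "P c a = 0" using aD by (simp add: direct_part_iff)
      then show ?thesis using cplx.subspace_0[OF cWt_sub]
        by (intro exI[of _ 0]) (simp add: cform_0_left[OF B])
    qed
    have "\<exists>t. \<forall>c\<in>?Sp. ?z (P c a) = of_real (t c) \<and> t c \<ge> 0 \<and> (P c a \<notin> cset (Wt (w + int l - 1)) \<longrightarrow> t c > 0)"
      by (rule bchoice) (use ex in blast)
    then obtain t where t: "\<forall>c\<in>?Sp. ?z (P c a) = of_real (t c) \<and> t c \<ge> 0 \<and> (P c a \<notin> cset (Wt (w + int l - 1)) \<longrightarrow> t c > 0)"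
      by (rule exE)
    have "cform St a ((cmap N ^^ l) (cj a)) = (\<Sum>c\<in>?Sp. cform St (P c a) ((cmap N ^^ l) (cj a)))"
      by (simp add: eig_part_sum flip: cform_sum_left[OF B])
    also have "\<dots> = (\<Sum>c\<in>?Sp. cform St (P c a) ((cmap N ^^ l) (cj (P c a))))"
    proof (rule sum.cong[OF refl])
      fix c assume c: "c \<in> ?Sp"
      have "P (cnj c) ((cmap N ^^ l) (cj a)) = (cmap N ^^ l) (P (cnj c) (cj a))"
        by (rule comm_pow2[of "P (cnj c)" "cmap N"]) (rule P_N)
      then show "cform St (P c a) ((cmap N ^^ l) (cj a)) = cform St (P c a) ((cmap N ^^ l) (cj (P c a)))"
        using cform_St_part[OF eig_part_in norm_spectrum[OF c], of a "(cmap N ^^ l) (cj a)"] by (simp add: P_cj)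
    qed
    finally have "?z a = (\<Sum>c\<in>?Sp. ?z (P c a))" by (simp add: sum_distrib_left)
    also have "\<dots> = (\<Sum>c\<in>?Sp. of_real (t c))" using t by (intro sum.cong) auto
    finally have z: "?z a = of_real (\<Sum>c\<in>?Sp. t c)" by simp
    have "\<exists>c\<in>?Sp. P c a \<notin> cset (Wt (w + int l - 1))"
    proof (rule ccontr)
      assume "\<not> ?thesis"
      then have "(\<Sum>c\<in>?Sp. P c a) \<in> cset (Wt (w + int l - 1))" by (intro cplx.subspace_sum cWt_sub) blast
      then show False using nz aD by (simp add: eig_part_sum)
    qed
    then obtain c where "c \<in> ?Sp" "t c > 0" using t by blast
    then have "(\<Sum>c\<in>?Sp. t c) > 0" using t by (intro sum_pos2[OF finite_spectrum]) auto
    then show ?thesis unfolding Let_def z by simp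
  qed
  have posall: "\<forall>(l::nat) p. \<forall>a \<in> (F_Gr (\<lambda>p. Ft p \<inter> D C) (\<lambda>k. Wt k \<inter> ?V) (w + int l) p \<inter> primitive (\<lambda>k. Wt k \<inter> ?V) N w l) \<inter>
                    cj ` (F_Gr (\<lambda>p. Ft p \<inter> D C) (\<lambda>k. Wt k \<inter> ?V) (w + int l) (w + int l - p) \<inter> primitive (\<lambda>k. Wt k \<inter> ?V) N w l).
        a \<notin> cset (Wt (w + int l - 1) \<inter> ?V) \<longrightarrow>
        (let z = \<i> powi (2 * p - w - int l) * cform St a ((cmap N ^^ l) (cj a)) in z \<in> \<real> \<and> Re z > 0)"
    unfolding FG cW by (intro allI ballI impI) (rule pos)
  show ?thesis
    unfolding pmhs_def
    by (intro conjI) (fact mhs' linear_N NV nil weight B nd sym skew NF SF posall)+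
qed

lemma steenbrink_pmhs_tilde: "steenbrink_pmhs (tilde X)"
proof -
  have t: "wt (tilde X) = m + 1" "FF (tilde X) = Ft" "WW (tilde X) = Wt" "MM (tilde X) = tilde_M M" "SS (tilde X) = St"
    by (simp_all add: tilde_def)
  have 1: "pmhs (m + 1) Vt (\<lambda>p. Ft p \<inter> D (- {-1})) (\<lambda>k. Wt k \<inter> Vt) N St"
    by (rule pmhs_tilde[OF single_cnj(4) _ weight_Vt]) (auto simp: w1_eq theta_def, metis minus_minus)
  have 2: "pmhs (m + 2) Vm (\<lambda>p. Ft p \<inter> D {-1}) (\<lambda>k. Wt k \<inter> Vm) N St"
    by (rule pmhs_tilde[OF single_cnj(2) _ weight_Vm]) (auto simp: w1_eq theta_def)
  have e: "m + 1 + 1 = m + 2" by simp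
  show ?thesis
    unfolding steenbrink_pmhs_def t eigsp_ne1_tilde eigsp_1_tilde N_tilde e
    using steenbrink_mhs_t bilinear_St St_nondeg St_inv 1 2 by blast
qed

text \<open>
  With \<open>\<beta> = alpha c + n\<close> the right-hand side is \<open>k - n - 1\<close>. Adding \<open>1/2\<close> to \<open>k - \<beta>\<close>
  reaches the next integer exactly when \<open>alpha c \<le> 1/2\<close>.
\<close>

lemma floor_shift:
  assumes "unit_exp \<beta> = c"
  shows "\<lfloor>of_int (k + 1) - (\<beta> + 1/2)\<rfloor> - eps c = \<lfloor>of_int k - \<beta>\<rfloor>"
proof -
  have c: "norm c = 1" using assms norm_unit_exp by blast
  then have "unit_exp \<beta> = unit_exp (alpha c)" using assms alpha(3) by simp
  then obtain n :: int where n: "\<beta> = alpha c + of_int n" using unit_exp_eq_iff by blast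
  have a: "0 < alpha c" "alpha c \<le> 1" using alpha[OF c] by auto
  have "\<lfloor>of_int k - \<beta>\<rfloor> = k - n - 1" unfolding n using a by (intro floor_unique) auto
  moreover have "\<lfloor>of_int (k + 1) - (\<beta> + 1/2)\<rfloor> = k - n - 1 + eps c"
    unfolding n eps_def using a by (intro floor_unique) (auto split: if_splits)
  ultimately show ?thesis by simp
qed

lemma F_Gr_eig_tilde:
  assumes "norm c = 1"
  shows "F_Gr_eig (tilde X) (- c) k p = F_Gr_eig X c (k - delta c) (p - eps c)"
proof -
  have e: "k - 1 - delta c = k - delta c - 1" by simp
  show ?thesis using F_Gr_piece[OF assms, of p k] unfolding e
    by (simp add: F_Gr_eig_def tilde_def eigsp_tilde eigsp_eq)
qed

lemma spp_tilde: "spp (tilde X) = spp_shift (1/2, 1) (spp X)"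
proof
  fix x :: "real \<times> int"
  obtain \<alpha> k where x: "x = (\<alpha>, k)" by fastforce
  define \<beta> where "\<beta> = \<alpha> - 1/2"
  define c where "c = unit_exp \<beta>"
  have c: "norm c = 1" unfolding c_def by (rule norm_unit_exp)
  have ea: "unit_exp \<alpha> = - c" using unit_exp_half(1)[of \<beta>] by (simp add: c_def \<beta>_def)
  let ?p = "\<lfloor>of_int (m + 1) - \<alpha>\<rfloor>" and ?q = "\<lfloor>of_int m - \<beta>\<rfloor>"
  have p: "?p - eps c = ?q" "?p + 1 - eps c = ?q + 1"
    using floor_shift[of \<beta> c m] by (simp_all add: c_def \<beta>_def)
  have k: "k + theta (- c) - delta c = k - 1 + theta c" by (simp add: delta_def)
  have "spp (tilde X) (\<alpha>, k) = cplx.dim (F_Gr_eig (tilde X) (- c) (k + theta (- c)) ?p) - cplx.dim (F_Gr_eig (tilde X) (- c) (k + theta (- c)) (?p + 1))"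
    unfolding spp_def prod.case Let_def ea by (simp add: tilde_def)
  also have "\<dots> = cplx.dim (F_Gr_eig X c (k - 1 + theta c) ?q) - cplx.dim (F_Gr_eig X c (k - 1 + theta c) (?q + 1))"
    unfolding F_Gr_eig_tilde[OF c] p k ..
  also have "\<dots> = spp X (\<beta>, k - 1)" unfolding spp_def prod.case Let_def c_def ..
  finally show "spp (tilde X) x = spp_shift (1/2, 1) (spp X) x"
    by (simp add: spp_shift_def x \<beta>_def)
qed

end

theorem theorem4p6:
  fixes X :: "'a::real_vector steenbrink_data"
  assumes "finite_dimensional (UNIV :: 'a set)"
    and "steenbrink_pmhs X"
  shows "semisimple_part (MM (tilde X)) = (\<lambda>x. - semisimple_part (MM X) x)
       \<and> log_unipotent (MM (tilde X)) = log_unipotent (MM X)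
       \<and> (\<forall>c. eigsp (MM (tilde X)) c = eigsp (MM X) (- c))
       \<and> wt (tilde X) = wt X + 1
       \<and> steenbrink_pmhs (tilde X)
       \<and> spp (tilde X) = spp_shift (1/2, 1) (spp X)
       \<and> seifert_normalized (MM (tilde X)) (SS (tilde X)) = seifert_normalized (MM X) (SS X)
       \<and> MM (tilde (tilde X)) = MM X
       \<and> SS (tilde (tilde X)) = SS X
       \<and> wt (tilde (tilde X)) = wt X + 2
       \<and> (\<forall>k. WW (tilde (tilde X)) k = WW X (k - 2))
       \<and> (\<forall>p. FF (tilde (tilde X)) p = FF X (p - 1))"
proof -
  interpret X: steenbrink X by (rule steenbrink.intro) (rule assms)+
  have pm: "steenbrink_pmhs (tilde X)" by (rule X.steenbrink_pmhs_tilde)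
  interpret Y: steenbrink "tilde X" by (rule steenbrink.intro[OF assms(1) pm])
  have t: "wt (tilde X) = wt X + 1" "FF (tilde X) = X.Ft" "WW (tilde X) = X.Wt"
    "MM (tilde X) = tilde_M (MM X)" "SS (tilde X) = X.St"
    by (simp_all add: tilde_def)
  have tt: "wt (tilde (tilde X)) = wt X + 2" "FF (tilde (tilde X)) = Y.Ft" "WW (tilde (tilde X)) = Y.Wt"
    "MM (tilde (tilde X)) = tilde_M (tilde_M (MM X))" "SS (tilde (tilde X)) = Y.St"
    by (simp_all add: tilde_def)
  have EY: "Y.E c = X.E (- c)" for c unfolding t by (rule X.gen_eig_tilde)
  have grY: "graded (cmap (MM (tilde X))) A = X.gr A" for A unfolding t by (rule X.graded_tilde)
  have fopY: "Y.fop f = X.fop f" for f unfolding t X.N_tilde ..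
  have L: "seifert_normalized (MM (tilde X)) (SS (tilde X)) = seifert_normalized (MM X) (SS X)"
  proof (intro ext)
    fix a b
    have "seifert_normalized (MM (tilde X)) (SS (tilde X)) a b = - SS (tilde X) a (Y.kappa b)"
      by (rule Y.seifert_eq)
    also have "\<dots> = - X.St a (Y.kappa b)" by (simp only: t(5))
    also have "\<dots> = seifert_normalized (MM X) (SS X) a (nu (log_unipotent (MM X)) (tilde_M (MM X)) (Y.kappa b))"
      by (simp add: tilde_S_def)
    also have "nu (log_unipotent (MM X)) (tilde_M (MM X)) = inv Y.kappa"
      using Y.nu_eq by (simp only: t X.N_tilde)
    also have "inv Y.kappa (Y.kappa b) = b" by (rule inv_f_f[OF bij_is_inj[OF Y.bij_kappa]])
    finally show "seifert_normalized (MM (tilde X)) (SS (tilde X)) a b = seifert_normalized (MM X) (SS X) a b" .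
  qed
  have S: "SS (tilde (tilde X)) = SS X"
  proof (intro ext)
    fix a b
    have "cmap X.form_op (cmap Y.form_op v) = v" for v
    proof -
      have "cmap Y.form_op v = X.blk (\<lambda>c. rho (- c)) v"
        unfolding Y.cmap_form_op by (simp only: t X.blk_tilde)
      then have "cmap X.form_op (cmap Y.form_op v) = X.blk (\<lambda>c. rho c * rho (- c)) v"
        by (simp only: X.cmap_form_op X.blk_mult)
      then show ?thesis using rho_neg by (simp add: mult.commute X.blk_1)
    qed
    from this[of "(b, 0)"] have "X.form_op (Y.form_op b) = b" by (simp add: cmap_def)
    then show "SS (tilde (tilde X)) a b = SS X a b" unfolding tt Y.St_eq unfolding t X.St_eq by simp
  qed
  have W: "WW (tilde (tilde X)) k = WW X (k - 2)" for k
  proof (rule cset_inject, rule X.graded_eqI)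
    show "X.gr (cset (WW (tilde (tilde X)) k))" unfolding tt grY[symmetric] by (rule Y.gr_Wt)
    show "X.gr (cset (WW X (k - 2)))" by (rule X.gr_W)
    fix c
    have e: "k - delta (- c) - delta c = k - 2" using delta_neg[of c] by simp
    have "cset (Y.Wt k) \<inter> Y.E (- c) = cset (WW (tilde X) (k - delta (- c))) \<inter> Y.E (- c)" by (rule Y.Wt_E)
    then have "cset (Y.Wt k) \<inter> X.E c = cset (X.Wt (k - delta (- c))) \<inter> X.E c"
      unfolding EY unfolding t by simp
    then show "cset (WW (tilde (tilde X)) k) \<inter> X.E c = cset (WW X (k - 2)) \<inter> X.E c"
      unfolding tt X.Wt_E e .
  qed
  have F: "FF (tilde (tilde X)) p = FF X (p - 1)" for p
  proof (rule X.graded_eqI')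
    show "X.gr (FF (tilde (tilde X)) p)" unfolding tt grY[symmetric] by (rule Y.gr_Ft)
    show "X.gr (FF X (p - 1))" by (rule X.gr_F)
    fix c assume "c \<in> spectrum (cmap (MM X))"
    then have c: "norm c = 1" "norm (- c) = 1" using X.norm_spectrum[of c] by auto
    have e: "p - eps (- c) - eps c = p - 1" using eps_neg[OF c(1)] by simp
    have "Y.Ft p \<inter> Y.E (- c) = Y.fop (phi (- c)) ` (FF (tilde X) (p - eps (- c)) \<inter> Y.E (- c))"
      by (rule Y.Ft_E[OF c(2)])
    then have "Y.Ft p \<inter> X.E c = X.fop (phi (- c)) ` (X.Ft (p - eps (- c)) \<inter> X.E c)"
      unfolding EY fopY unfolding t by simp
    also have "\<dots> = X.fop (phi (- c) * phi c) ` (FF X (p - 1) \<inter> X.E c)"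
      unfolding X.Ft_E[OF c(1)] e image_image fps_op_mult[OF X.nil_N] ..
    also have "\<dots> = FF X (p - 1) \<inter> X.E c"
      unfolding phi_neg[OF c(1)] by (simp add: fps_op_1[OF X.nil_N])
    finally show "FF (tilde (tilde X)) p \<inter> X.E c = FF X (p - 1) \<inter> X.E c" unfolding tt .
  qed
  have MM': "MM (tilde (tilde X)) = MM X" by (simp add: tt tilde_M_def fun_eq_iff)
  show ?thesis
    using X.semisimple_part_tilde X.N_tilde X.eigsp_tilde t(1) pm X.spp_tilde L MM' S tt(1) W F
    unfolding t(4) by blast
qed

end
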